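(* Let $\beta>0$ and let $h^I:H^{-s}\to\mathbb{R}$ be a Borel function such that $h^I\in\mathbb{D}^{1,2}(\mu_{\beta,0})$ and $e^{-\beta h^I}\in L^2(\mu_{\beta,0})$ (hence also $e^{-\beta h^I}\in L^1(\mu_{\beta,0})$). Let $\mu$ be a Borel probability measure on $H^{-s}$ which is absolutely continuous with respect to $\mu_{\beta,0}$, with non-negative density $\varrho=\frac{d\mu}{d\mu_{\beta,0}}\in L^1(\mu_{\beta,0})$, and assume that $\varrho\in\mathbb{D}^{1,2}(\mu_{\beta,0})$. Then $\mu$ is a $(\beta,X)$-KMS state for the vector field $X(u)=-iAu-i\nabla h^I(u)$ if and only if $\mu$ is equal to the Gibbs measure $$\mu_\beta=\frac{e^{-\beta h^I}\,\mu_{\beta,0}}{\int_{H^{-s}}e^{-\beta h^I}\,d\mu_{\beta,0}}.$$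
   Context: Setting. $H$ is an infinite-dimensional separable complex Hilbert space with inner product $\langle\cdot,\cdot\rangle$ antilinear in the left variable, and $\langle\cdot,\cdot\rangle_{H,\mathbb{R}}=\mathrm{Re}\langle\cdot,\cdot\rangle$. $A$ is a positive self-adjoint operator on $H$ with $A\ge c\,\mathds{1}$ for some $c>0$ and compact resolvent; $\{e_j\}_{j\ge1}$ is an orthonormal basis of $H$ with $Ae_j=\lambda_je_j$, and $f_j=ie_j$, so $\{e_j,f_j\}_j$ is an orthonormal basis of $H$ as a real Hilbert space. Fix $s\ge0$ with $\sum_j\lambda_j^{-(1+s)}<\infty$. $H^s=D(A^{s/2})$ with $\langle x,y\rangle_{H^s}=\langle A^{s/2}x,A^{s/2}y\rangle$, and $H^{-s}$ is the completion of $H$ for $\langle x,y\rangle_{H^{-s}}=\langle A^{-s/2}x,A^{-s/2}y\rangle$. $\langle\cdot,\cdot\rangle_{H,\mathbb{R}}$ extends to the real duality pairing between $H^{-s}$ and $H^s$; we also write $\langle\cdot,\cdot\rangle$ for it when pairing gradients with vectors. Gaussian measure. $\mu_{\beta,0}$ is the centered Gaussian Borel probability measure on $H^{-s}$ with $\int e^{i\langle w,u\rangle_{H,\mathbb{R}}}d\mu_{\beta,0}(u)=e^{-\frac1{2\beta}\langle w,A^{-1}w\rangle}$ for $w\in H^s$. Cylindrical functions. $\pi_n(u)=(\langle u,e_1\rangle_{H,\mathbb{R}},\dots,\langle u,e_n\rangle_{H,\mathbb{R}};\langle u,f_1\rangle_{H,\mathbb{R}},\dots,\langle u,f_n\rangle_{H,\mathbb{R}})\in\mathbb{R}^{2n}$.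 $\mathscr{C}^\infty_{c,cyl}(H^{-s})$ is the set of $F=\varphi\circ\pi_n$ with $n\in\mathbb{N}$, $\varphi\in\mathscr{C}_c^\infty(\mathbb{R}^{2n})$. Let $\partial_{e_j}F,\partial_{f_j}F$ be the directional derivatives; $\nabla F=\sum_j\partial_{e_j}F\,e_j+\partial_{f_j}F\,f_j$; $\{F,G\}=\sum_j\big(\partial_{e_j}F\,\partial_{f_j}G-\partial_{e_j}G\,\partial_{f_j}F\big)$ (finite sums). Malliavin derivative. For $p\in[1,\infty)$, $\nabla$ with domain $\mathscr{C}^\infty_{c,cyl}(H^{-s})\subset L^p(\mu_{\beta,0})$ and values in $L^p(\mu_{\beta,0};H^{-s})$ is closable; $\mathbb{D}^{1,p}(\mu_{\beta,0})$ is the domain of its closure, i.e. the $F\in L^p(\mu_{\beta,0})$ for which there are $F_n\in\mathscr{C}^\infty_{c,cyl}(H^{-s})$ with $F_n\to F$ in $L^p(\mu_{\beta,0})$ and $\nabla F_n$ convergent in $L^p(\mu_{\beta,0};H^{-s})$; the limit is denoted $\nabla F$. KMS. A Borel probability measure $\mu$ on $H^{-s}$ is a $(\beta,X)$-KMS state for $X(u)=-iAu-i\nabla h^I(u)$ if for all $F,G\in\mathscr{C}^\infty_{c,cyl}(H^{-s})$ $$\int\{F,G\}\,d\mu=\beta\int\mathrm{Re}\langle\nabla F(u),-iAu-i\nabla h^I(u)\rangle\,G(u)\,d\mu,$$ where $\mathrm{Re}\langle\nabla F(u),-iAu\rangle=\sum_j\lambda_j\big(\partial_{e_j}F\,\langle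 u,f_j\rangle_{H,\mathbb{R}}-\partial_{f_j}F\,\langle u,e_j\rangle_{H,\mathbb{R}}\big)$ and $\mathrm{Re}\langle\nabla F,-i\nabla h^I\rangle=\sum_j\big(\partial_{e_j}F\,\langle\nabla h^I,f_j\rangle-\partial_{f_j}F\,\langle\nabla h^I,e_j\rangle\big)$. *)

theory Defs
  imports "HOL-Probability.Probability"
begin

section \<open>Complex Hilbert spaces and unbounded operators\<close>

text \<open>
  Inner product antilinear in the left variable. The real inner product of the superclass is the
  real part of the complex one, so \<open>inner\<close> below always denotes the real inner product of the
  underlying real Hilbert space, and \<open>norm\<close> the common norm.
\<close>

class complex_inner = real_inner +
  fixes scaleC :: "complex \<Rightarrow> 'a \<Rightarrow> 'a" (infixr "*\<^sub>C" 75)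
    and cinner :: "'a \<Rightarrow> 'a \<Rightarrow> complex"
  assumes scaleC_add_right: "a *\<^sub>C (x + y) = a *\<^sub>C x + a *\<^sub>C y"
    and scaleC_add_left: "(a + b) *\<^sub>C x = a *\<^sub>C x + b *\<^sub>C x"
    and scaleC_scaleC: "a *\<^sub>C (b *\<^sub>C x) = (a * b) *\<^sub>C x"
    and scaleC_of_real: "complex_of_real r *\<^sub>C x = r *\<^sub>R x"
    and cinner_commute: "cinner y x = cnj (cinner x y)"
    and cinner_add_right: "cinner x (y + z) = cinner x y + cinner x z"
    and cinner_scaleC_right: "cinner x (a *\<^sub>C y) = a * cinner x y"
    and inner_eq_Re_cinner: "inner x y = Re (cinner x y)"

definition linear_operator :: "'a::complex_inner set \<Rightarrow> ('a \<Rightarrow> 'a) \<Rightarrow> bool" where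
  "linear_operator D A \<longleftrightarrow> module.subspace (*\<^sub>C) D \<and>
     (\<forall>x\<in>D. \<forall>y\<in>D. A (x + y) = A x + A y) \<and> (\<forall>a. \<forall>x\<in>D. A (a *\<^sub>C x) = a *\<^sub>C A x)"

text \<open>
  An unbounded operator is a function \<open>A\<close> that is only relevant on its domain \<open>D\<close>. The last
  conjunct says that the graph of the adjoint is the graph of \<open>A\<close>.
\<close>

definition self_adjoint :: "'a::complex_inner set \<Rightarrow> ('a \<Rightarrow> 'a) \<Rightarrow> bool" where
  "self_adjoint D A \<longleftrightarrow> linear_operator D A \<and> closure D = UNIV \<and>
     (\<forall>y z. (\<forall>x\<in>D. cinner y (A x) = cinner z x) \<longleftrightarrow> y \<in> D \<and> z = A y)"

definition resolvent_set :: "'a::complex_inner set \<Rightarrow> ('a \<Rightarrow> 'a) \<Rightarrow> complex set" where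
  "resolvent_set D A = {\<zeta>. bij_betw (\<lambda>x. A x - \<zeta> *\<^sub>C x) D UNIV \<and>
     (\<exists>K. \<forall>x\<in>D. norm x \<le> K * norm (A x - \<zeta> *\<^sub>C x))}"

definition compact_resolvent :: "'a::complex_inner set \<Rightarrow> ('a \<Rightarrow> 'a) \<Rightarrow> bool" where
  "compact_resolvent D A \<longleftrightarrow> (\<exists>\<zeta>\<in>resolvent_set D A.
     compact (closure (the_inv_into D (\<lambda>x. A x - \<zeta> *\<^sub>C x) ` cball 0 1)))"

definition orthonormal_basis :: "(nat \<Rightarrow> 'a::complex_inner) \<Rightarrow> bool" where
  "orthonormal_basis e \<longleftrightarrow> (\<forall>i j. cinner (e i) (e j) = (if i = j then 1 else 0)) \<and>
     closure (module.span (*\<^sub>C) (range e)) = UNIV"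

section \<open>The spaces of positive and negative regularity\<close>

text \<open>
  The functional calculus of an operator that is diagonal in the orthonormal basis \<open>e\<close> with positive
  eigenvalues \<open>lam\<close>: \<open>op_powr e lam r\<close> is the \<open>r\<close>-th power and \<open>op_powr_domain e lam r\<close> its domain.
\<close>

definition op_powr_domain :: "(nat \<Rightarrow> 'a::complex_inner) \<Rightarrow> (nat \<Rightarrow> real) \<Rightarrow> real \<Rightarrow> 'a set" where
  "op_powr_domain e lam r = {x. summable (\<lambda>j. (lam j powr r * norm (cinner (e j) x))\<^sup>2)}"

definition op_powr :: "(nat \<Rightarrow> 'a::complex_inner) \<Rightarrow> (nat \<Rightarrow> real) \<Rightarrow> real \<Rightarrow> 'a \<Rightarrow> 'a" where
  "op_powr e lam r x = (\<Sum>j. lam j powr r *\<^sub>R cinner (e j) x *\<^sub>C e j)"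

definition sobolev :: "(nat \<Rightarrow> 'a::complex_inner) \<Rightarrow> (nat \<Rightarrow> real) \<Rightarrow> real \<Rightarrow> 'a set" where
  "sobolev e lam s = op_powr_domain e lam (s / 2)"

text \<open>
  The complete space \<open>'k\<close>, with the canonical map \<open>\<iota>\<close>, is the completion of \<open>'h\<close> with respect to
  the inner product of negative order \<open>-s\<close>.
\<close>

definition sobolev_completion ::
    "(nat \<Rightarrow> 'h::complex_inner) \<Rightarrow> (nat \<Rightarrow> real) \<Rightarrow> real \<Rightarrow>
     ('h \<Rightarrow> 'k::{complex_inner,complete_space}) \<Rightarrow> bool" where
  "sobolev_completion e lam s \<iota> \<longleftrightarrow>
     (\<forall>x y. \<iota> (x + y) = \<iota> x + \<iota> y) \<and> (\<forall>a x. \<iota> (a *\<^sub>C x) = a *\<^sub>C \<iota> x) \<and>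
     (\<forall>x y. cinner (\<iota> x) (\<iota> y) = cinner (op_powr e lam (- s / 2) x) (op_powr e lam (- s / 2) y)) \<and>
     closure (range \<iota>) = UNIV"

text \<open>
  For \<open>w\<close> of regularity \<open>s\<close>, \<open>x \<mapsto> inner x w\<close> is continuous for the norm of negative order; the
  pairing with \<open>w\<close> is its unique continuous extension to the completion. For other \<open>w\<close> the value is
  unspecified.
\<close>

definition dual_pairing :: "('h::complex_inner \<Rightarrow> 'k::complex_inner) \<Rightarrow> 'k \<Rightarrow> 'h \<Rightarrow> real" where
  "dual_pairing \<iota> u w = (THE l. bounded_linear l \<and> (\<forall>x. l (\<iota> x) = inner x w)) u"

section \<open>The Gaussian measure\<close>

definition borel_prob :: "'k::topological_space measure \<Rightarrow> bool" where
  "borel_prob M \<longleftrightarrow> prob_space M \<and> sets M = sets borel"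

text \<open>The characteristic functional determines the measure and makes it centered Gaussian.\<close>

definition free_gibbs_measure ::
    "'h::complex_inner set \<Rightarrow> ('h \<Rightarrow> 'h) \<Rightarrow> (nat \<Rightarrow> 'h) \<Rightarrow> (nat \<Rightarrow> real) \<Rightarrow> real \<Rightarrow>
     ('h \<Rightarrow> 'k::complex_inner) \<Rightarrow> real \<Rightarrow> 'k measure \<Rightarrow> bool" where
  "free_gibbs_measure D A e lam s \<iota> \<beta> M \<longleftrightarrow> borel_prob M \<and>
     (\<forall>w\<in>sobolev e lam s.
        (\<integral>u. exp (\<i> * complex_of_real (dual_pairing \<iota> u w)) \<partial>M)
          = exp (- (1 / (2 * complex_of_real \<beta>)) * cinner w (the_inv_into D A w)))"

section \<open>Smooth compactly supported cylindrical functions\<close>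

text \<open>
  A function on \<open>\<real>\<^sup>m\<close> is represented by a function of sequences \<open>nat \<Rightarrow> real\<close> that depends only on
  the coordinates below \<open>m\<close>. For such functions, continuity in the product topology on
  \<open>nat \<Rightarrow> real\<close> is continuity on \<open>\<real>\<^sup>m\<close>.
\<close>

definition partial_deriv :: "nat \<Rightarrow> ((nat \<Rightarrow> real) \<Rightarrow> real) \<Rightarrow> (nat \<Rightarrow> real) \<Rightarrow> real" where
  "partial_deriv i \<phi> x = deriv (\<lambda>t. \<phi> (x(i := t))) (x i)"

primrec Ck :: "nat \<Rightarrow> nat \<Rightarrow> ((nat \<Rightarrow> real) \<Rightarrow> real) \<Rightarrow> bool" where
  "Ck m 0 \<phi> \<longleftrightarrow> continuous_on UNIV \<phi>"
| "Ck m (Suc k) \<phi> \<longleftrightarrow> continuous_on UNIV \<phi> \<and>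
     (\<forall>i<m. (\<forall>x. (\<lambda>t. \<phi> (x(i := t))) differentiable (at (x i))) \<and> Ck m k (partial_deriv i \<phi>))"

definition Cc_infinity :: "nat \<Rightarrow> ((nat \<Rightarrow> real) \<Rightarrow> real) set" where
  "Cc_infinity m = {\<phi>.
     (\<forall>x y. (\<forall>i<m. x i = y i) \<longrightarrow> \<phi> x = \<phi> y) \<and>
     (\<forall>k. Ck m k \<phi>) \<and>
     (\<exists>R. \<forall>x. \<phi> x \<noteq> 0 \<longrightarrow> (\<forall>i<m. \<bar>x i\<bar> \<le> R))}"

definition cyl_proj ::
    "(nat \<Rightarrow> 'h::complex_inner) \<Rightarrow> ('h \<Rightarrow> 'k::complex_inner) \<Rightarrow> nat \<Rightarrow> 'k \<Rightarrow> nat \<Rightarrow> real" where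
  "cyl_proj e \<iota> n u = (\<lambda>k. if k < n then dual_pairing \<iota> u (e k)
     else if k < 2 * n then dual_pairing \<iota> u (\<i> *\<^sub>C e (k - n)) else 0)"

definition cyl_functions ::
    "(nat \<Rightarrow> 'h::complex_inner) \<Rightarrow> ('h \<Rightarrow> 'k::complex_inner) \<Rightarrow> ('k \<Rightarrow> real) set" where
  "cyl_functions e \<iota> = {\<phi> \<circ> cyl_proj e \<iota> n | n \<phi>. 1 \<le> n \<and> \<phi> \<in> Cc_infinity (2 * n)}"

text \<open>
  Below, the basis is \<open>e j\<close>, \<open>\<i> *\<^sub>C e j\<close> over the reals. For cylindrical functions all the series
  over \<open>j\<close> have only finitely many nonzero terms.
\<close>

definition dir_deriv :: "'k::real_normed_vector \<Rightarrow> ('k \<Rightarrow> real) \<Rightarrow> 'k \<Rightarrow> real" where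
  "dir_deriv v F u = deriv (\<lambda>t. F (u + t *\<^sub>R v)) 0"

definition cyl_gradient ::
    "(nat \<Rightarrow> 'h::complex_inner) \<Rightarrow> ('h \<Rightarrow> 'k::complex_inner) \<Rightarrow> ('k \<Rightarrow> real) \<Rightarrow> 'k \<Rightarrow> 'h" where
  "cyl_gradient e \<iota> F u = (\<Sum>j. dir_deriv (\<iota> (e j)) F u *\<^sub>R e j
     + dir_deriv (\<iota> (\<i> *\<^sub>C e j)) F u *\<^sub>R (\<i> *\<^sub>C e j))"

definition poisson_bracket ::
    "(nat \<Rightarrow> 'h::complex_inner) \<Rightarrow> ('h \<Rightarrow> 'k::complex_inner) \<Rightarrow>
     ('k \<Rightarrow> real) \<Rightarrow> ('k \<Rightarrow> real) \<Rightarrow> 'k \<Rightarrow> real" where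
  "poisson_bracket e \<iota> F G u =
     (\<Sum>j. dir_deriv (\<iota> (e j)) F u * dir_deriv (\<iota> (\<i> *\<^sub>C e j)) G u
        - dir_deriv (\<iota> (e j)) G u * dir_deriv (\<iota> (\<i> *\<^sub>C e j)) F u)"

section \<open>Malliavin derivative\<close>

definition in_Lp ::
    "'k measure \<Rightarrow> real \<Rightarrow> ('k \<Rightarrow> 'b::real_normed_vector) \<Rightarrow> bool" where
  "in_Lp M p F \<longleftrightarrow> F \<in> borel_measurable M \<and> (\<integral>\<^sup>+u. ennreal (norm (F u) powr p) \<partial>M) < \<infinity>"

definition tendsto_Lp ::
    "'k measure \<Rightarrow> real \<Rightarrow> (nat \<Rightarrow> 'k \<Rightarrow> 'b::real_normed_vector) \<Rightarrow> ('k \<Rightarrow> 'b) \<Rightarrow> bool" where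
  "tendsto_Lp M p Fn F \<longleftrightarrow>
     (\<lambda>n. \<integral>\<^sup>+u. ennreal (norm (Fn n u - F u) powr p) \<partial>M) \<longlonglongrightarrow> 0"

text \<open>The graph of the closure of the gradient, as a relation between functions.\<close>

definition has_malliavin_gradient ::
    "(nat \<Rightarrow> 'h::complex_inner) \<Rightarrow> ('h \<Rightarrow> 'k::complex_inner) \<Rightarrow> 'k measure \<Rightarrow> real \<Rightarrow>
     ('k \<Rightarrow> real) \<Rightarrow> ('k \<Rightarrow> 'k) \<Rightarrow> bool" where
  "has_malliavin_gradient e \<iota> M p F V \<longleftrightarrow> in_Lp M p F \<and> in_Lp M p V \<and>
     (\<exists>Fn. (\<forall>n. Fn n \<in> cyl_functions e \<iota>) \<and> tendsto_Lp M p Fn F \<and>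
        tendsto_Lp M p (\<lambda>n u. \<iota> (cyl_gradient e \<iota> (Fn n) u)) V)"

definition malliavin_space ::
    "(nat \<Rightarrow> 'h::complex_inner) \<Rightarrow> ('h \<Rightarrow> 'k::complex_inner) \<Rightarrow> 'k measure \<Rightarrow> real \<Rightarrow>
     ('k \<Rightarrow> real) set" where
  "malliavin_space e \<iota> M p = {F. \<exists>V. has_malliavin_gradient e \<iota> M p F V}"

text \<open>
  Since the gradient is closable, the choice below is determined up to a null set of \<open>M\<close>.
\<close>

definition malliavin_gradient ::
    "(nat \<Rightarrow> 'h::complex_inner) \<Rightarrow> ('h \<Rightarrow> 'k::complex_inner) \<Rightarrow> 'k measure \<Rightarrow> real \<Rightarrow>
     ('k \<Rightarrow> real) \<Rightarrow> 'k \<Rightarrow> 'k" where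
  "malliavin_gradient e \<iota> M p F = (SOME V. has_malliavin_gradient e \<iota> M p F V)"

section \<open>KMS states and Gibbs measures\<close>

text \<open>
  The real pairing of \<open>\<nabla>F(u)\<close> with \<open>- \<i> A u\<close>, which is not an element of the completion in
  general, and with \<open>- \<i> V u\<close>.
\<close>

definition linear_drift ::
    "(nat \<Rightarrow> 'h::complex_inner) \<Rightarrow> (nat \<Rightarrow> real) \<Rightarrow> ('h \<Rightarrow> 'k::complex_inner) \<Rightarrow>
     ('k \<Rightarrow> real) \<Rightarrow> 'k \<Rightarrow> real" where
  "linear_drift e lam \<iota> F u =
     (\<Sum>j. lam j * (dir_deriv (\<iota> (e j)) F u * dual_pairing \<iota> u (\<i> *\<^sub>C e j)
        - dir_deriv (\<iota> (\<i> *\<^sub>C e j)) F u * dual_pairing \<iota> u (e j)))"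

definition nonlinear_drift ::
    "(nat \<Rightarrow> 'h::complex_inner) \<Rightarrow> ('h \<Rightarrow> 'k::complex_inner) \<Rightarrow> ('k \<Rightarrow> 'k) \<Rightarrow>
     ('k \<Rightarrow> real) \<Rightarrow> 'k \<Rightarrow> real" where
  "nonlinear_drift e \<iota> V F u =
     (\<Sum>j. dir_deriv (\<iota> (e j)) F u * dual_pairing \<iota> (V u) (\<i> *\<^sub>C e j)
        - dir_deriv (\<iota> (\<i> *\<^sub>C e j)) F u * dual_pairing \<iota> (V u) (e j))"

text \<open>The vector field is \<open>X(u) = - \<i> A u - \<i> V u\<close>.\<close>

definition KMS_state ::
    "(nat \<Rightarrow> 'h::complex_inner) \<Rightarrow> (nat \<Rightarrow> real) \<Rightarrow> ('h \<Rightarrow> 'k::complex_inner) \<Rightarrow> real \<Rightarrow>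
     ('k \<Rightarrow> 'k) \<Rightarrow> 'k measure \<Rightarrow> bool" where
  "KMS_state e lam \<iota> \<beta> V M \<longleftrightarrow> borel_prob M \<and>
     (\<forall>F\<in>cyl_functions e \<iota>. \<forall>G\<in>cyl_functions e \<iota>.
        (\<integral>u. poisson_bracket e \<iota> F G u \<partial>M)
          = \<beta> * (\<integral>u. (linear_drift e lam \<iota> F u + nonlinear_drift e \<iota> V F u) * G u \<partial>M))"

definition gibbs_measure :: "real \<Rightarrow> ('k \<Rightarrow> real) \<Rightarrow> 'k measure \<Rightarrow> 'k measure" where
  "gibbs_measure \<beta> h M =
     density M (\<lambda>u. ennreal (exp (- \<beta> * h u) / (\<integral>v. exp (- \<beta> * h v) \<partial>M)))"

end

theory Submission
  imports Defs
begin

text \<open>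
  Integrating by parts against the Gaussian measure turns the KMS condition for the density
  \<open>\<rho>\<close> into \<open>\<integral> G \<cdot> (\<nabla>F, - \<i> (\<nabla>\<rho> + \<beta> \<rho> \<nabla>h)) = 0\<close> for all cylindrical \<open>F\<close>, \<open>G\<close>, that is,
  into the gradient equation \<open>\<nabla>\<rho> + \<beta> \<rho> \<nabla>h = 0\<close>; the second derivatives of \<open>F\<close> cancel by symmetry.
  The equation is compared with the Gibbs density through bounded functions of \<open>(\<rho>, h)\<close>, for which the
  chain rule holds. If \<open>\<rho> = C exp (- \<beta> h)\<close>, the chain rule for
  \<open>arctan \<rho> - arctan (C exp (- \<beta> h)) = 0\<close> gives the equation. Conversely, the equation makes
  the weak gradient of \<open>arctan (\<rho> exp (\<beta> h))\<close> vanish; its Fourier transform against the Gaussian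
  measure then solves a linear differential equation along rays, so the function is constant.
\<close>

section \<open>Characteristic functionals of finite measures on a Hilbert space\<close>

text \<open>The density may vanish on a set of positive measure and no integrability of
  \<open>\<rho> exp (\<beta> h)\<close> is assumed, so neither \<open>log \<rho>\<close> nor the
  quotient by the Gibbs weight can be differentiated directly. \<open>arctan\<close> makes the
  quotient bounded while staying injective, and a further cutoff in \<open>h\<close> alone controls
  the derivative in \<open>\<rho>\<close>, which otherwise grows like \<open>exp (\<beta> h)\<close>
  where \<open>\<rho>\<close> is small. The calculus takes place in an abstract frame: directions
  \<open>d v\<close> and, biorthogonal to them, vectors \<open>z v\<close> that represent the real
  coordinates. Derivatives are taken in one direction at a time; infinite dimension enters through
  the fact that the characteristic functional determines a finite measure, which is derived from the
  one-dimensional case. Two kinds of test functions are in play: the KMS condition speaks of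
  compactly supported cylindrical functions, the Fourier arguments of cosines. The class
  \<open>C1b\<close> contains both, and smooth cutoffs of growing radius lead from the first kind to
  the second.\<close>

lemma finite_measure_eqI_char:
  fixes M N :: "real measure"
  assumes M: "finite_measure M" "sets M = sets borel" and N: "finite_measure N" "sets N = sets borel"
    and eq: "\<And>t. char M t = char N t"
  shows "M = N"
proof -
  interpret M: finite_measure M by fact
  interpret N: finite_measure N by fact
  have sp: "space M = UNIV" "space N = UNIV"
    using sets_eq_imp_space_eq[OF M(2)] sets_eq_imp_space_eq[OF N(2)] by simp_all
  define m where "m = measure M UNIV"
  have "complex_of_real m = char M 0"
    by (simp add: char_def m_def sp scaleR_conv_of_real)
  also have "\<dots> = measure N UNIV"
    unfolding eq by (simp add: char_def sp scaleR_conv_of_real)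
  finally have mN: "m = measure N UNIV" by simp
  have em: "emeasure M UNIV = ennreal m" "emeasure N UNIV = ennreal m"
    by (simp add: m_def M.emeasure_eq_measure) (simp add: mN N.emeasure_eq_measure)
  have m0: "m \<ge> 0" by (simp add: m_def)
  show ?thesis
  \<comment> \<open>Levy's theorem concerns probability measures: the common mass \<open>m\<close>,
    read off at \<open>t = 0\<close>, is divided out, which is possible unless it vanishes.\<close>
  proof (cases "m = 0")
    case True
    show ?thesis
    proof (rule measure_eqI)
      fix A assume A: "A \<in> sets M"
      have "emeasure M A \<le> emeasure M UNIV" "emeasure N A \<le> emeasure N UNIV"
        using emeasure_space[of M A] emeasure_space[of N A] sp by simp_all
      then show "emeasure M A = emeasure N A" using True em by simp
    qed (simp add: M N)
  next
    case False
    then have mp: "m > 0" using m0 by simp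
    let ?D = "\<lambda>L::real measure. density L (\<lambda>_. ennreal (1 / m))"
    have rd: "real_distribution (?D L)" if L: "sets L = sets borel" "space L = UNIV" "emeasure L UNIV = ennreal m" for L
    proof -
      have "emeasure (?D L) (space (?D L)) = ennreal (1 / m) * ennreal m"
        using L by (subst emeasure_density) (auto simp: nn_integral_cmult_indicator)
      also have "\<dots> = 1" using mp by (simp flip: ennreal_mult)
      finally have "prob_space (?D L)" by (rule prob_spaceI)
      then show ?thesis using L by (auto simp: real_distribution_def real_distribution_axioms_def)
    qed
    have cD: "char (?D L) t = (1 / m) *\<^sub>R char L t" if L: "sets L = sets borel" for L t
      unfolding char_def using mp L
      by (subst integral_density) (auto simp: measurable_cong_sets[OF L refl])
    have "?D M = ?D N"
      by (rule Levy_uniqueness) (auto intro!: rd simp: M N sp em cD eq fun_eq_iff)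
    then have "density (?D M) (\<lambda>_. ennreal m) = density (?D N) (\<lambda>_. ennreal m)" by simp
    then show ?thesis using mp
      by (simp add: density_density_eq ennreal_mult'[symmetric] density_1)
  qed
qed

lemma finite_measure_density_bounded:
  fixes g :: "'a \<Rightarrow> real"
  assumes "finite_measure M" "g \<in> borel_measurable M" "\<And>u. g u \<le> C"
  shows "finite_measure (density M (\<lambda>u. ennreal (g u)))"
proof -
  interpret finite_measure M by fact
  have "emeasure (density M (\<lambda>u. ennreal (g u))) (space M) = (\<integral>\<^sup>+u. ennreal (g u) \<partial>M)"
    using assms by (subst emeasure_density) (auto intro!: nn_integral_cong)
  also have "\<dots> \<le> (\<integral>\<^sup>+u. ennreal C \<partial>M)"
    using assms by (intro nn_integral_mono) (auto intro: ennreal_leI)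
  also have "\<dots> < \<infinity>"
    by (simp add: ennreal_mult_less_top emeasure_eq_measure)
  finally show ?thesis
    by (intro finite_measureI) auto
qed

text \<open>Both sides are the mass that the image of the measure with density \<open>g\<close>
  under \<open>u \<bullet> z\<close> gives to \<open>B\<close>, and \<open>eq\<close> equates the
  characteristic functions of these two measures on the line. The weight has to be nonnegative to be
  a density.\<close>

lemma slice_integral_eq:
  fixes M N :: "'a::{real_inner,second_countable_topology} measure" and g :: "'a \<Rightarrow> real"
  assumes M: "finite_measure M" "sets M = sets borel" and N: "finite_measure N" "sets N = sets borel"
    and g: "g \<in> borel_measurable borel" "\<And>u. 0 \<le> g u" "\<And>u. g u \<le> C"
    and eq: "\<And>t. (CLINT u|M. g u *\<^sub>R iexp (t * (u \<bullet> z))) = (CLINT u|N. g u *\<^sub>R iexp (t * (u \<bullet> z)))"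
    and B: "B \<in> sets borel"
  shows "(\<integral>u. g u * indicator B (u \<bullet> z) \<partial>M) = (\<integral>u. g u * indicator B (u \<bullet> z) \<partial>N)"
proof -
  let ?D = "\<lambda>L::'a measure. distr (density L (\<lambda>u. ennreal (g u))) borel (\<lambda>u. u \<bullet> z)"
  have [measurable]: "(\<lambda>u::'a. u \<bullet> z) \<in> borel_measurable borel"
    by (intro borel_measurable_continuous_onI continuous_intros)
  have fin: "finite_measure (?D L)" if L: "finite_measure L" "sets L = sets borel" for L
    using L g
    by (intro finite_measure.finite_measure_distr finite_measure_density_bounded[where C = C])
       (auto simp: measurable_cong_sets[OF L(2) refl])
  have ch: "char (?D L) t = (CLINT u|L. g u *\<^sub>R iexp (t * (u \<bullet> z)))" if L: "sets L = sets borel" for L t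
  proof -
    have [measurable]: "g \<in> borel_measurable L" "(\<lambda>u::'a. u \<bullet> z) \<in> borel_measurable L"
      using g by (auto simp: measurable_cong_sets[OF L refl])
    show ?thesis unfolding char_def
      by (subst integral_distr) (auto simp: integral_density g)
  qed
  have me: "measure (?D L) B = (\<integral>u. g u * indicator B (u \<bullet> z) \<partial>L)" if L: "sets L = sets borel" for L
  proof -
    have [measurable]: "g \<in> borel_measurable L" "(\<lambda>u::'a. u \<bullet> z) \<in> borel_measurable L"
      using g by (auto simp: measurable_cong_sets[OF L refl])
    note B[measurable]
    have "measure (?D L) B = (\<integral>x. indicator B x \<partial>?D L)" using B by simp
    also have "\<dots> = (\<integral>u. g u * indicator B (u \<bullet> z) \<partial>L)"
      by (subst integral_distr) (auto simp: integral_density g)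
    finally show ?thesis .
  qed
  have "?D M = ?D N"
    by (rule finite_measure_eqI_char) (use eq in \<open>auto simp: fin M N ch\<close>)
  then show ?thesis using me[of M] me[of N] M N by simp
qed

lemma cos_phase_sin: "cos (x - pi / 2) = sin x" "sin (x - pi / 2) = - cos (x::real)"
  by (simp_all add: cos_diff sin_diff)

lemma iexp_trig: "iexp x = complex_of_real (cos x) + \<i> * complex_of_real (sin x)"
  by (simp add: cis_conv_exp[symmetric] complex_eq_iff)

lemma integral_re_im:
  assumes "integrable M f" "integrable M g"
  shows "(CLINT u|M. complex_of_real (f u) + \<i> * complex_of_real (g u)) =
    complex_of_real (\<integral>u. f u \<partial>M) + \<i> * complex_of_real (\<integral>u. g u \<partial>M)"
  using assms by simp

lemma integrable_bounded_finite:
  fixes f :: "'a \<Rightarrow> 'b::{banach, second_countable_topology}"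
  assumes "finite_measure M" "f \<in> borel_measurable M" "\<And>x. norm (f x) \<le> C"
  shows "integrable M f"
  using finite_measure.integrable_const_bound[OF assms(1), of f C] assms by auto

text \<open>Levy's uniqueness theorem needs positive measures. The weights \<open>1 + cos (u \<bullet> y + p)\<close> are
  positive, and the Fourier transforms of the weighted measures are sums of translates.\<close>

lemma char_functional_restrict:
  fixes M N :: "'a::{real_inner,second_countable_topology} measure" and g :: "'a \<Rightarrow> real"
  assumes M: "finite_measure M" "sets M = sets borel" and N: "finite_measure N" "sets N = sets borel"
    and g: "g \<in> borel_measurable borel" "\<And>u. 0 \<le> g u" "\<And>u. g u \<le> 1"
    and eq: "\<And>y. (CLINT u|M. g u *\<^sub>R iexp (u \<bullet> y)) = (CLINT u|N. g u *\<^sub>R iexp (u \<bullet> y))"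
    and B: "B \<in> sets borel"
  shows "(CLINT u|M. (g u * indicator B (u \<bullet> z)) *\<^sub>R iexp (u \<bullet> y)) =
    (CLINT u|N. (g u * indicator B (u \<bullet> z)) *\<^sub>R iexp (u \<bullet> y))"
proof -
  have inn[measurable]: "(\<lambda>u::'a. u \<bullet> w) \<in> borel_measurable borel" for w
    by (intro borel_measurable_continuous_onI continuous_intros)
  note g(1)[measurable] B[measurable]
  have meas: "f \<in> borel_measurable M \<longleftrightarrow> f \<in> borel_measurable borel"
      "f \<in> borel_measurable N \<longleftrightarrow> f \<in> borel_measurable borel" for f :: "'a \<Rightarrow> 'b::topological_space"
    using measurable_cong_sets[OF M(2) refl] measurable_cong_sets[OF N(2) refl] by auto
  have int: "integrable M f" "integrable N f"
    if "f \<in> borel_measurable borel" "\<And>x. norm (f x) \<le> C" for C and f :: "'a \<Rightarrow> 'b::{banach, second_countable_topology}"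
    using that by (auto intro!: integrable_bounded_finite M N simp: meas)
  have intg: "integrable M (\<lambda>u. g u *\<^sub>R iexp (u \<bullet> y))" "integrable N (\<lambda>u. g u *\<^sub>R iexp (u \<bullet> y))" for y
    using g(2,3) by (auto intro!: int[of _ 1])
  let ?k = "\<lambda>p u. 1 + cos (u \<bullet> y + p)" and ?B = "\<lambda>u. indicator B (u \<bullet> z) :: real"
  have k: "0 \<le> ?k p u" "?k p u \<le> 2" for p u
    using cos_ge_minus_one[of "u \<bullet> y + p"] cos_le_one[of "u \<bullet> y + p"] by linarith+
  have gk: "0 \<le> g u * ?k p u" "g u * ?k p u \<le> 2" for p u
    using mult_mono[of "g u" 1 "?k p u" 2] g(2,3)[of u] k[of u p] by simp_all
  have eqk: "(\<integral>u. (g u * ?k p u) * ?B u \<partial>M) = (\<integral>u. (g u * ?k p u) * ?B u \<partial>N)" for p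
  proof (rule slice_integral_eq[OF M N _ gk _ B])
    fix t
    let ?g = "\<lambda>w u. g u *\<^sub>R iexp (u \<bullet> w)"
    \<comment> \<open>The cosine is half a sum of two exponentials, so the weighted transform
      combines the transforms at \<open>t z\<close>, \<open>t z + y\<close> and
      \<open>t z - y\<close>, where \<open>M\<close> and \<open>N\<close> agree.\<close>
    have "(g u * ?k p u) *\<^sub>R iexp (t * (u \<bullet> z)) = 1 * ?g (t *\<^sub>R z) u
        + (iexp p / 2) * ?g (t *\<^sub>R z + y) u + (iexp (- p) / 2) * ?g (t *\<^sub>R z - y) u" for u
    proof -
      have "complex_of_real (?k p u) = 1 + (iexp p * iexp (u \<bullet> y) + iexp (- p) * iexp (- (u \<bullet> y))) / 2"
        unfolding iexp_trig by (simp add: cos_add algebra_simps complex_eq_iff) (simp add: field_simps)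
      then have "(g u * ?k p u) *\<^sub>R iexp (t * (u \<bullet> z)) = complex_of_real (g u)
          * ((1 + (iexp p * iexp (u \<bullet> y) + iexp (- p) * iexp (- (u \<bullet> y))) / 2) * iexp (t * (u \<bullet> z)))"
        by (simp add: scaleR_conv_of_real mult_ac)
      then show ?thesis
        by (simp add: scaleR_conv_of_real inner_simps field_simps exp_add exp_diff exp_minus)
    qed
    then show "(CLINT u|M. (g u * ?k p u) *\<^sub>R iexp (t * (u \<bullet> z))) = (CLINT u|N. (g u * ?k p u) *\<^sub>R iexp (t * (u \<bullet> z)))"
      by (simp only: Bochner_Integration.integral_add integral_mult_right_zero
          integrable_mult_right Bochner_Integration.integrable_add intg eq)
  qed measurable
  let ?c = "\<lambda>p u. (g u * cos (u \<bullet> y + p)) * ?B u"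
  have ik: "integrable M (\<lambda>u. (g u * ?k p u) * ?B u)" "integrable N (\<lambda>u. (g u * ?k p u) * ?B u)" for p
    using gk by (auto intro!: int[of _ 2] simp: indicator_def)
  have cs: "(\<integral>u. ?c p u \<partial>M) = (\<integral>u. ?c p u \<partial>N)" for p
  proof -
    \<comment> \<open>A shift of the phase by pi flips the sign of the cosine, so half the
      difference of two positive weights isolates it.\<close>
    have c: "?c p u = ((g u * ?k p u) * ?B u - (g u * ?k (p + pi) u) * ?B u) / 2" for u
    proof -
      have "cos (u \<bullet> y + (p + pi)) = - cos (u \<bullet> y + p)" by (simp only: add.assoc[symmetric] cos_periodic_pi)
      then show ?thesis by (simp only:) (simp add: algebra_simps)
    qed
    show ?thesis unfolding c
      by (simp only: integral_divide_zero Bochner_Integration.integral_diff ik eqk)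
  qed
  have ic: "integrable M (?c p)" "integrable N (?c p)" for p
    using g(2,3) by (auto intro!: int[of _ 1] mult_le_one simp: indicator_def abs_mult)
  \<comment> \<open>The phases 0 and \<open>- pi / 2\<close> recover the real and the imaginary part
    of the exponential.\<close>
  have split: "(g u * ?B u) *\<^sub>R iexp (u \<bullet> y) = complex_of_real (?c 0 u) + \<i> * complex_of_real (?c (- (pi / 2)) u)" for u
    by (simp add: iexp_trig scaleR_conv_of_real cos_phase_sin algebra_simps)
  show ?thesis unfolding split integral_re_im[OF ic(1) ic(1)] integral_re_im[OF ic(2) ic(2)] cs ..
qed

section \<open>Half-spaces generate the Borel sets of a separable inner product space\<close>

lemma closed_ball_halfspaces:
  fixes a :: "'a::{real_inner,second_countable_topology}"
  obtains D where "countable D" "\<And>r. r \<ge> 0 \<Longrightarrow> cball a r = (\<Inter>d\<in>D. {u. u \<bullet> d \<le> a \<bullet> d + r * norm d})"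
proof -
  obtain D :: "'a set" where D: "countable D" "\<And>X. open X \<Longrightarrow> X \<noteq> {} \<Longrightarrow> \<exists>d\<in>D. d \<in> X"
    using countable_dense_setE by blast
  show thesis
  proof (rule that[OF D(1)], intro set_eqI iffI INT_I CollectI)
    fix r :: real and u d assume "u \<in> cball a r"
    then have "norm (u - a) \<le> r" by (simp add: dist_norm norm_minus_commute)
    then have "(u - a) \<bullet> d \<le> r * norm d"
      by (meson mult_right_mono norm_cauchy_schwarz norm_ge_zero order_trans)
    then show "u \<bullet> d \<le> a \<bullet> d + r * norm d" by (simp add: inner_diff_left)
  next
    fix r :: real and u assume r: "r \<ge> 0" and u: "u \<in> (\<Inter>d\<in>D. {u. u \<bullet> d \<le> a \<bullet> d + r * norm d})"
    \<comment> \<open>Continuity extends the inequality from the dense set \<open>D\<close> to every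
      direction; the direction \<open>u - a\<close> then bounds the distance.\<close>
    have cl: "closed {d. (u - a) \<bullet> d \<le> r * norm d}"
      by (intro closed_Collect_le continuous_intros)
    have "{d. (u - a) \<bullet> d \<le> r * norm d} = UNIV"
    proof (rule ccontr)
      assume "{d. (u - a) \<bullet> d \<le> r * norm d} \<noteq> UNIV"
      then obtain d where "d \<in> D" "d \<in> - {d. (u - a) \<bullet> d \<le> r * norm d}"
        using D(2)[of "- {d. (u - a) \<bullet> d \<le> r * norm d}"] cl by auto
      then show False using u by (auto simp: inner_diff_left)
    qed
    then have "(u - a) \<bullet> (u - a) \<le> r * norm (u - a)" by blast
    then have "norm (u - a) * norm (u - a) \<le> r * norm (u - a)"
      by (simp add: power2_norm_eq_inner[symmetric] power2_eq_square)
    then have "norm (u - a) \<le> r" using r by (cases "norm (u - a) = 0") auto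
    then show "u \<in> cball a r" by (simp add: dist_norm norm_minus_commute)
  qed
qed

text \<open>An open set is a countable union of closed balls with centres in a countable dense set
  and rational radii, and each of these balls is a countable intersection of half-spaces.\<close>

lemma sets_borel_eq_halfspaces:
  "sets (borel :: 'a::{real_inner,second_countable_topology} measure) =
    sigma_sets UNIV {H. \<exists>z b. H = {u. u \<bullet> z \<le> b}}" (is "_ = sigma_sets UNIV ?H")
proof
  interpret S: sigma_algebra UNIV "sigma_sets UNIV ?H"
    by (rule sigma_algebra_sigma_sets) auto
  have cb: "cball a r \<in> sigma_sets UNIV ?H" for a :: 'a and r
  proof (cases "r \<ge> 0")
    case True
    obtain D where D: "countable D" "\<And>r. r \<ge> 0 \<Longrightarrow> cball a r = (\<Inter>d\<in>D. {u. u \<bullet> d \<le> a \<bullet> d + r * norm d})"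
      by (rule closed_ball_halfspaces[of a]) blast
    show ?thesis unfolding D(2)[OF True]
      using D(1) by (intro S.countable_INT'') (auto intro!: sigma_sets.Basic)
  next
    case False
    then have "cball a r = {}" by auto
    then show ?thesis by simp
  qed
  obtain D :: "'a set" where D: "countable D" "\<And>X. open X \<Longrightarrow> X \<noteq> {} \<Longrightarrow> \<exists>d\<in>D. d \<in> X"
    using countable_dense_setE by blast
  have "S \<in> sigma_sets UNIV ?H" if S: "open S" for S :: "'a set"
  proof -
    let ?I = "{p \<in> D \<times> \<rat>. cball (fst p) (snd p) \<subseteq> S}"
    have "S = (\<Union>p\<in>?I. cball (fst p) (snd p))"
    proof (intro set_eqI iffI)
      fix x assume "x \<in> S"
      then obtain r where r: "r > 0" "ball x r \<subseteq> S" using S openE by blast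
      obtain d where d: "d \<in> D" "d \<in> ball x (r / 4)" using D(2)[of "ball x (r/4)"] r by auto
      \<comment> \<open>The centre \<open>d\<close> has distance less than \<open>r / 4\<close> from
        \<open>x\<close>: a radius above \<open>r / 4\<close> reaches \<open>x\<close>, and one
        below \<open>r / 2\<close> stays inside \<open>ball x r\<close>.\<close>
      obtain q where q: "q \<in> \<rat>" "r / 4 < q" "q < r / 2" using Rats_dense_in_real[of "r/4" "r/2"] r by auto
      have "cball d q \<subseteq> ball x r"
      proof
        fix y assume "y \<in> cball d q"
        then show "y \<in> ball x r" using d(2) q r dist_triangle[of x y d] by auto
      qed
      then show "x \<in> (\<Union>p\<in>?I. cball (fst p) (snd p))"
        using d q r by (auto intro!: exI[of _ d] exI[of _ q] simp: dist_commute)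
    qed auto
    moreover have "countable ?I"
      by (rule countable_subset[of _ "D \<times> \<rat>"]) (auto intro: D(1) countable_rat)
    ultimately show ?thesis
      using cb by (subst \<open>S = _\<close>, intro S.countable_UN'') auto
  qed
  then show "sets borel \<subseteq> sigma_sets UNIV ?H"
    unfolding borel_def by (subst sets_measure_of) (auto intro!: S.sigma_sets_subset)
  have "closed {u. u \<bullet> z \<le> b}" for z :: 'a and b
    by (intro closed_Collect_le continuous_intros)
  then show "sigma_sets UNIV ?H \<subseteq> sets borel"
    by (intro sets.sigma_sets_subset[of _ borel, simplified]) auto
qed

text \<open>Dominated convergence extends the hypothesis from \<open>S\<close> to all directions.
  Then \<open>char_functional_restrict\<close> inserts indicators of half-spaces into the transform
  one after the other. At \<open>y = 0\<close> this equates the measures on finite intersections of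
  half-spaces, which are stable under intersection and generate the Borel sets.\<close>

lemma finite_measure_eqI_char_functional:
  fixes M N :: "'a::{real_inner,second_countable_topology} measure"
  assumes M: "finite_measure M" "sets M = sets borel" and N: "finite_measure N" "sets N = sets borel"
    and dense: "closure S = UNIV"
    and eq: "\<And>y. y \<in> S \<Longrightarrow> (CLINT u|M. iexp (u \<bullet> y)) = (CLINT u|N. iexp (u \<bullet> y))"
  shows "M = N"
proof -
  have inn[measurable]: "(\<lambda>u::'a. u \<bullet> w) \<in> borel_measurable borel" for w
    by (intro borel_measurable_continuous_onI continuous_intros)
  have all: "(CLINT u|M. iexp (u \<bullet> y)) = (CLINT u|N. iexp (u \<bullet> y))" for y
  proof -
    have "y \<in> closure S" using dense by simp
    then obtain f where f: "\<And>n::nat. f n \<in> S" "f \<longlonglongrightarrow> y"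
      unfolding closure_sequential by auto
    have "(\<lambda>n. CLINT u|L. iexp (u \<bullet> f n)) \<longlonglongrightarrow> (CLINT u|L. iexp (u \<bullet> y))"
      if L: "finite_measure L" "sets L = sets borel" for L
      using f(2) L measurable_cong_sets[OF L(2) refl]
      by (intro integral_dominated_convergence[where w = "\<lambda>_. 1"])
         (auto intro!: tendsto_intros finite_measure.integrable_const)
    from LIMSEQ_unique[OF this[OF M] ] this[OF N] show ?thesis
      by (simp add: eq f(1))
  qed
  \<comment> \<open>The direction \<open>y\<close> stays arbitrary in the induction, because
    inserting one more half-space uses the transforms in all directions.\<close>
  have fin: "(CLINT u|M. (\<Prod>p\<in>I. indicator {..snd p} (u \<bullet> fst p) :: real) *\<^sub>R iexp (u \<bullet> y)) =
     (CLINT u|N. (\<Prod>p\<in>I. indicator {..snd p} (u \<bullet> fst p) :: real) *\<^sub>R iexp (u \<bullet> y))"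
    if "finite I" for I :: "('a \<times> real) set" and y
    using that
  proof (induction I arbitrary: y)
    case empty
    then show ?case by (simp add: all)
  next
    case (insert p I)
    have "0 \<le> (\<Prod>p\<in>I. indicator {..snd p} (u \<bullet> fst p) :: real)" for u :: 'a
      by (intro prod_nonneg) auto
    moreover have "(\<Prod>p\<in>I. indicator {..snd p} (u \<bullet> fst p) :: real) \<le> 1" for u :: 'a
      by (intro prod_le_1) (auto simp: indicator_def)
    ultimately show ?case
      using char_functional_restrict[OF M N _ _ _ insert.IH, of "{..snd p}" "fst p" y] insert.hyps
      by (simp add: mult.commute[of "indicator _ _"])
  qed
  let ?E = "{H. \<exists>I::('a \<times> real) set. finite I \<and> H = {u. \<forall>p\<in>I. u \<bullet> fst p \<le> snd p}}"
  have Esets: "H \<in> sets borel" if "H \<in> ?E" for H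
  proof -
    from that obtain I :: "('a \<times> real) set" where I: "finite I" "H = {u. \<forall>p\<in>I. u \<bullet> fst p \<le> snd p}" by auto
    have "closed H" unfolding I(2) Collect_ball_eq by (intro closed_INT ballI closed_Collect_le continuous_intros)
    then show ?thesis by simp
  qed
  have gen: "sets (borel::'a measure) = sigma_sets UNIV ?E"
  proof
    show "sets (borel::'a measure) \<subseteq> sigma_sets UNIV ?E"
      unfolding sets_borel_eq_halfspaces
    proof (rule sigma_sets_mono')
      show "{H. \<exists>z b. H = {u::'a. u \<bullet> z \<le> b}} \<subseteq> ?E"
      proof clarsimp
        fix z :: 'a and b
        show "\<exists>I::('a \<times> real) set. finite I \<and> {u. u \<bullet> z \<le> b} = {u. \<forall>p\<in>I. u \<bullet> fst p \<le> snd p}"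
          by (rule exI[of _ "{(z, b)}"]) auto
      qed
    qed
    show "sigma_sets UNIV ?E \<subseteq> sets borel"
      using Esets by (intro sets.sigma_sets_subset[of _ borel, simplified]) auto
  qed
  show ?thesis
  proof (rule measure_eqI_generator_eq[of ?E UNIV _ _ "\<lambda>_. UNIV"])
    show "Int_stable ?E"
    proof (rule Int_stableI, clarsimp)
      fix I J :: "('a \<times> real) set" assume "finite I" "finite J"
      then show "\<exists>K::('a \<times> real) set. finite K \<and> {u. \<forall>p\<in>I. u \<bullet> fst p \<le> snd p} \<inter> {u. \<forall>p\<in>J. u \<bullet> fst p \<le> snd p} = {u. \<forall>p\<in>K. u \<bullet> fst p \<le> snd p}"
        by (intro exI[of _ "I \<union> J"]) auto
    qed
    fix H assume HE: "H \<in> ?E"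
    then obtain I :: "('a \<times> real) set" where I: "finite I" "H = {u. \<forall>p\<in>I. u \<bullet> fst p \<le> snd p}" by auto
    have "(\<Prod>p\<in>I. indicator {..snd p} (u \<bullet> fst p) :: real) = indicator H u" for u
      using I by (auto simp: indicator_def prod_zero_iff intro!: prod.neutral)
    then have "(CLINT u|M. (indicator H u::real) *\<^sub>R 1) = (CLINT u|N. (indicator H u::real) *\<^sub>R 1)"
      using fin[OF I(1), of 0] by simp
    then have "measure M H = measure N H"
      using Esets[OF HE] M N by (simp add: scaleR_conv_of_real)
    then show "emeasure M H = emeasure N H"
      using M N by (simp add: finite_measure.emeasure_eq_measure)
  next
    show "range (\<lambda>_::nat. UNIV) \<subseteq> ?E" by (auto intro!: exI[of _ "{}"])
    show "emeasure M UNIV \<noteq> \<infinity>" using M by (simp add: finite_measure.emeasure_eq_measure)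
  qed (use gen M N in auto)
qed

text \<open>The positive and the negative part of \<open>T\<close> are densities of finite measures
  with the same characteristic functional, so they agree almost everywhere; as one of them vanishes
  at each point, so does \<open>T\<close>. The free phase \<open>p\<close> covers real and imaginary
  parts by real integrals.\<close>

lemma AE_zero_if_char_functional_zero:
  fixes M :: "'a::{real_inner,second_countable_topology} measure" and T :: "'a \<Rightarrow> real"
  assumes M: "finite_measure M" "sets M = sets borel" and T: "integrable M T"
    and dense: "closure S = UNIV"
    and c: "\<And>y p. y \<in> S \<Longrightarrow> (\<integral>u. T u * cos (u \<bullet> y + p) \<partial>M) = 0"
  shows "AE u in M. T u = 0"
proof -
  note [measurable] = borel_measurable_integrable[OF T]
  have inn[measurable]: "(\<lambda>u::'a. u \<bullet> w) \<in> borel_measurable M" for w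
    unfolding measurable_cong_sets[OF M(2) refl]
    by (intro borel_measurable_continuous_onI continuous_intros)
  let ?P = "\<lambda>u. max 0 (T u)" and ?N = "\<lambda>u. max 0 (- T u)"
  have intP: "integrable M ?P" "integrable M ?N" using T by auto
  have fin: "finite_measure (density M (\<lambda>u. ennreal (f u)))" if "integrable M f" "\<And>u. f u \<ge> 0" for f
  proof (rule finite_measureI)
    have [measurable]: "f \<in> borel_measurable M" using that by auto
    have "emeasure (density M (\<lambda>u. ennreal (f u))) (space M) = (\<integral>\<^sup>+u. ennreal (f u) \<partial>M)"
      by (subst emeasure_density) (auto intro!: nn_integral_cong)
    then show "emeasure (density M (\<lambda>u. ennreal (f u))) (space (density M (\<lambda>u. ennreal (f u)))) \<noteq> \<infinity>"
      using nn_integral_eq_integral[of M f] that by simp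
  qed
  have bd: "integrable M (\<lambda>u. f u *\<^sub>R iexp (u \<bullet> y))" if "integrable M f" for f :: "'a \<Rightarrow> real" and y
    by (rule Bochner_Integration.integrable_bound[OF that]) (use that in auto)
  have bc: "integrable M (\<lambda>u. T u * cos (u \<bullet> y))" "integrable M (\<lambda>u. T u * sin (u \<bullet> y))" for y
    by (rule Bochner_Integration.integrable_bound[OF T]; auto simp: abs_mult mult_left_le)+
  have dens: "(CLINT u|density M (\<lambda>u. ennreal (f u)). iexp (u \<bullet> y)) = (CLINT u|M. f u *\<^sub>R iexp (u \<bullet> y))"
    if "f \<in> borel_measurable M" "\<And>u. 0 \<le> f u" for f y
    using that by (subst integral_density) auto
  have "density M (\<lambda>u. ennreal (?P u)) = density M (\<lambda>u. ennreal (?N u))"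
  proof (rule finite_measure_eqI_char_functional[OF _ _ _ _ dense])
    fix y assume y: "y \<in> S"
    have "(CLINT u|M. T u *\<^sub>R iexp (u \<bullet> y)) = complex_of_real (\<integral>u. T u * cos (u \<bullet> y) \<partial>M) + \<i> * complex_of_real (\<integral>u. T u * sin (u \<bullet> y) \<partial>M)"
      using integral_re_im[OF bc[of y]] by (simp add: iexp_trig scaleR_conv_of_real algebra_simps)
    also have "\<dots> = 0" using c[OF y, of 0] c[OF y, of "- (pi / 2)"] by (simp add: cos_phase_sin)
    finally have "(CLINT u|M. T u *\<^sub>R iexp (u \<bullet> y)) = 0" .
    moreover have "T u *\<^sub>R iexp (u \<bullet> y) = ?P u *\<^sub>R iexp (u \<bullet> y) - ?N u *\<^sub>R iexp (u \<bullet> y)" for u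
      by (auto simp: max_def)
    ultimately have "(CLINT u|M. ?P u *\<^sub>R iexp (u \<bullet> y)) = (CLINT u|M. ?N u *\<^sub>R iexp (u \<bullet> y))"
      using Bochner_Integration.integral_diff[OF bd[OF intP(1), of y] bd[OF intP(2), of y]] by simp
    then show "(CLINT u|density M (\<lambda>u. ennreal (?P u)). iexp (u \<bullet> y)) = (CLINT u|density M (\<lambda>u. ennreal (?N u)). iexp (u \<bullet> y))"
      by (simp only: dens borel_measurable_integrable[OF intP(1)] borel_measurable_integrable[OF intP(2)] max.cobounded1)
  qed (simp_all only: fin intP max.cobounded1 sets_density M)
  then have "AE u in M. ennreal (?P u) = ennreal (?N u)"
    using M by (subst (asm) sigma_finite_measure.density_unique_iff)
      (auto simp: finite_measure_def)
  then show ?thesis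
    by (rule AE_mp) (auto intro!: AE_I2 simp: max_def split: if_splits)
qed

section \<open>Gaussian integration by parts\<close>

lemma std_normal_density_tendsto_0:
  "(\<lambda>n. std_normal_density (real n)) \<longlonglongrightarrow> 0" "(\<lambda>n. std_normal_density (- real n)) \<longlonglongrightarrow> 0"
proof -
  have "(\<lambda>n. exp (- ((real n)\<^sup>2 / 2))) \<longlonglongrightarrow> 0"
    by (intro filterlim_compose[OF exp_at_bot] filterlim_uminus_at_bot_at_top[THEN filterlim_compose]
        filterlim_tendsto_pos_mult_at_top[of "\<lambda>_. 1/2" "1/2", simplified] filterlim_pow_at_top filterlim_real_sequentially) auto
  then have "(\<lambda>n. (1 / sqrt (2 * pi)) * exp (- ((real n)\<^sup>2 / 2))) \<longlonglongrightarrow> (1 / sqrt (2 * pi)) * 0"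
    by (rule tendsto_mult_left)
  then show "(\<lambda>n. std_normal_density (real n)) \<longlonglongrightarrow> 0" "(\<lambda>n. std_normal_density (- real n)) \<longlonglongrightarrow> 0"
    by (simp_all add: std_normal_density_def)
qed

text \<open>The difference of the two integrands, times the density, is the derivative of
  \<open>f\<close> times the density. Over \<open>{- n..n}\<close> it integrates to boundary terms,
  which tend to 0 because \<open>f\<close> is bounded.\<close>

lemma std_normal_integration_by_parts:
  fixes f f' :: "real \<Rightarrow> real"
  assumes der: "\<And>x. (f has_real_derivative f' x) (at x)" and cont: "continuous_on UNIV f'"
    and bd: "\<And>x. \<bar>f x\<bar> \<le> C" "\<And>x. \<bar>f' x\<bar> \<le> C"
  shows "(\<integral>x. f' x \<partial>std_normal_distribution) = (\<integral>x. x * f x \<partial>std_normal_distribution)"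
proof -
  let ?p = std_normal_density
  have contf: "continuous_on UNIV f"
    using der DERIV_continuous_on by blast
  have [measurable]: "f \<in> borel_measurable borel" "f' \<in> borel_measurable borel"
    using cont contf by (auto intro: borel_measurable_continuous_onI)
  have C0: "C \<ge> 0" using bd(1)[of 0] by linarith
  have i1: "integrable lborel (\<lambda>x. ?p x * f' x)"
    by (rule Bochner_Integration.integrable_bound[of _ "\<lambda>x. ?p x * C"])
       (use bd C0 in \<open>auto simp: abs_mult intro!: mult_left_mono AE_I2\<close>)
  have i2: "integrable lborel (\<lambda>x. ?p x * (x * f x))"
  proof (rule Bochner_Integration.integrable_bound[of _ "\<lambda>x. (?p x * \<bar>x\<bar>^1) * C"])
    show "integrable lborel (\<lambda>x. (?p x * \<bar>x\<bar>^1) * C)"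
      by (intro integrable_mult_left integrable_std_normal_moment_abs)
  qed (use bd C0 in \<open>auto simp: abs_mult mult.assoc intro!: mult_left_mono AE_I2\<close>)
  let ?g = "\<lambda>x. ?p x * f' x - ?p x * (x * f x)"
  have ig: "integrable lborel ?g" using i1 i2 by simp
  have dp: "((\<lambda>x. f x * ?p x) has_real_derivative ?g x) (at x)" for x
  proof -
    have "(?p has_real_derivative (- x * ?p x)) (at x)"
      unfolding std_normal_density_def by (auto intro!: derivative_eq_intros simp: field_simps)
    from DERIV_mult[OF der[of x] this] show ?thesis by (simp add: algebra_simps)
  qed
  have cg: "isCont ?g x" for x
  proof -
    have "continuous_on UNIV ?g"
      unfolding std_normal_density_def by (intro continuous_intros cont contf) auto
    then show ?thesis by (simp add: continuous_on_eq_continuous_at)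
  qed
  have FTC: "(\<integral>x. ?g x * indicator {- real n..real n} x \<partial>lborel) = f (real n) * ?p (real n) - f (- real n) * ?p (- real n)" for n
    by (rule integral_FTC_Icc_real[of "- real n" "real n"]) (auto intro: dp cg)
  have "(\<lambda>n. \<integral>x. ?g x * indicator {- real n..real n} x \<partial>lborel) \<longlonglongrightarrow> (\<integral>x. ?g x \<partial>lborel)"
  proof (rule integral_dominated_convergence[where w = "\<lambda>x. \<bar>?g x\<bar>"])
    show "AE x in lborel. (\<lambda>n. ?g x * indicator {- real n..real n} x) \<longlonglongrightarrow> ?g x"
    proof (rule AE_I2)
      fix x
      obtain N where N: "\<bar>x\<bar> \<le> real N" using real_arch_simple by blast
      have "\<forall>\<^sub>F n in sequentially. ?g x * indicator {- real n..real n} x = ?g x"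
        using eventually_ge_at_top[of N]
      proof eventually_elim
        case (elim n)
        then have "\<bar>x\<bar> \<le> real n" using N by linarith
        then show ?case by (simp add: indicator_def abs_le_iff)
      qed
      then show "(\<lambda>n. ?g x * indicator {- real n..real n} x) \<longlonglongrightarrow> ?g x"
        by (rule tendsto_eventually)
    qed
  qed (use ig in \<open>auto simp: indicator_def\<close>)
  moreover have "(\<lambda>n. \<integral>x. ?g x * indicator {- real n..real n} x \<partial>lborel) \<longlonglongrightarrow> 0"
  proof -
    have "(\<lambda>n. f (real n) * ?p (real n)) \<longlonglongrightarrow> 0" "(\<lambda>n. f (- real n) * ?p (- real n)) \<longlonglongrightarrow> 0"
      using bd std_normal_density_tendsto_0[THEN tendsto_mult_right_zero, of C]
      by - (rule Lim_null_comparison[of _ "\<lambda>n. C * ?p (real n)"] Lim_null_comparison[of _ "\<lambda>n. C * ?p (- real n)"],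
            rule always_eventually, rule allI, simp add: abs_mult mult_right_mono, assumption)+
    from tendsto_diff[OF this] show ?thesis unfolding FTC by simp
  qed
  ultimately have "(\<integral>x. ?g x \<partial>lborel) = 0" by (rule LIMSEQ_unique)
  then show ?thesis using i1 i2
    by (simp add: integral_density)
qed

text \<open>The derivative is an argument instead of being computed, which makes products and
  compositions easy to certify. Without any support condition the class admits the characters
  \<open>cos (u \<bullet> y + p)\<close> besides the cylindrical functions and their
  derivatives.\<close>

definition C1b :: "'k::real_normed_vector \<Rightarrow> ('k \<Rightarrow> real) \<Rightarrow> ('k \<Rightarrow> real) \<Rightarrow> bool" where
  "C1b d f f' \<longleftrightarrow> continuous_on UNIV f \<and> continuous_on UNIV f' \<and>
     (\<exists>C. \<forall>u. \<bar>f u\<bar> \<le> C) \<and> (\<exists>C. \<forall>u. \<bar>f' u\<bar> \<le> C) \<and>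
     (\<forall>u. ((\<lambda>t. f (u + t *\<^sub>R d)) has_real_derivative f' u) (at 0))"

lemma C1b_DERIV:
  assumes "C1b d f f'"
  shows "((\<lambda>t. f (u + (c * t) *\<^sub>R d)) has_real_derivative c * f' (u + (c * t) *\<^sub>R d)) (at t)"
proof -
  have "((\<lambda>r. f ((u + (c * t) *\<^sub>R d) + r *\<^sub>R d)) has_real_derivative f' (u + (c * t) *\<^sub>R d)) (at (c * t - c * t))"
    using assms by (simp add: C1b_def)
  then have "((\<lambda>x. f ((u + (c * t) *\<^sub>R d) + (c * x - c * t) *\<^sub>R d)) has_real_derivative f' (u + (c * t) *\<^sub>R d) * c) (at t)"
    by (rule DERIV_chain2) (auto intro!: derivative_eq_intros)
  then show ?thesis by (simp add: algebra_simps)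
qed

lemma C1b_mult:
  assumes "C1b d f f'" "C1b d g g'"
  shows "C1b d (\<lambda>u. f u * g u) (\<lambda>u. f' u * g u + f u * g' u)"
proof -
  obtain C1 C2 D1 D2 where C: "\<And>u. \<bar>f u\<bar> \<le> C1" "\<And>u. \<bar>f' u\<bar> \<le> C2" "\<And>u. \<bar>g u\<bar> \<le> D1" "\<And>u. \<bar>g' u\<bar> \<le> D2"
    using assms unfolding C1b_def by metis
  then have "C1 \<ge> 0" "C2 \<ge> 0" by (metis abs_ge_zero order_trans)+
  then have "\<bar>f u * g u\<bar> \<le> C1 * D1" "\<bar>f' u * g u + f u * g' u\<bar> \<le> C2 * D1 + C1 * D2" for u
    using C by (auto simp: abs_mult intro!: mult_mono order_trans[OF abs_triangle_ineq] add_mono)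
  moreover have "((\<lambda>t. f (u + t *\<^sub>R d) * g (u + t *\<^sub>R d)) has_real_derivative f' u * g u + f u * g' u) (at 0)" for u
    using assms DERIV_mult[of "\<lambda>t. f (u + t *\<^sub>R d)" "f' u" 0 UNIV "\<lambda>t. g (u + t *\<^sub>R d)" "g' u"]
    by (simp add: C1b_def add.commute mult.commute)
  ultimately show ?thesis using assms
    unfolding C1b_def by (auto intro!: continuous_intros)
qed

lemma C1b_cos:
  fixes d :: "'k::real_inner"
  shows "C1b d (\<lambda>u. cos (u \<bullet> y + p)) (\<lambda>u. - sin (u \<bullet> y + p) * (d \<bullet> y))"
proof -
  have "\<bar>- sin (u \<bullet> y + p) * (d \<bullet> y)\<bar> \<le> \<bar>d \<bullet> y\<bar>" for u
    by (simp add: abs_mult mult_left_le_one_le)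
  moreover have "((\<lambda>t. cos ((u + t *\<^sub>R d) \<bullet> y + p)) has_real_derivative - sin (u \<bullet> y + p) * (d \<bullet> y)) (at 0)" for u
    by (auto intro!: derivative_eq_intros simp: inner_simps)
  moreover have "\<exists>C. \<forall>u. \<bar>cos (u \<bullet> y + p)\<bar> \<le> C" by (rule exI[of _ 1]) simp
  ultimately show ?thesis unfolding C1b_def
    by (auto intro!: continuous_intros)
qed

text \<open>Any prescribed index \<open>v\<close> can be put into \<open>J\<close> with coefficient
  0; so one coordinate can be split off whatever \<open>y\<close> is.\<close>

lemma span_range_explicit:
  assumes "y \<in> span (range z)"
  obtains J w where "finite J" "v \<in> J" "y = (\<Sum>j\<in>J. w j *\<^sub>R z j)"
proof -
  have "\<exists>J w. finite J \<and> v \<in> J \<and> y = (\<Sum>j\<in>J. w j *\<^sub>R z j)"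
    using assms
  proof (induction rule: span_induct_alt)
    case base
    show ?case by (intro exI[of _ "{v}"] exI[of _ "\<lambda>_. 0"]) auto
  next
    case (step c x y)
    then obtain J w i where J: "finite J" "v \<in> J" "y = (\<Sum>j\<in>J. w j *\<^sub>R z j)" "x = z i" by auto
    define w' where "w' = (\<lambda>j. (if j \<in> J then w j else 0) + (if j = i then c else 0))"
    have "(\<Sum>j\<in>insert i J. w' j *\<^sub>R z j) = (\<Sum>j\<in>insert i J. (if j \<in> J then w j else 0) *\<^sub>R z j) + (\<Sum>j\<in>insert i J. (if j = i then c else 0) *\<^sub>R z j)"
      by (simp add: w'_def scaleR_left_distrib sum.distrib)
    also have "(\<Sum>j\<in>insert i J. (if j \<in> J then w j else 0) *\<^sub>R z j) = y"
      unfolding J(3) using J(1) by (intro sum.mono_neutral_cong_right) auto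
    also have "(\<Sum>j\<in>insert i J. (if j = i then c else 0) *\<^sub>R z j) = (\<Sum>j\<in>insert i J. if j = i then c *\<^sub>R z i else 0)"
      by (intro sum.cong) auto
    also have "\<dots> = c *\<^sub>R x" using J by simp
    finally show ?case using J by (intro exI[of _ "insert i J"] exI[of _ w']) (auto simp: add.commute)
  qed
  then show thesis using that by blast
qed

text \<open>\<open>z v\<close> represents the coordinate \<open>X v\<close>, and by biorthogonality
  a shift along \<open>d v\<close> changes this coordinate only. The last assumption says that the
  coordinates are independent centred Gaussian variables with variances
  \<open>1 / \<kappa> v\<close>.\<close>

locale gaussian_frame =
  fixes M :: "'k::{real_inner,second_countable_topology} measure"
    and z d :: "'i \<Rightarrow> 'k" and \<kappa> :: "'i \<Rightarrow> real"
  assumes prob: "prob_space M" and sets_M: "sets M = sets borel"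
    and \<kappa>_pos: "\<kappa> v > 0"
    and biorth: "d v \<bullet> z v' = (if v = v' then 1 else 0)"
    and dense: "closure (span (range z)) = UNIV"
    and char_fun: "finite J \<Longrightarrow> (CLINT u|M. iexp (u \<bullet> (\<Sum>j\<in>J. w j *\<^sub>R z j)))
        = complex_of_real (exp (- (\<Sum>j\<in>J. (w j)\<^sup>2 / \<kappa> j) / 2))"
begin

sublocale prob_space M by (rule prob)

abbreviation X :: "'i \<Rightarrow> 'k \<Rightarrow> real" where "X v u \<equiv> u \<bullet> z v"

lemma meas_M: "f \<in> measurable M N \<longleftrightarrow> f \<in> measurable borel N"
  using measurable_cong_sets[OF sets_M refl] by auto

lemma measurable_continuous: "continuous_on UNIV f \<Longrightarrow> f \<in> borel_measurable M"
  unfolding meas_M by (rule borel_measurable_continuous_onI)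

lemma measurable_inner[measurable]: "(\<lambda>u. u \<bullet> y) \<in> borel_measurable M"
  by (intro measurable_continuous continuous_intros)

text \<open>Overwrites the coordinate \<open>v\<close> with a standard normal sample rescaled to
  variance \<open>1 / \<kappa> v\<close> and leaves the other coordinates as they are.\<close>

definition resample :: "'i \<Rightarrow> real \<times> 'k \<Rightarrow> 'k" where
  "resample v p = snd p + (fst p / sqrt (\<kappa> v) - X v (snd p)) *\<^sub>R d v"

lemma resample_measurable[measurable]: "resample v \<in> borel_measurable (std_normal_distribution \<Otimes>\<^sub>M M)"
  and snd_measurable[measurable]: "snd \<in> borel_measurable (std_normal_distribution \<Otimes>\<^sub>M M)"
proof -
  show [measurable]: "snd \<in> borel_measurable (std_normal_distribution \<Otimes>\<^sub>M M)"
    using measurable_snd[of std_normal_distribution M] measurable_cong_sets[OF refl sets_M] by blast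
  have [measurable]: "fst \<in> borel_measurable (std_normal_distribution \<Otimes>\<^sub>M M)"
    using measurable_fst[of std_normal_distribution M] by (simp cong: measurable_cong_sets)
  show "resample v \<in> borel_measurable (std_normal_distribution \<Otimes>\<^sub>M M)"
    unfolding resample_def[abs_def] by measurable
qed

text \<open>The law of \<open>M\<close> is unchanged when one coordinate is replaced by an independent copy.\<close>

lemma disintegration:
  "M = distr (std_normal_distribution \<Otimes>\<^sub>M M) borel (resample v)"
    (is "_ = distr ?P borel ?m")
proof -
  interpret S: prob_space std_normal_distribution by (rule prob_space_normal_density) simp
  interpret P: pair_prob_space std_normal_distribution M ..
  show ?thesis
  proof (rule finite_measure_eqI_char_functional[OF _ sets_M _ _ dense])
    show "finite_measure M" by unfold_locales
    show "finite_measure (distr ?P borel ?m)" by (intro P.finite_measure_distr) auto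
    fix y assume "y \<in> span (range z)"
    then obtain J w where J: "finite J" "v \<in> J" and y: "y = (\<Sum>j\<in>J. w j *\<^sub>R z j)"
      by (rule span_range_explicit)
    define y' where "y' = (\<Sum>j\<in>J - {v}. w j *\<^sub>R z j)"
    have yy': "y = w v *\<^sub>R z v + y'" unfolding y y'_def using J by (simp add: sum.remove)
    have dy': "d v \<bullet> y' = 0" unfolding y'_def by (auto simp: inner_sum_right biorth intro!: sum.neutral split: if_splits)
    define a where "a = w v / sqrt (\<kappa> v)"
    \<comment> \<open>Since \<open>d v\<close> is orthogonal to \<open>y'\<close>, the exponent
      separates into one term for the new sample and one for the remaining coordinates.\<close>
    have "?m p \<bullet> y = a * fst p + snd p \<bullet> y'" for p
      by (simp add: resample_def yy' inner_simps dy' biorth a_def algebra_simps)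
    then have e: "iexp (?m p \<bullet> y) = iexp (a * fst p) * iexp (snd p \<bullet> y')" for p
      by (simp add: exp_add algebra_simps)
    have "(CLINT u|distr ?P borel ?m. iexp (u \<bullet> y)) = (CLINT p|?P. iexp (a * fst p) * iexp (snd p \<bullet> y'))"
      by (subst integral_distr) (auto simp: e simp del: of_real_mult)
    also have "\<dots> = (CLINT s|std_normal_distribution. CLINT u|M. iexp (a * s) * iexp (u \<bullet> y'))"
    proof -
      have "integrable ?P (\<lambda>p. iexp (a * fst p) * iexp (snd p \<bullet> y'))"
        by (rule P.integrable_const_bound[where B = 1]) (auto simp: norm_mult)
      from P.integral_fst'[OF this] show ?thesis by simp
    qed
    also have "\<dots> = (CLINT s|std_normal_distribution. iexp (a * s)) * (CLINT u|M. iexp (u \<bullet> y'))"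
      by simp
    also have "(CLINT s|std_normal_distribution. iexp (a * s)) = complex_of_real (exp (- a\<^sup>2 / 2))"
      using char_std_normal_distribution by (simp add: char_def fun_eq_iff)
    also have "(CLINT u|M. iexp (u \<bullet> y')) = complex_of_real (exp (- (\<Sum>j\<in>J-{v}. (w j)\<^sup>2 / \<kappa> j) / 2))"
      unfolding y'_def using J by (intro char_fun) auto
    also have "complex_of_real (exp (- a\<^sup>2 / 2)) * \<dots> = complex_of_real (exp (- (\<Sum>j\<in>J. (w j)\<^sup>2 / \<kappa> j) / 2))"
    proof -
      have "a\<^sup>2 = (w v)\<^sup>2 / \<kappa> v" using \<kappa>_pos[of v] by (simp add: a_def power_divide)
      then have "- a\<^sup>2 / 2 + (- (\<Sum>j\<in>J-{v}. (w j)\<^sup>2 / \<kappa> j) / 2) = - (\<Sum>j\<in>J. (w j)\<^sup>2 / \<kappa> j) / 2"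
        using J by (simp add: sum.remove[of J v] field_simps)
      then show ?thesis by (simp only: of_real_mult[symmetric] exp_add[symmetric])
    qed
    also have "\<dots> = (CLINT u|M. iexp (u \<bullet> y))"
      unfolding y using J by (intro char_fun[symmetric]) auto
    finally show "(CLINT u|M. iexp (u \<bullet> y)) = (CLINT u|distr ?P borel ?m. iexp (u \<bullet> y))" by simp
  qed simp
qed

lemma coordinate_distr: "distr M borel (\<lambda>u. sqrt (\<kappa> v) * X v u) = std_normal_distribution"
proof (rule Levy_uniqueness)
  show "real_distribution (distr M borel (\<lambda>u. sqrt (\<kappa> v) * X v u))"
    by (rule real_distribution_distr) simp
  show "real_distribution std_normal_distribution" by (rule real_dist_normal_dist)
  show "char (distr M borel (\<lambda>u. sqrt (\<kappa> v) * X v u)) = char std_normal_distribution"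
  proof
    fix t
    have "char (distr M borel (\<lambda>u. sqrt (\<kappa> v) * X v u)) t = (CLINT u|M. iexp (u \<bullet> (\<Sum>j\<in>{v}. (t * sqrt (\<kappa> v)) *\<^sub>R z j)))"
      unfolding char_def by (subst integral_distr) (auto simp: mult_ac)
    also have "\<dots> = complex_of_real (exp (- t\<^sup>2 / 2))"
      using \<kappa>_pos[of v] by (subst char_fun) (auto simp: power_mult_distrib less_imp_le)
    finally show "char (distr M borel (\<lambda>u. sqrt (\<kappa> v) * X v u)) t = char std_normal_distribution t"
      by (simp add: char_std_normal_distribution)
  qed
qed

lemma integrable_X2: "integrable M (\<lambda>u. (X v u)\<^sup>2)"
proof -
  have "integrable (distr M borel (\<lambda>u. sqrt (\<kappa> v) * X v u)) (\<lambda>x. x\<^sup>2)"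
    unfolding coordinate_distr by (rule integrable_std_normal_distribution_moment)
  then have "integrable M (\<lambda>u. (sqrt (\<kappa> v) * X v u)\<^sup>2)"
    by (subst (asm) integrable_distr_eq) auto
  then show ?thesis using \<kappa>_pos[of v] by (simp add: power_mult_distrib)
qed

lemma integrable_bounded: "f \<in> borel_measurable M \<Longrightarrow> (\<And>u. \<bar>f u\<bar> \<le> C) \<Longrightarrow> integrable M f" for f :: "'k \<Rightarrow> real"
  by (rule integrable_const_bound[where B = C]) auto

text \<open>By \<open>disintegration\<close> the coordinate \<open>v\<close> can be integrated first
  with the others frozen, which leaves the one-dimensional identity on a line in direction
  \<open>d v\<close>. The scale \<open>\<sigma> = 1 / sqrt (\<kappa> v)\<close> enters twice,
  through the chain rule and as the size of the coordinate; this gives the factor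
  \<open>\<kappa> v\<close>.\<close>

lemma gaussian_integration_by_parts:
  assumes "C1b (d v) f f'"
  shows "(\<integral>u. f' u \<partial>M) = \<kappa> v * (\<integral>u. X v u * f u \<partial>M)"
proof -
  interpret S: prob_space std_normal_distribution by (rule prob_space_normal_density) simp
  interpret P: pair_prob_space std_normal_distribution M ..
  let ?P = "std_normal_distribution \<Otimes>\<^sub>M M"
  define \<sigma> where "\<sigma> = 1 / sqrt (\<kappa> v)"
  have \<sigma>: "\<sigma> > 0" using \<kappa>_pos[of v] by (simp add: \<sigma>_def)
  let ?m = "resample v"
  have cf: "continuous_on UNIV f" "continuous_on UNIV f'" using assms by (auto simp: C1b_def)
  then have [measurable]: "f \<in> borel_measurable borel" "f' \<in> borel_measurable borel"
    by (auto intro: borel_measurable_continuous_onI)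
  obtain C where C: "\<And>u. \<bar>f u\<bar> \<le> C" "\<And>u. \<bar>f' u\<bar> \<le> C"
    using assms unfolding C1b_def by (metis dual_order.trans linear)
  have IM: "(\<integral>u. g u \<partial>M) = (\<integral>u. \<integral>s. g (u + (s * \<sigma> - X v u) *\<^sub>R d v) \<partial>std_normal_distribution \<partial>M)"
    if g: "integrable M g" for g :: "'k \<Rightarrow> real"
  proof -
    have gm[measurable]: "g \<in> borel_measurable borel" using g meas_M by blast
    have "integrable (distr ?P borel ?m) g" using g by (simp flip: disintegration)
    then have ig: "integrable ?P (\<lambda>p. g (?m p))" by (subst (asm) integrable_distr_eq) auto
    have "(\<integral>u. g u \<partial>M) = (\<integral>u. g u \<partial>distr ?P borel ?m)" by (simp flip: disintegration)
    also have "\<dots> = (\<integral>p. g (?m p) \<partial>?P)" by (subst integral_distr) auto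
    finally have *: "(\<integral>u. g u \<partial>M) = (\<integral>p. g (?m p) \<partial>?P)" .
    show "(\<integral>u. g u \<partial>M) = (\<integral>u. \<integral>s. g (u + (s * \<sigma> - X v u) *\<^sub>R d v) \<partial>std_normal_distribution \<partial>M)"
      unfolding * using P.integral_snd[of "\<lambda>s u. g (?m (s, u))"] ig by (simp add: \<sigma>_def case_prod_unfold resample_def)
  qed
  have int1: "integrable M f'" using C by (intro integrable_bounded[of _ C]) (auto simp: meas_M)
  have X1: "integrable M (X v)" using integrable_X2 by (rule square_integrable_imp_integrable[rotated]) simp
  have int2: "integrable M (\<lambda>u. X v u * f u)"
  proof (rule Bochner_Integration.integrable_bound[of _ "\<lambda>u. X v u * C"])
    show "AE u in M. norm (X v u * f u) \<le> norm (X v u * C)"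
      using C by (auto simp: abs_mult intro!: AE_I2 mult_left_mono order_trans[OF C(1) abs_ge_self])
  qed (use X1 in \<open>auto simp: meas_M\<close>)
  have inner: "\<sigma> * (\<integral>s. f' (u + (s * \<sigma> - X v u) *\<^sub>R d v) \<partial>std_normal_distribution)
      = (\<integral>s. s * f (u + (s * \<sigma> - X v u) *\<^sub>R d v) \<partial>std_normal_distribution)" for u
  proof -
    let ?u = "u - X v u *\<^sub>R d v"
    have eq: "u + (s * \<sigma> - X v u) *\<^sub>R d v = ?u + (\<sigma> * s) *\<^sub>R d v" for s
      by (simp add: algebra_simps)
    have "(\<integral>s. \<sigma> * f' (?u + (\<sigma> * s) *\<^sub>R d v) \<partial>std_normal_distribution) = (\<integral>s. s * f (?u + (\<sigma> * s) *\<^sub>R d v) \<partial>std_normal_distribution)"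
    proof (rule std_normal_integration_by_parts[where C = "max C (\<sigma> * C)"])
      show "((\<lambda>s. f (?u + (\<sigma> * s) *\<^sub>R d v)) has_real_derivative \<sigma> * f' (?u + (\<sigma> * s) *\<^sub>R d v)) (at s)" for s
        by (rule C1b_DERIV[OF assms])
      show "continuous_on UNIV (\<lambda>s. \<sigma> * f' (?u + (\<sigma> * s) *\<^sub>R d v))"
        by (intro continuous_intros continuous_on_compose2[OF cf(2)]) auto
      show "\<bar>f (?u + (\<sigma> * s) *\<^sub>R d v)\<bar> \<le> max C (\<sigma> * C)" for s
        using C(1)[of "?u + (\<sigma> * s) *\<^sub>R d v"] by linarith
      have "\<sigma> * \<bar>f' (?u + (\<sigma> * s) *\<^sub>R d v)\<bar> \<le> \<sigma> * C" for s
        using C(2) \<sigma> by simp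
      then show "\<bar>\<sigma> * f' (?u + (\<sigma> * s) *\<^sub>R d v)\<bar> \<le> max C (\<sigma> * C)" for s
        using \<sigma> by (simp add: abs_mult le_max_iff_disj)
    qed
    then show ?thesis unfolding eq by simp
  qed
  have "(\<integral>u. X v u * f u \<partial>M) = (\<integral>u. \<integral>s. \<sigma> * (s * f (u + (s * \<sigma> - X v u) *\<^sub>R d v)) \<partial>std_normal_distribution \<partial>M)"
    by (subst IM[OF int2]) (simp add: inner_simps biorth algebra_simps)
  also have "\<dots> = \<sigma> * (\<integral>u. (\<integral>s. s * f (u + (s * \<sigma> - X v u) *\<^sub>R d v) \<partial>std_normal_distribution) \<partial>M)"
    by simp
  also have "\<dots> = \<sigma> * (\<sigma> * (\<integral>u. f' u \<partial>M))"
    unfolding inner[symmetric] by (simp add: IM[OF int1])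
  finally show ?thesis using \<kappa>_pos[of v] by (simp add: \<sigma>_def field_simps flip: power2_eq_square)
qed

end

section \<open>Weak derivatives and the chain rule\<close>

definition L2 :: "'a measure \<Rightarrow> ('a \<Rightarrow> real) \<Rightarrow> bool" where
  "L2 M f \<longleftrightarrow> f \<in> borel_measurable M \<and> integrable M (\<lambda>u. (f u)\<^sup>2)"

lemma abs_mult_le_weighted_squares:
  fixes a b \<delta> :: real
  assumes "\<delta> > 0"
  shows "\<bar>a * b\<bar> \<le> \<delta> * b\<^sup>2 + a\<^sup>2 / \<delta>"
proof -
  have "0 \<le> (\<delta> * \<bar>b\<bar> - \<bar>a\<bar>)\<^sup>2 / \<delta>" using assms by simp
  also have "\<dots> = \<delta> * b\<^sup>2 - 2 * \<bar>a * b\<bar> + a\<^sup>2 / \<delta>"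
    using assms by (simp add: field_simps power2_eq_square abs_mult)
  finally show ?thesis by (simp add: abs_mult) (smt (verit) abs_ge_zero mult_nonneg_nonneg)
qed

lemma L2_integrable_mult:
  assumes "L2 M f" "L2 M g"
  shows "integrable M (\<lambda>u. f u * g u)"
proof (rule Bochner_Integration.integrable_bound[of _ "\<lambda>u. 1 * (g u)\<^sup>2 + (f u)\<^sup>2 / 1"])
  show "AE u in M. norm (f u * g u) \<le> norm (1 * (g u)\<^sup>2 + (f u)\<^sup>2 / 1)"
    using abs_mult_le_weighted_squares[of 1] by (intro AE_I2) fastforce
qed (use assms in \<open>auto simp: L2_def\<close>)

lemma L2_diff:
  assumes "L2 M f" "L2 M g"
  shows "L2 M (\<lambda>u. f u - g u)"
proof -
  have "integrable M (\<lambda>u. (f u)\<^sup>2 - 2 * (f u * g u) + (g u)\<^sup>2)"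
    using assms L2_integrable_mult[OF assms] by (auto simp: L2_def)
  then show ?thesis using assms by (auto simp: L2_def power2_diff algebra_simps)
qed

lemma L2_mult_bounded:
  assumes "L2 M f" "g \<in> borel_measurable M" "\<And>u. \<bar>g u\<bar> \<le> C"
  shows "L2 M (\<lambda>u. f u * g u)"
  unfolding L2_def
proof
  show "integrable M (\<lambda>u. (f u * g u)\<^sup>2)"
  proof (rule Bochner_Integration.integrable_bound[of _ "\<lambda>u. (f u)\<^sup>2 * C\<^sup>2"])
    have "(g u)\<^sup>2 \<le> C\<^sup>2" for u using assms(3)[of u] by (simp add: abs_le_square_iff[symmetric])
    then show "AE u in M. norm ((f u * g u)\<^sup>2) \<le> norm ((f u)\<^sup>2 * C\<^sup>2)"
      by (auto simp: power_mult_distrib intro!: AE_I2 mult_left_mono)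
  qed (use assms in \<open>auto simp: L2_def\<close>)
qed (use assms in \<open>auto simp: L2_def\<close>)

text \<open>A weighted form of \<open>2 a b \<le> a\<^sup>2 + b\<^sup>2\<close> takes the place of
  the Cauchy-Schwarz inequality.\<close>

lemma L2_tendsto_mult:
  assumes a: "\<And>n. L2 M (a n)" "(\<lambda>n. \<integral>u. (a n u)\<^sup>2 \<partial>M) \<longlonglongrightarrow> 0" and g: "L2 M g"
  shows "(\<lambda>n. \<integral>u. \<bar>a n u * g u\<bar> \<partial>M) \<longlonglongrightarrow> 0"
proof (rule LIMSEQ_I)
  fix r :: real assume r: "r > 0"
  define K where "K = (\<integral>u. (g u)\<^sup>2 \<partial>M)"
  have K: "K \<ge> 0" by (simp add: K_def)
  \<comment> \<open>This weight keeps the fixed contribution \<open>\<delta> * K\<close> below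
    \<open>r / 2\<close>; the \<open>+ 1\<close> covers \<open>K = 0\<close>.\<close>
  define \<delta> where "\<delta> = r / (2 * (K + 1))"
  have \<delta>: "\<delta> > 0" using r K by (simp add: \<delta>_def)
  have dK: "\<delta> * K < r / 2" using r K by (simp add: \<delta>_def field_simps)
  have pos: "r * \<delta> / 2 > 0" using r \<delta> by simp
  obtain N where N: "\<And>n. n \<ge> N \<Longrightarrow> (\<integral>u. (a n u)\<^sup>2 \<partial>M) < r * \<delta> / 2"
    using order_tendstoD(2)[OF a(2) pos] unfolding eventually_sequentially by blast
  have "norm ((\<integral>u. \<bar>a n u * g u\<bar> \<partial>M) - 0) < r" if n: "n \<ge> N" for n
  proof -
    have "(\<integral>u. \<bar>a n u * g u\<bar> \<partial>M) \<le> (\<integral>u. \<delta> * (g u)\<^sup>2 + (a n u)\<^sup>2 / \<delta> \<partial>M)"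
      using a(1)[of n] g L2_integrable_mult[OF a(1)[of n] g] abs_mult_le_weighted_squares[OF \<delta>]
      by (intro integral_mono) (auto simp: L2_def)
    also have "\<dots> = \<delta> * K + (\<integral>u. (a n u)\<^sup>2 \<partial>M) / \<delta>"
      using a(1)[of n] g by (simp add: L2_def K_def)
    also have "\<dots> < r / 2 + r / 2"
      using dK N[OF n] \<delta> by (intro add_strict_mono) (auto simp: field_simps)
    finally show ?thesis by simp
  qed
  then show "\<exists>N. \<forall>n\<ge>N. norm ((\<integral>u. \<bar>a n u * g u\<bar> \<partial>M) - 0) < r" by blast
qed

lemma integral_tendsto_if_diff_L1:
  fixes f :: "nat \<Rightarrow> 'a \<Rightarrow> real"
  assumes "\<And>n. integrable M (f n)" "integrable M g" "(\<lambda>n. \<integral>u. \<bar>f n u - g u\<bar> \<partial>M) \<longlonglongrightarrow> 0"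
  shows "(\<lambda>n. \<integral>u. f n u \<partial>M) \<longlonglongrightarrow> (\<integral>u. g u \<partial>M)"
proof -
  have "(\<lambda>n. (\<integral>u. f n u \<partial>M) - (\<integral>u. g u \<partial>M)) \<longlonglongrightarrow> 0"
  proof (rule Lim_null_comparison[OF _ assms(3)], rule always_eventually, rule allI)
    fix n
    have "norm ((\<integral>u. f n u \<partial>M) - (\<integral>u. g u \<partial>M)) = norm (\<integral>u. f n u - g u \<partial>M)"
      using assms by simp
    also have "\<dots> \<le> (\<integral>u. \<bar>f n u - g u\<bar> \<partial>M)"
      using integral_norm_bound[of M "\<lambda>u. f n u - g u"] by simp
    finally show "norm ((\<integral>u. f n u \<partial>M) - (\<integral>u. g u \<partial>M)) \<le> (\<integral>u. \<bar>f n u - g u\<bar> \<partial>M)" .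
  qed
  then show ?thesis by (simp add: LIM_zero_iff)
qed

text \<open>The graph of the L2-closure of the derivative in the single direction \<open>d\<close>,
  with approximants in \<open>C1b\<close>. Each component of a Malliavin gradient is of this kind,
  and integration by parts and the chain rule are needed only direction by direction.\<close>

definition W12 :: "'k::real_normed_vector measure \<Rightarrow> 'k \<Rightarrow> ('k \<Rightarrow> real) \<Rightarrow> ('k \<Rightarrow> real) \<Rightarrow> bool" where
  "W12 M d F V \<longleftrightarrow> L2 M F \<and> L2 M V \<and> (\<exists>Fn Vn. (\<forall>n::nat. C1b d (Fn n) (Vn n)) \<and>
     (\<lambda>n. \<integral>u. (Fn n u - F u)\<^sup>2 \<partial>M) \<longlonglongrightarrow> 0 \<and> (\<lambda>n. \<integral>u. (Vn n u - V u)\<^sup>2 \<partial>M) \<longlonglongrightarrow> 0)"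

lemma has_derivative_pair_chain:
  fixes \<Psi> :: "real \<Rightarrow> real \<Rightarrow> real"
  assumes \<Psi>: "((\<lambda>p. \<Psi> (fst p) (snd p)) has_derivative (\<lambda>q. p * fst q + q' * snd q)) (at (f 0, g 0))"
    and f: "(f has_real_derivative f') (at 0)" and g: "(g has_real_derivative g') (at 0)"
  shows "((\<lambda>t. \<Psi> (f t) (g t)) has_real_derivative p * f' + q' * g') (at 0)"
proof -
  have "((\<lambda>t. (f t, g t)) has_derivative (\<lambda>h. (f' * h, g' * h))) (at 0)"
    using f g by (intro has_derivative_Pair) (auto simp: has_field_derivative_def)
  from has_derivative_compose[OF this, of "\<lambda>p. \<Psi> (fst p) (snd p)" "\<lambda>q. p * fst q + q' * snd q"] \<Psi>
  have "((\<lambda>t. \<Psi> (f t) (g t)) has_derivative (\<lambda>h. p * (f' * h) + q' * (g' * h))) (at 0)"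
    by simp
  moreover have "(\<lambda>h. p * (f' * h) + q' * (g' * h)) = (*) (p * f' + q' * g')"
    by (simp add: fun_eq_iff algebra_simps)
  ultimately show ?thesis
    by (simp only: has_field_derivative_def)
qed

context gaussian_frame
begin

lemma L2_bounded: "f \<in> borel_measurable M \<Longrightarrow> (\<And>u. \<bar>f u\<bar> \<le> C) \<Longrightarrow> L2 M f"
  using L2_mult_bounded[of M "\<lambda>_. 1" f C] by (simp add: L2_def)

lemma L2_integrable: "L2 M f \<Longrightarrow> integrable M f"
  using L2_integrable_mult[of M f "\<lambda>_. 1"] by (simp add: L2_def)

lemma L2_X: "L2 M (X v)"
  using integrable_X2 by (simp add: L2_def)

lemma C1b_bound:
  assumes "C1b x f f'"
  obtains C where "\<And>u. \<bar>f u\<bar> \<le> C" "\<And>u. \<bar>f' u\<bar> \<le> C" "C \<ge> 0"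
proof -
  obtain C1 C2 where C: "\<And>u. \<bar>f u\<bar> \<le> C1" "\<And>u. \<bar>f' u\<bar> \<le> C2"
    using assms unfolding C1b_def by blast
  have "C1 \<ge> 0" using C(1)[of undefined] by linarith
  moreover have "\<bar>f u\<bar> \<le> max C1 C2" "\<bar>f' u\<bar> \<le> max C1 C2" for u using C[of u] by linarith+
  ultimately show thesis using that[of "max C1 C2"] by simp
qed

lemma C1b_measurable: "C1b x f f' \<Longrightarrow> f \<in> borel_measurable M" "C1b x f f' \<Longrightarrow> f' \<in> borel_measurable M"
  by (auto simp: C1b_def measurable_continuous)

lemma C1b_L2: assumes "C1b x f f'" shows "L2 M f" "L2 M f'"
proof -
  obtain C where "\<And>u. \<bar>f u\<bar> \<le> C" "\<And>u. \<bar>f' u\<bar> \<le> C" "C \<ge> 0" using C1b_bound[OF assms] by blast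
  then show "L2 M f" "L2 M f'" using C1b_measurable[OF assms] by (auto intro: L2_bounded)
qed

text \<open>This function is minus the Gaussian adjoint of the derivative along \<open>d v\<close>,
  applied to \<open>G\<close>. It is unbounded because of the factor \<open>X v\<close>, but square
  integrable.\<close>

lemma L2_adjoint:
  assumes "C1b (d v) G G'"
  shows "L2 M (\<lambda>u. G' u - \<kappa> v * X v u * G u)"
proof -
  obtain C where C: "\<And>u. \<bar>G u\<bar> \<le> C" "C \<ge> 0" using assms by (rule C1b_bound) blast
  have "\<bar>\<kappa> v * G u\<bar> \<le> \<kappa> v * C" for u using \<kappa>_pos[of v] C by (simp add: abs_mult)
  then have "L2 M (\<lambda>u. X v u * (\<kappa> v * G u))"
    using L2_X C1b_measurable[OF assms] by (intro L2_mult_bounded) auto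
  with C1b_L2(2)[OF assms] have "L2 M (\<lambda>u. G' u - X v u * (\<kappa> v * G u))" by (rule L2_diff)
  then show ?thesis by (simp add: mult_ac)
qed

lemma C1b_integration_by_parts:
  assumes F: "C1b (d v) F F'" and G: "C1b (d v) G G'"
  shows "(\<integral>u. F u * (G' u - \<kappa> v * X v u * G u) \<partial>M) = - (\<integral>u. F' u * G u \<partial>M)"
proof -
  have i: "integrable M (\<lambda>u. F u * (G' u - \<kappa> v * X v u * G u))" "integrable M (\<lambda>u. F' u * G u)"
    by (intro L2_integrable_mult C1b_L2[OF F] L2_adjoint[OF G] C1b_L2[OF G])+
  have FG: "C1b (d v) (\<lambda>u. F u * G u) (\<lambda>u. F' u * G u + F u * G' u)" by (rule C1b_mult[OF F G])
  have "(\<integral>u. F' u * G u + F u * G' u \<partial>M) = \<kappa> v * (\<integral>u. X v u * (F u * G u) \<partial>M)"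
    by (rule gaussian_integration_by_parts[OF FG])
  also have "\<dots> = (\<integral>u. \<kappa> v * (X v u * (F u * G u)) \<partial>M)" by simp
  also have "\<dots> = (\<integral>u. (F' u * G u + F u * G' u) - (F u * (G' u - \<kappa> v * X v u * G u) + F' u * G u) \<partial>M)"
    by (intro Bochner_Integration.integral_cong) (auto simp: algebra_simps)
  also have "\<dots> = (\<integral>u. F' u * G u + F u * G' u \<partial>M) - ((\<integral>u. F u * (G' u - \<kappa> v * X v u * G u) \<partial>M) + (\<integral>u. F' u * G u \<partial>M))"
    using i L2_integrable[OF C1b_L2(2)[OF FG]] by (subst Bochner_Integration.integral_diff) auto
  finally show ?thesis by simp
qed

lemma W12_integration_by_parts:
  assumes F: "W12 M (d v) F V" and G: "C1b (d v) G G'"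
  shows "(\<integral>u. F u * (G' u - \<kappa> v * X v u * G u) \<partial>M) = - (\<integral>u. V u * G u \<partial>M)"
proof -
  obtain Fn Vn where n: "\<And>n::nat. C1b (d v) (Fn n) (Vn n)"
     "(\<lambda>n. \<integral>u. (Fn n u - F u)\<^sup>2 \<partial>M) \<longlonglongrightarrow> 0" "(\<lambda>n. \<integral>u. (Vn n u - V u)\<^sup>2 \<partial>M) \<longlonglongrightarrow> 0" and L: "L2 M F" "L2 M V"
    using F unfolding W12_def by blast
  have conv: "(\<lambda>n. \<integral>u. A n u * g u \<partial>M) \<longlonglongrightarrow> (\<integral>u. B u * g u \<partial>M)"
    if "\<And>n. L2 M (A n)" "L2 M B" "L2 M g" "(\<lambda>n. \<integral>u. (A n u - B u)\<^sup>2 \<partial>M) \<longlonglongrightarrow> 0" for A :: "nat \<Rightarrow> 'k \<Rightarrow> real" and B g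
  proof (rule integral_tendsto_if_diff_L1)
    show "(\<lambda>n. \<integral>u. \<bar>A n u * g u - B u * g u\<bar> \<partial>M) \<longlonglongrightarrow> 0"
      using L2_tendsto_mult[of M "\<lambda>n u. A n u - B u" g] that L2_diff[OF that(1,2)] by (simp add: left_diff_distrib)
  qed (use that L2_integrable_mult in auto)
  have "(\<lambda>n. \<integral>u. Fn n u * (G' u - \<kappa> v * X v u * G u) \<partial>M) \<longlonglongrightarrow> (\<integral>u. F u * (G' u - \<kappa> v * X v u * G u) \<partial>M)"
    by (rule conv[OF C1b_L2(1)[OF n(1)] L(1) L2_adjoint[OF G] n(2)])
  moreover have "(\<lambda>n. \<integral>u. Vn n u * G u \<partial>M) \<longlonglongrightarrow> (\<integral>u. V u * G u \<partial>M)"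
    by (rule conv[OF C1b_L2(2)[OF n(1)] L(2) C1b_L2(1)[OF G] n(3)])
  then have "(\<lambda>n. \<integral>u. Fn n u * (G' u - \<kappa> v * X v u * G u) \<partial>M) \<longlonglongrightarrow> - (\<integral>u. V u * G u \<partial>M)"
    unfolding C1b_integration_by_parts[OF n(1) G] by (rule tendsto_minus)
  ultimately show ?thesis by (rule LIMSEQ_unique)
qed

lemma integrable_mult_bounded:
  fixes f g :: "'k \<Rightarrow> real"
  assumes "integrable M f" "g \<in> borel_measurable M" "\<And>u. \<bar>g u\<bar> \<le> C"
  shows "integrable M (\<lambda>u. g u * f u)"
proof (rule Bochner_Integration.integrable_bound[of _ "\<lambda>u. C * f u"])
  show "AE u in M. norm (g u * f u) \<le> norm (C * f u)"
    by (auto simp: abs_mult intro!: AE_I2 mult_right_mono order_trans[OF assms(3) abs_ge_self])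
qed (use assms in auto)

text \<open>The limit theorem behind the chain rule: derivatives converge in L2, their coefficients
  only boundedly almost everywhere. In \<open>p n * (a n - b) + p n * b\<close> the first term is
  small by L2-convergence, and the second converges by domination.\<close>

lemma integral_bounded_mult_L2_tendsto:
  fixes p :: "nat \<Rightarrow> 'k \<Rightarrow> real"
  assumes a: "\<And>n. L2 M (a n)" "L2 M b" "(\<lambda>n. \<integral>u. (a n u - b u)\<^sup>2 \<partial>M) \<longlonglongrightarrow> 0"
    and p: "\<And>n. p n \<in> borel_measurable M" "q \<in> borel_measurable M" "\<And>n u. \<bar>p n u\<bar> \<le> C"
      "AE u in M. (\<lambda>n. p n u) \<longlonglongrightarrow> q u"
  shows "(\<lambda>n. \<integral>u. p n u * a n u \<partial>M) \<longlonglongrightarrow> (\<integral>u. q u * b u \<partial>M)"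
proof -
  note p(1,2)[measurable]
  have L: "L2 M (\<lambda>u. a n u - b u)" for n by (intro L2_diff a)
  have [measurable]: "b \<in> borel_measurable M" using a(2) by (simp add: L2_def)
  have int: "integrable M (\<lambda>u. p n u * f u)" if "L2 M f" for n f
    by (rule integrable_mult_bounded[OF L2_integrable[OF that] p(1,3)])
  have "(\<lambda>n. \<integral>u. p n u * (a n u - b u) \<partial>M) \<longlonglongrightarrow> 0"
  proof (rule Lim_null_comparison[OF always_eventually])
    show "(\<lambda>n. \<integral>u. \<bar>(a n u - b u) * C\<bar> \<partial>M) \<longlonglongrightarrow> 0"
      by (rule L2_tendsto_mult[OF L a(3)]) (simp add: L2_def)
    show "\<forall>n. norm (\<integral>u. p n u * (a n u - b u) \<partial>M) \<le> (\<integral>u. \<bar>(a n u - b u) * C\<bar> \<partial>M)"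
    proof (intro allI order_trans[OF integral_norm_bound] integral_mono)
      show "integrable M (\<lambda>u. norm (p n u * (a n u - b u)))" for n by (intro integrable_norm int L)
      show "integrable M (\<lambda>u. \<bar>(a n u - b u) * C\<bar>)" for n using L2_integrable[OF L[of n]] by simp
      show "norm (p n u * (a n u - b u)) \<le> \<bar>(a n u - b u) * C\<bar>" for n u
        using order_trans[OF p(3)[of n u] abs_ge_self] by (simp add: abs_mult mult.commute[of _ C] mult_right_mono)
    qed
  qed
  moreover have "(\<lambda>n. \<integral>u. p n u * b u \<partial>M) \<longlonglongrightarrow> (\<integral>u. q u * b u \<partial>M)"
  proof (rule integral_dominated_convergence[where w = "\<lambda>u. C * \<bar>b u\<bar>"])
    show "AE u in M. (\<lambda>n. p n u * b u) \<longlonglongrightarrow> q u * b u"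
      using p(4) by eventually_elim (intro tendsto_mult_right)
    show "AE u in M. norm (p n u * b u) \<le> C * \<bar>b u\<bar>" for n
      using p(3) by (auto simp: abs_mult intro!: AE_I2 mult_right_mono)
  qed (use L2_integrable[OF a(2)] in auto)
  ultimately have "(\<lambda>n. (\<integral>u. p n u * (a n u - b u) \<partial>M) + (\<integral>u. p n u * b u \<partial>M)) \<longlonglongrightarrow> 0 + (\<integral>u. q u * b u \<partial>M)"
    by (rule tendsto_add)
  moreover have "(\<integral>u. p n u * (a n u - b u) \<partial>M) + (\<integral>u. p n u * b u \<partial>M) = (\<integral>u. p n u * a n u \<partial>M)" for n
    using int[OF a(1)] int[OF a(2)] by (simp add: right_diff_distrib)
  ultimately show ?thesis by simp
qed

text \<open>The rule is stated in weak form, tested against \<open>G\<close>. The compositions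
  \<open>\<Psi> (Fn n) (Hn n)\<close> belong to \<open>C1b\<close> and satisfy integration by parts;
  boundedness of \<open>\<Psi>1\<close> and \<open>\<Psi>2\<close> is what allows the limit, since
  they converge only almost everywhere.\<close>

lemma W12_chain:
  fixes \<Psi> \<Psi>1 \<Psi>2 :: "real \<Rightarrow> real \<Rightarrow> real"
  assumes F: "W12 M (d v) F V" and H: "W12 M (d v) H W" and G: "C1b (d v) G G'"
    and c: "continuous_on UNIV (\<lambda>p. \<Psi> (fst p) (snd p))" "continuous_on UNIV (\<lambda>p. \<Psi>1 (fst p) (snd p))"
       "continuous_on UNIV (\<lambda>p. \<Psi>2 (fst p) (snd p))"
    and b: "\<And>r h. \<bar>\<Psi> r h\<bar> \<le> B" "\<And>r h. \<bar>\<Psi>1 r h\<bar> \<le> B" "\<And>r h. \<bar>\<Psi>2 r h\<bar> \<le> B"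
    and der: "\<And>r h. ((\<lambda>p. \<Psi> (fst p) (snd p)) has_derivative (\<lambda>q. \<Psi>1 r h * fst q + \<Psi>2 r h * snd q)) (at (r, h))"
  shows "(\<integral>u. \<Psi> (F u) (H u) * (G' u - \<kappa> v * X v u * G u) \<partial>M)
    = - (\<integral>u. (\<Psi>1 (F u) (H u) * V u + \<Psi>2 (F u) (H u) * W u) * G u \<partial>M)"
proof -
  obtain Fn Vn where n: "\<And>n::nat. C1b (d v) (Fn n) (Vn n)"
     "(\<lambda>n. \<integral>u. (Fn n u - F u)\<^sup>2 \<partial>M) \<longlonglongrightarrow> 0" "(\<lambda>n. \<integral>u. (Vn n u - V u)\<^sup>2 \<partial>M) \<longlonglongrightarrow> 0" and L: "L2 M F" "L2 M V"
    using F unfolding W12_def by blast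
  obtain Hn Wn where m: "\<And>n::nat. C1b (d v) (Hn n) (Wn n)"
     "(\<lambda>n. \<integral>u. (Hn n u - H u)\<^sup>2 \<partial>M) \<longlonglongrightarrow> 0" "(\<lambda>n. \<integral>u. (Wn n u - W u)\<^sup>2 \<partial>M) \<longlonglongrightarrow> 0" and K: "L2 M H" "L2 M W"
    using H unfolding W12_def by blast
  have [measurable]: "F \<in> borel_measurable M" "H \<in> borel_measurable M" "G \<in> borel_measurable M"
      "Fn n \<in> borel_measurable M" "Hn n \<in> borel_measurable M" for n
    using L K by (auto simp: L2_def intro: C1b_measurable[OF n(1)] C1b_measurable[OF m(1)] C1b_measurable[OF G])
  have Fd: "L2 M (\<lambda>u. Fn n u - F u)" "L2 M (\<lambda>u. Hn n u - H u)" for n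
    by (intro L2_diff C1b_L2[OF n(1)] C1b_L2[OF m(1)] L K)+
  \<comment> \<open>The sum of the squared errors converges in L1, so one subsequence converges
    almost everywhere for both sequences.\<close>
  have "(\<lambda>n. (\<integral>u. (Fn n u - F u)\<^sup>2 \<partial>M) + (\<integral>u. (Hn n u - H u)\<^sup>2 \<partial>M)) \<longlonglongrightarrow> 0 + 0"
    by (intro tendsto_add n m)
  then have "(\<lambda>n. \<integral>u. norm ((Fn n u - F u)\<^sup>2 + (Hn n u - H u)\<^sup>2) \<partial>M) \<longlonglongrightarrow> 0"
    using Fd by (simp add: L2_def)
  from tendsto_L1_AE_subseq[OF _ this] obtain r where r: "strict_mono r"
      "AE u in M. (\<lambda>n. (Fn (r n) u - F u)\<^sup>2 + (Hn (r n) u - H u)\<^sup>2) \<longlonglongrightarrow> 0"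
    using Fd by (auto simp: L2_def)
  let ?p = "\<lambda>\<Phi> n u. \<Phi> (Fn (r n) u) (Hn (r n) u)" and ?q = "\<lambda>\<Phi> u. \<Phi> (F u) (H u)"
  have lim: "AE u in M. (\<lambda>n. ?p \<Phi> n u) \<longlonglongrightarrow> ?q \<Phi> u"
    if "continuous_on UNIV (\<lambda>p. \<Phi> (fst p) (snd p))" for \<Phi> :: "real \<Rightarrow> real \<Rightarrow> real"
    using r(2)
  proof eventually_elim
    case (elim u)
    have sq: "(\<lambda>n. a n) \<longlonglongrightarrow> 0" if "\<And>n. (a n)\<^sup>2 \<le> (Fn (r n) u - F u)\<^sup>2 + (Hn (r n) u - H u)\<^sup>2" for a :: "nat \<Rightarrow> real"
    proof -
      have "(\<lambda>n. (a n)\<^sup>2) \<longlonglongrightarrow> 0"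
        by (rule Lim_null_comparison[OF _ elim]) (use that in auto)
      from tendsto_real_sqrt[OF this] show ?thesis by (simp add: tendsto_rabs_zero_iff)
    qed
    have "(\<lambda>n. Fn (r n) u) \<longlonglongrightarrow> F u" "(\<lambda>n. Hn (r n) u) \<longlonglongrightarrow> H u"
      using sq[of "\<lambda>n. Fn (r n) u - F u"] sq[of "\<lambda>n. Hn (r n) u - H u"] by (simp_all add: LIM_zero_iff)
    moreover have "isCont (\<lambda>p. \<Phi> (fst p) (snd p)) (F u, H u)"
      using that by (simp add: continuous_on_eq_continuous_at)
    ultimately show ?case
      using isCont_tendsto_compose[OF _ tendsto_Pair] by fastforce
  qed
  have pm: "?p \<Phi> n \<in> borel_measurable M" "?q \<Phi> \<in> borel_measurable M"
    if "continuous_on UNIV (\<lambda>p. \<Phi> (fst p) (snd p))" for \<Phi> :: "real \<Rightarrow> real \<Rightarrow> real" and n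
    using borel_measurable_continuous_Pair[of "Fn (r n)" M "Hn (r n)" "\<lambda>x y. \<Phi> x y"]
      borel_measurable_continuous_Pair[of F M H "\<lambda>x y. \<Phi> x y"] that by (auto simp: split_beta')
  have B0: "B \<ge> 0" using b(1)[of 0 0] by linarith
  obtain C where C: "\<And>u. \<bar>G u\<bar> \<le> C" "C \<ge> 0" using G by (rule C1b_bound) blast
  have comp: "C1b (d v) (\<lambda>u. \<Psi> (Fn n u) (Hn n u)) (\<lambda>u. \<Psi>1 (Fn n u) (Hn n u) * Vn n u + \<Psi>2 (Fn n u) (Hn n u) * Wn n u)" for n
    unfolding C1b_def
  proof (intro conjI allI)
    have cc: "continuous_on UNIV (Fn n)" "continuous_on UNIV (Hn n)" "continuous_on UNIV (Vn n)" "continuous_on UNIV (Wn n)"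
      using n(1)[of n] m(1)[of n] by (auto simp: C1b_def)
    have cp: "continuous_on UNIV (\<lambda>u. \<Phi> (Fn n u) (Hn n u))"
      if "continuous_on UNIV (\<lambda>p. \<Phi> (fst p) (snd p))" for \<Phi> :: "real \<Rightarrow> real \<Rightarrow> real"
      using continuous_on_compose2[OF that, of UNIV "\<lambda>u. (Fn n u, Hn n u)"] cc by (simp add: continuous_on_Pair)
    show "continuous_on UNIV (\<lambda>u. \<Psi> (Fn n u) (Hn n u))"
      "continuous_on UNIV (\<lambda>u. \<Psi>1 (Fn n u) (Hn n u) * Vn n u + \<Psi>2 (Fn n u) (Hn n u) * Wn n u)"
      by (intro continuous_intros cp c cc)+
    show "\<exists>C. \<forall>u. \<bar>\<Psi> (Fn n u) (Hn n u)\<bar> \<le> C" using b by blast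
    obtain C1 where C1: "\<And>u. \<bar>Vn n u\<bar> \<le> C1" "C1 \<ge> 0" using n(1)[of n] by (rule C1b_bound) blast
    obtain C2 where C2: "\<And>u. \<bar>Wn n u\<bar> \<le> C2" "C2 \<ge> 0" using m(1)[of n] by (rule C1b_bound) blast
    have "\<bar>\<Psi>1 (Fn n u) (Hn n u) * Vn n u + \<Psi>2 (Fn n u) (Hn n u) * Wn n u\<bar> \<le> B * C1 + B * C2" for u
      using b C1 C2 B0 by (intro order_trans[OF abs_triangle_ineq] add_mono) (auto simp: abs_mult intro!: mult_mono)
    then show "\<exists>C. \<forall>u. \<bar>\<Psi>1 (Fn n u) (Hn n u) * Vn n u + \<Psi>2 (Fn n u) (Hn n u) * Wn n u\<bar> \<le> C" by blast
    show "((\<lambda>t. \<Psi> (Fn n (u + t *\<^sub>R d v)) (Hn n (u + t *\<^sub>R d v))) has_real_derivative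
        \<Psi>1 (Fn n u) (Hn n u) * Vn n u + \<Psi>2 (Fn n u) (Hn n u) * Wn n u) (at 0)" for u
      by (rule has_derivative_pair_chain) (use der n(1)[of n] m(1)[of n] in \<open>auto simp: C1b_def\<close>)
  qed
  have tend: "(\<lambda>n. \<integral>u. (?p \<Phi> n u * g u) * An (r n) u \<partial>M) \<longlonglongrightarrow> (\<integral>u. (?q \<Phi> u * g u) * A u \<partial>M)"
    and int: "integrable M (\<lambda>u. (?p \<Phi> k u * g u) * An (r k) u)" "integrable M (\<lambda>u. (?q \<Phi> u * g u) * A u)"
    if \<Phi>: "continuous_on UNIV (\<lambda>p. \<Phi> (fst p) (snd p))" "\<And>r h. \<bar>\<Phi> r h\<bar> \<le> B"
      and g: "g \<in> borel_measurable M" "\<And>u. \<bar>g u\<bar> \<le> K"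
      and A: "\<And>n. L2 M (An n)" "L2 M A" "(\<lambda>n. \<integral>u. (An n u - A u)\<^sup>2 \<partial>M) \<longlonglongrightarrow> 0"
    for \<Phi> :: "real \<Rightarrow> real \<Rightarrow> real" and g An A k K
  proof -
    note g(1)[measurable] pm[OF \<Phi>(1), measurable]
    have bd: "\<bar>\<Phi> a b * g u\<bar> \<le> B * K" for a b u
      using \<Phi>(2)[of a b] g(2)[of u] B0 by (auto simp: abs_mult intro!: mult_mono)
    show "(\<lambda>n. \<integral>u. (?p \<Phi> n u * g u) * An (r n) u \<partial>M) \<longlonglongrightarrow> (\<integral>u. (?q \<Phi> u * g u) * A u \<partial>M)"
    proof (rule integral_bounded_mult_L2_tendsto[OF A(1,2) _ _ _ bd])
      show "(\<lambda>n. \<integral>u. (An (r n) u - A u)\<^sup>2 \<partial>M) \<longlonglongrightarrow> 0"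
        using LIMSEQ_subseq_LIMSEQ[OF A(3) r(1)] by (simp add: o_def)
      show "AE u in M. (\<lambda>n. ?p \<Phi> n u * g u) \<longlonglongrightarrow> ?q \<Phi> u * g u"
        using lim[OF \<Phi>(1)] by eventually_elim (intro tendsto_mult_right)
    qed measurable
    show "integrable M (\<lambda>u. (?p \<Phi> k u * g u) * An (r k) u)" "integrable M (\<lambda>u. (?q \<Phi> u * g u) * A u)"
      by (rule integrable_mult_bounded[OF L2_integrable[OF A(1)] _ bd], measurable,
          rule integrable_mult_bounded[OF L2_integrable[OF A(2)] _ bd], measurable)
  qed
  let ?Q = "\<lambda>u. G' u - \<kappa> v * X v u * G u"
  \<comment> \<open>Here \<open>tend\<close> is used with the constant L2-sequence \<open>?Q\<close>
    and the test factor 1.\<close>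
  have lhs: "(\<lambda>n. \<integral>u. (?p \<Psi> n u * 1) * ?Q u \<partial>M) \<longlonglongrightarrow> (\<integral>u. (?q \<Psi> u * 1) * ?Q u \<partial>M)"
    by (rule tend[OF c(1) b(1), of "\<lambda>_. 1" 1 "\<lambda>_. ?Q"]) (use L2_adjoint[OF G] in auto)
  note Gm = C1b_measurable(1)[OF G]
  note i1 = int[OF c(2) b(2) Gm C(1) C1b_L2(2)[OF n(1)] L(2) n(3)]
    and i2 = int[OF c(3) b(3) Gm C(1) C1b_L2(2)[OF m(1)] K(2) m(3)]
  have "(\<integral>u. (?p \<Psi> n u * 1) * ?Q u \<partial>M) = - ((\<integral>u. (?p \<Psi>1 n u * G u) * Vn (r n) u \<partial>M) + (\<integral>u. (?p \<Psi>2 n u * G u) * Wn (r n) u \<partial>M))" for n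
    using C1b_integration_by_parts[OF comp[of "r n"] G] i1(1)[of n] i2(1)[of n]
    by (simp add: algebra_simps)
  with lhs have "(\<lambda>n. - ((\<integral>u. (?p \<Psi>1 n u * G u) * Vn (r n) u \<partial>M) + (\<integral>u. (?p \<Psi>2 n u * G u) * Wn (r n) u \<partial>M)))
      \<longlonglongrightarrow> (\<integral>u. (?q \<Psi> u * 1) * ?Q u \<partial>M)" by (simp only:)
  from LIMSEQ_unique[OF this tendsto_minus[OF tendsto_add[OF
      tend[OF c(2) b(2) Gm C(1) C1b_L2(2)[OF n(1)] L(2) n(3)] tend[OF c(3) b(3) Gm C(1) C1b_L2(2)[OF m(1)] K(2) m(3)]]]]
  show ?thesis using i1(2) i2(2) by (simp add: algebra_simps)
qed

end

section \<open>The gradient equation and the Gibbs density\<close>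

text \<open>The cosine is 1-Lipschitz, so the difference quotients are dominated by the integrable
  function \<open>\<bar>T u * Y u\<bar>\<close>.\<close>

lemma DERIV_integral_cos:
  fixes T Y :: "'a \<Rightarrow> real"
  assumes [measurable]: "T \<in> borel_measurable M" "Y \<in> borel_measurable M"
    and TY: "integrable M (\<lambda>u. T u * Y u)" and T: "\<And>t. integrable M (\<lambda>u. T u * cos (t * Y u + p))"
  shows "((\<lambda>t. \<integral>u. T u * cos (t * Y u + p) \<partial>M) has_real_derivative
    (\<integral>u. (T u * Y u) * - sin (t * Y u + p) \<partial>M)) (at t)"
  unfolding DERIV_def tendsto_at_iff_sequentially comp_def
proof (intro allI impI)
  fix X :: "nat \<Rightarrow> real" assume X: "\<forall>i. X i \<in> UNIV - {0}" "X \<longlonglongrightarrow> 0"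
  let ?g = "\<lambda>t u. cos (t * Y u + p)" and ?g' = "\<lambda>u. - sin (t * Y u + p)"
  let ?q = "\<lambda>i u. (?g (t + X i) u - ?g t u) / X i"
  have eq: "(\<integral>u. T u * ?q i u \<partial>M) = ((\<integral>u. T u * ?g (t + X i) u \<partial>M) - (\<integral>u. T u * ?g t u \<partial>M)) / X i" for i
  proof -
    have "T u * ?q i u = (T u * ?g (t + X i) u - T u * ?g t u) / X i" for u
      by (simp add: right_diff_distrib)
    then show ?thesis by (simp only: Bochner_Integration.integral_diff integral_divide_zero T)
  qed
  have "(\<lambda>i. \<integral>u. T u * ?q i u \<partial>M) \<longlonglongrightarrow> (\<integral>u. (T u * Y u) * ?g' u \<partial>M)"
  proof (rule integral_dominated_convergence[where w = "\<lambda>u. \<bar>T u * Y u\<bar>"])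
    show "AE u in M. (\<lambda>i. T u * ?q i u) \<longlonglongrightarrow> (T u * Y u) * ?g' u"
    proof (rule AE_I2)
      fix u
      have "((\<lambda>r. ?g r u) has_real_derivative ?g' u * Y u) (at t)"
        by (auto intro!: derivative_eq_intros)
      then have "(\<lambda>i. ?q i u) \<longlonglongrightarrow> ?g' u * Y u"
        using X unfolding DERIV_def tendsto_at_iff_sequentially comp_def by blast
      from tendsto_mult_left[OF this, of "T u"] show "(\<lambda>i. T u * ?q i u) \<longlonglongrightarrow> (T u * Y u) * ?g' u"
        by (simp add: mult_ac)
    qed
    have lip: "\<bar>cos x - cos y\<bar> \<le> \<bar>x - y\<bar>" for x y :: real
      using field_differentiable_bound[of UNIV cos "\<lambda>x. - sin x" 1 x y] by simp
    show "AE u in M. norm (T u * ?q i u) \<le> \<bar>T u * Y u\<bar>" for i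
    proof (rule AE_I2)
      fix u
      have "\<bar>?g (t + X i) u - ?g t u\<bar> \<le> \<bar>X i\<bar> * \<bar>Y u\<bar>"
        using lip[of "(t + X i) * Y u + p" "t * Y u + p"] by (simp add: algebra_simps abs_mult)
      then have "\<bar>?q i u\<bar> \<le> \<bar>Y u\<bar>"
        using X(1) by (simp add: field_simps)
      then show "norm (T u * ?q i u) \<le> \<bar>T u * Y u\<bar>"
        unfolding real_norm_def abs_mult by (intro mult_left_mono) auto
    qed
  qed (use TY in auto)
  then show "(\<lambda>i. ((\<integral>u. T u * ?g (t + X i) u \<partial>M) - (\<integral>u. T u * ?g t u \<partial>M)) / X i) \<longlonglongrightarrow> (\<integral>u. (T u * Y u) * ?g' u \<partial>M)"
    by (simp only: eq)
qed

lemma inverse_one_plus_square: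
  fixes r :: real
  shows "0 < inverse (1 + r\<^sup>2)" "inverse (1 + r\<^sup>2) \<le> 1" "\<bar>r\<bar> * inverse (1 + r\<^sup>2) \<le> 1" "r\<^sup>2 * inverse (1 + r\<^sup>2) \<le> 1"
    "1 + r\<^sup>2 \<noteq> 0"
proof -
  have p: "0 < 1 + r\<^sup>2" by (simp add: add_pos_nonneg)
  have "\<bar>r\<bar> \<le> 1 + r\<^sup>2"
    using zero_le_power2[of "\<bar>r\<bar> - 1"] abs_ge_zero[of r] by (simp add: power2_diff del: zero_le_power2)
  with p show "0 < inverse (1 + r\<^sup>2)" "inverse (1 + r\<^sup>2) \<le> 1" "\<bar>r\<bar> * inverse (1 + r\<^sup>2) \<le> 1" "r\<^sup>2 * inverse (1 + r\<^sup>2) \<le> 1"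
    "1 + r\<^sup>2 \<noteq> 0"
    by (auto simp: field_simps)
qed

text \<open>\<open>exp (Q * t\<^sup>2 / 2)\<close> is an integrating factor.\<close>

lemma gaussian_ode_zero:
  fixes a :: "real \<Rightarrow> real"
  assumes "\<And>t. (a has_real_derivative - t * Q * a t) (at t)" "a 0 = 0"
  shows "a t = 0"
proof -
  have "((\<lambda>t. a t * exp (Q * t\<^sup>2 / 2)) has_real_derivative 0) (at t)" for t
    by (rule derivative_eq_intros assms refl | simp)+
  then have "a t * exp (Q * t\<^sup>2 / 2) = a 0 * exp (Q * 0\<^sup>2 / 2)"
    by (rule DERIV_isconst_all[rule_format])
  then show ?thesis using assms(2) by simp
qed

context gaussian_frame
begin

text \<open>Along the ray through \<open>y\<close>, let \<open>a p t\<close> be the transform of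
  \<open>T\<close>. Differentiating in \<open>t\<close> produces factors \<open>X j\<close>, which
  the vanishing weak derivative trades for \<open>t * w j / \<kappa> j\<close>. So \<open>a\<close>
  solves the equation of \<open>gaussian_ode_zero\<close>, with \<open>Q\<close> the variance of
  \<open>u \<bullet> y\<close>, and it starts at 0 because \<open>T\<close> has mean 0.\<close>

lemma AE_zero_if_weak_gradient_zero:
  assumes T: "T \<in> borel_measurable M" "\<And>u. \<bar>T u\<bar> \<le> C" "(\<integral>u. T u \<partial>M) = 0"
    and weak: "\<And>v G G'. C1b (d v) G G' \<Longrightarrow> (\<integral>u. T u * (G' u - \<kappa> v * X v u * G u) \<partial>M) = 0"
  shows "AE u in M. T u = 0"
proof -
  note T(1)[measurable]
  have L2T: "L2 M T" using T by (intro L2_bounded) auto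
  have main: "(\<integral>u. T u * cos (u \<bullet> y + p) \<partial>M) = 0" if y: "y \<in> span (range z)" for y p
  proof -
    obtain J w where J: "finite J" and yJ: "y = (\<Sum>j\<in>J. w j *\<^sub>R z j)"
      using span_range_explicit[OF y] by metis
    define Q where "Q = (\<Sum>j\<in>J. (w j)\<^sup>2 / \<kappa> j)"
    let ?c = "\<lambda>p t u. cos (t * (u \<bullet> y) + p)" and ?s = "\<lambda>p t u. sin (t * (u \<bullet> y) + p)"
    have dy: "d j \<bullet> y = w j" if "j \<in> J" for j
      using J that by (simp add: yJ inner_sum_right biorth if_distrib[where f = "\<lambda>x. _ * x"] cong: if_cong)
    have Ly: "L2 M (\<lambda>u. u \<bullet> y)"
    proof -
      have "L2 M (\<lambda>u. \<Sum>j\<in>J'. w j * (u \<bullet> z j))" if "finite J'" for J'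
        using that
      proof induction
        case (insert j J')
        have "L2 M (\<lambda>u. (u \<bullet> z j) * - w j)"
          by (rule L2_mult_bounded[OF L2_X]) auto
        from L2_diff[OF insert.IH this] insert.hyps show ?case by (simp add: algebra_simps)
      qed (simp add: L2_def)
      from this[OF J] show ?thesis by (simp add: yJ inner_sum_right)
    qed
    have iT: "integrable M (\<lambda>u. T u * ?c p t u)" for p t
      by (rule L2_integrable_mult[OF L2T]; rule L2_bounded[of _ 1]; simp)
    have iX: "integrable M (\<lambda>u. T u * X j u * ?s p t u)" for p t j
      by (rule L2_integrable_mult[where f = "\<lambda>u. T u * X j u", OF _ L2_bounded[of _ 1]];
          (simp add: mult.commute[of "T _"] L2_mult_bounded[OF L2_X T(1,2)])?)
    have exp_Y: "T u * (u \<bullet> y) * - x = (\<Sum>j\<in>J. - w j * (T u * X j u * x))" for u x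
      by (simp add: yJ inner_sum_right sum_distrib_left sum_distrib_right sum_negf mult_ac)
    define a where "a p t = (\<integral>u. T u * ?c p t u \<partial>M)" for p t
    have ibp: "(\<integral>u. T u * X j u * ?s p t u \<partial>M) = t * w j * a p t / \<kappa> j" if "j \<in> J" for j p t
    proof -
      \<comment> \<open>Delaying the phase by \<open>pi / 2\<close> makes the test function the sine
        \<open>?s p t\<close> and its derivative a multiple of the cosine
        \<open>?c p t\<close>.\<close>
      have "(\<integral>u. T u * (- sin (u \<bullet> (t *\<^sub>R y) + (p - pi / 2)) * (d j \<bullet> (t *\<^sub>R y)) - \<kappa> j * X j u * cos (u \<bullet> (t *\<^sub>R y) + (p - pi / 2))) \<partial>M) = 0"
        (is "?I = 0")
        by (rule weak[OF C1b_cos])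
      also have "?I
        = (\<integral>u. t * w j * (T u * ?c p t u) - \<kappa> j * (T u * X j u * ?s p t u) \<partial>M)"
        using dy[OF that] by (intro Bochner_Integration.integral_cong) (auto simp: add_diff_eq cos_phase_sin algebra_simps)
      also have "\<dots> = t * w j * a p t - \<kappa> j * (\<integral>u. T u * X j u * ?s p t u \<partial>M)"
        using iT iX unfolding a_def by (subst Bochner_Integration.integral_diff) auto
      finally show ?thesis using \<kappa>_pos[of j] by (intro eq_divide_imp) (auto simp: mult.commute)
    qed
    have da: "(a p has_real_derivative - t * Q * a p t) (at t)" for p t
    proof -
      have "(a p has_real_derivative (\<integral>u. (T u * (u \<bullet> y)) * - ?s p t u \<partial>M)) (at t)"
        unfolding a_def by (intro DERIV_integral_cos iT L2_integrable_mult[OF L2T Ly]) measurable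
      also have "(\<integral>u. (T u * (u \<bullet> y)) * - ?s p t u \<partial>M) = (\<Sum>j\<in>J. - w j * (t * w j * a p t / \<kappa> j))"
        unfolding exp_Y using iX by (simp add: Bochner_Integration.integral_sum ibp)
      also have "\<dots> = - t * Q * a p t"
        by (simp add: Q_def sum_distrib_left sum_distrib_right sum_negf power2_eq_square mult_ac)
      finally show ?thesis .
    qed
    have "a p 1 = 0" by (rule gaussian_ode_zero[OF da]) (simp add: a_def T(3))
    then show ?thesis by (simp add: a_def)
  qed
  show ?thesis
    by (rule AE_zero_if_char_functional_zero[OF finite_measure_axioms sets_M L2_integrable[OF L2T] dense main])
qed

lemma AE_zero_if_weak_zero:
  assumes "integrable M T" and "\<And>G G'. C1b (d v) G G' \<Longrightarrow> (\<integral>u. T u * G u \<partial>M) = 0"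
  shows "AE u in M. T u = 0"
  by (rule AE_zero_if_char_functional_zero[OF finite_measure_axioms sets_M assms(1) dense assms(2)[OF C1b_cos]])

text \<open>The exponential and its derivative are unbounded, which puts them outside
  \<open>W12_chain\<close>. The difference of the arctangents of both sides of \<open>eq\<close> is
  admissible and vanishes almost everywhere, hence so does its weak derivative.\<close>

lemma gibbs_density_imp_gradient:
  assumes \<rho>: "W12 M (d v) \<rho> V" and h: "W12 M (d v) h W" and \<beta>: "\<beta> \<ge> 0"
    and eq: "AE u in M. \<rho> u = C * exp (- \<beta> * h u)"
  shows "AE u in M. V u + \<beta> * \<rho> u * W u = 0"
proof -
  have meas[measurable]: "\<rho> \<in> borel_measurable M" "h \<in> borel_measurable M" "V \<in> borel_measurable M" "W \<in> borel_measurable M"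
    and L: "L2 M V" "L2 M W"
    using \<rho> h by (auto simp: W12_def L2_def)
  let ?\<Psi> = "\<lambda>r x::real. arctan r - arctan (C * exp (- \<beta> * x))"
  let ?\<Psi>1 = "\<lambda>r::real. \<lambda>x::real. inverse (1 + r\<^sup>2)"
  let ?\<Psi>2 = "\<lambda>r::real. \<lambda>x. \<beta> * (C * exp (- \<beta> * x)) * inverse (1 + (C * exp (- \<beta> * x))\<^sup>2)"
  note nz = inverse_one_plus_square(5)
  have inv1: "\<bar>inverse (1 + r\<^sup>2)\<bar> \<le> 1" "\<bar>r * inverse (1 + r\<^sup>2)\<bar> \<le> 1" for r :: real
    using inverse_one_plus_square[of r] by (simp_all add: abs_mult)
  \<comment> \<open>Two arctangents differ by less than pi, hence by less than 4; the partial
    derivatives are bounded by 1 and \<open>\<beta>\<close>.\<close>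
  have bd: "\<bar>?\<Psi> r x\<bar> \<le> 4 + \<beta>" "\<bar>?\<Psi>1 r x\<bar> \<le> 4 + \<beta>" "\<bar>?\<Psi>2 r x\<bar> \<le> 4 + \<beta>" for r x
  proof -
    show "\<bar>?\<Psi> r x\<bar> \<le> 4 + \<beta>"
      using arctan_bounded[of r] arctan_bounded[of "C * exp (- \<beta> * x)"] pi_less_4 \<beta> by linarith
    show "\<bar>?\<Psi>1 r x\<bar> \<le> 4 + \<beta>" using inv1(1)[of r] \<beta> by linarith
    have "\<bar>?\<Psi>2 r x\<bar> = \<beta> * \<bar>(C * exp (- \<beta> * x)) * inverse (1 + (C * exp (- \<beta> * x))\<^sup>2)\<bar>"
      using \<beta> by (simp add: abs_mult)
    also have "\<dots> \<le> \<beta> * 1" by (intro mult_left_mono inv1 \<beta>)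
    finally show "\<bar>?\<Psi>2 r x\<bar> \<le> 4 + \<beta>" by linarith
  qed
  have cont: "continuous_on UNIV (\<lambda>p. ?\<Psi> (fst p) (snd p))" "continuous_on UNIV (\<lambda>p. ?\<Psi>1 (fst p) (snd p))"
    "continuous_on UNIV (\<lambda>p. ?\<Psi>2 (fst p) (snd p))"
    by (intro continuous_intros ballI nz)+
  have der: "((\<lambda>p. ?\<Psi> (fst p) (snd p)) has_derivative (\<lambda>q. ?\<Psi>1 r x * fst q + ?\<Psi>2 r x * snd q)) (at (r, x))" for r x
    by (rule has_derivative_eq_rhs, (rule derivative_intros)+) (auto simp: fun_eq_iff algebra_simps)
  let ?T = "\<lambda>u. ?\<Psi>1 (\<rho> u) (h u) * V u + ?\<Psi>2 (\<rho> u) (h u) * W u"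
  have "integrable M ?T"
    using bd by (intro Bochner_Integration.integrable_add integrable_mult_bounded[where C = "4 + \<beta>"] L2_integrable L) auto
  then have "AE u in M. ?T u = 0"
  proof (rule AE_zero_if_weak_zero)
    fix G G' assume G: "C1b (d v) G G'"
    have "(\<integral>u. ?\<Psi> (\<rho> u) (h u) * (G' u - \<kappa> v * X v u * G u) \<partial>M) = - (\<integral>u. ?T u * G u \<partial>M)"
      by (rule W12_chain[OF \<rho> h G cont bd der])
    moreover have "(\<integral>u. ?\<Psi> (\<rho> u) (h u) * (G' u - \<kappa> v * X v u * G u) \<partial>M) = (\<integral>u. 0 \<partial>M)"
      using eq C1b_measurable[OF G] by (intro integral_cong_AE) auto
    ultimately show "(\<integral>u. ?T u * G u \<partial>M) = 0" by simp
  qed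
  \<comment> \<open>Where \<open>\<rho> = C * exp (- \<beta> * h)\<close>, the factor
    \<open>?\<Psi>2\<close> equals \<open>\<beta> * \<rho> * ?\<Psi>1\<close>, so the positive
    factor \<open>?\<Psi>1\<close> cancels.\<close>
  with eq show ?thesis
  proof eventually_elim
    case (elim u)
    have "inverse (1 + (\<rho> u)\<^sup>2) * (V u + \<beta> * \<rho> u * W u) = 0"
      using elim(2) unfolding elim(1)[symmetric] by (simp add: algebra_simps)
    then show ?case using nz[of "\<rho> u"] by simp
  qed
qed

text \<open>In \<open>?A\<close> the partial derivatives with respect to \<open>\<rho>\<close> and
  \<open>h\<close> are in the ratio \<open>1 : \<beta> * \<rho>\<close>, so the gradient equation
  formally annihilates its derivative. Once \<open>?A\<close> is known to equal its mean
  \<open>m\<close>, applying \<open>tan\<close> returns the density with constant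
  \<open>tan m\<close>.\<close>

lemma gradient_imp_gibbs_density:
  assumes \<rho>h: "\<And>v. \<exists>V W. W12 M (d v) \<rho> V \<and> W12 M (d v) h W \<and> (AE u in M. V u + \<beta> * \<rho> u * W u = 0)"
    and [measurable]: "\<rho> \<in> borel_measurable M" "h \<in> borel_measurable M" and \<beta>: "\<beta> \<ge> 0"
  shows "\<exists>c. AE u in M. \<rho> u = c * exp (- \<beta> * h u)"
proof -
  let ?A = "\<lambda>u. arctan (\<rho> u * exp (\<beta> * h u))"
  have Ab: "\<bar>arctan x\<bar> \<le> 2" for x using arctan_bounded[of x] pi_less_4 by linarith
  define m where "m = (\<integral>u. ?A u \<partial>M)"
  have iA: "integrable M ?A" using Ab by (intro integrable_bounded[of _ 2]) auto
  have "AE u in M. ?A u - m = 0"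
  proof (rule AE_zero_if_weak_gradient_zero[where C = "2 + \<bar>m\<bar>"])
    show "\<bar>?A u - m\<bar> \<le> 2 + \<bar>m\<bar>" for u using Ab[of "\<rho> u * exp (\<beta> * h u)"] by linarith
    show "(\<integral>u. ?A u - m \<partial>M) = 0" using iA by (simp add: m_def prob_space)
    fix v G G' assume G: "C1b (d v) G G'"
    obtain V W where \<rho>: "W12 M (d v) \<rho> V" and h: "W12 M (d v) h W" and VW: "AE u in M. V u + \<beta> * \<rho> u * W u = 0"
      using \<rho>h by blast
    have [measurable]: "V \<in> borel_measurable M" "W \<in> borel_measurable M"
      and L: "L2 M V" "L2 M W" using \<rho> h by (auto simp: W12_def L2_def)
    note [measurable] = C1b_measurable[OF G]
    let ?Q = "\<lambda>u. G' u - \<kappa> v * X v u * G u"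
    have iQ: "integrable M ?Q" by (rule L2_integrable[OF L2_adjoint[OF G]])
    \<comment> \<open>Integration by parts against the constant 1 shows that \<open>?Q\<close> has
      integral 0, so subtracting the mean \<open>m\<close> does not change the weak
      derivative.\<close>
    have C1: "C1b (d v) (\<lambda>_. 1) (\<lambda>_. 0)" by (auto simp: C1b_def)
    have Q0: "(\<integral>u. ?Q u \<partial>M) = 0" using C1b_integration_by_parts[OF C1 G] by simp
    txt \<open>The factor \<open>?c\<close> makes \<open>arctan (r * exp (\<beta> x))\<close> a function with bounded derivatives; its own
      derivative contributes \<open>?r\<close>, which tends to 0 boundedly.\<close>
    let ?\<delta> = "\<lambda>n. inverse (real (Suc n))" and ?a = "\<lambda>x. exp (\<beta> * x)"
    let ?c = "\<lambda>n x. inverse (1 + (?\<delta> n * ?a x)\<^sup>2)"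
    let ?r = "\<lambda>n r x. arctan (r * ?a x) * (?c n x)\<^sup>2 * (2 * \<beta> * (?\<delta> n * ?a x)\<^sup>2)"
    note inv1 = inverse_one_plus_square
    \<comment> \<open>This bound and \<open>Acb\<close> do not depend on \<open>n\<close>, as the
      final limits require; the bound \<open>?B\<close> below does.\<close>
    have rb: "\<bar>?r n r x\<bar> \<le> 4 * \<beta>" for n r x
    proof -
      have "\<bar>?r n r x\<bar> = \<bar>arctan (r * ?a x)\<bar> * (2 * \<beta> * (?c n x * ((?\<delta> n * ?a x)\<^sup>2 * ?c n x)))"
        using \<beta> inv1(1)[of "?\<delta> n * ?a x"] by (simp add: abs_mult power2_eq_square)
      also have "\<dots> \<le> 2 * (2 * \<beta> * (1 * 1))"
        using inv1[of "?\<delta> n * ?a x"] Ab \<beta> by (intro mult_mono mult_left_mono mult_nonneg_nonneg) auto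
      finally show ?thesis by simp
    qed
    have Acb: "\<bar>arctan (r * ?a x) * ?c n x\<bar> \<le> 2 * 1" for n r x
      unfolding abs_mult using inv1[of "?\<delta> n * ?a x"] Ab by (intro mult_mono) auto
    have step: "(\<integral>u. ?A u * ?c n (h u) * ?Q u \<partial>M) = (\<integral>u. ?r n (\<rho> u) (h u) * (W u * G u) \<partial>M)" for n
    proof -
      let ?d = "?\<delta> n"
      have d0: "?d > 0" by simp
      let ?\<Psi> = "\<lambda>r x. arctan (r * ?a x) * ?c n x"
      let ?\<Psi>1 = "\<lambda>r x. ?a x * inverse (1 + (r * ?a x)\<^sup>2) * ?c n x"
      let ?\<Psi>2 = "\<lambda>r x. \<beta> * (r * ?a x * inverse (1 + (r * ?a x)\<^sup>2)) * ?c n x - ?r n r x"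
      let ?B = "2 + real (Suc n) + 5 * \<beta>"
      have bd: "\<bar>?\<Psi> r x\<bar> \<le> ?B" "\<bar>?\<Psi>1 r x\<bar> \<le> ?B" "\<bar>?\<Psi>2 r x\<bar> \<le> ?B" for r x
      proof -
        note i = inv1[of "?d * ?a x"] inv1[of "r * ?a x"]
        show "\<bar>?\<Psi> r x\<bar> \<le> ?B" by (rule order_trans[OF Acb]) (use \<beta> in simp)
        \<comment> \<open>At \<open>r = 0\<close> only the cutoff controls the exponential:
          \<open>?a x\<close> is \<open>Suc n\<close> times \<open>?d * ?a x\<close>, and
          \<open>\<bar>y\<bar> / (1 + y\<^sup>2) \<le> 1\<close> absorbs the latter. The growth in
          \<open>n\<close> is harmless, as the chain rule is applied for each fixed
          \<open>n\<close>.\<close>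
        have "\<bar>?\<Psi>1 r x\<bar> = inverse (1 + (r * ?a x)\<^sup>2) * (real (Suc n) * (\<bar>?d * ?a x\<bar> * ?c n x))"
          using i d0 by (simp add: abs_mult)
        also have "\<dots> \<le> 1 * (real (Suc n) * 1)"
          using i by (intro mult_mono mult_left_mono mult_nonneg_nonneg) auto
        finally show "\<bar>?\<Psi>1 r x\<bar> \<le> ?B" using \<beta> by simp
        have "\<bar>\<beta> * (r * ?a x * inverse (1 + (r * ?a x)\<^sup>2)) * ?c n x\<bar> = \<beta> * (\<bar>r * ?a x\<bar> * inverse (1 + (r * ?a x)\<^sup>2)) * ?c n x"
          using i \<beta> by (simp add: abs_mult)
        also have "\<dots> \<le> \<beta> * 1 * 1"
          using i \<beta> by (intro mult_mono mult_left_mono mult_nonneg_nonneg) auto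
        finally have "\<bar>?\<Psi>2 r x\<bar> \<le> \<beta> * 1 * 1 + 4 * \<beta>"
          by (intro order_trans[OF abs_triangle_ineq4] add_mono rb)
        then show "\<bar>?\<Psi>2 r x\<bar> \<le> ?B" by (rule order_trans) simp
      qed
      have cont: "continuous_on UNIV (\<lambda>p. ?\<Psi> (fst p) (snd p))" "continuous_on UNIV (\<lambda>p. ?\<Psi>1 (fst p) (snd p))"
        "continuous_on UNIV (\<lambda>p. ?\<Psi>2 (fst p) (snd p))"
        by (intro continuous_intros ballI inv1(5))+
      have der: "((\<lambda>p. ?\<Psi> (fst p) (snd p)) has_derivative (\<lambda>q. ?\<Psi>1 r x * fst q + ?\<Psi>2 r x * snd q)) (at (r, x))" for r x
      proof -
        have "((\<lambda>x. ?c n x) has_real_derivative - ((?c n x)\<^sup>2 * (2 * \<beta> * (?d * ?a x)\<^sup>2))) (at x)"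
          using inv1(5)[of "?d * ?a x"]
          by (auto intro!: derivative_eq_intros simp: power2_eq_square divide_inverse simp del: of_nat_Suc)
        then have 1: "((\<lambda>p. ?c n (snd p)) has_derivative (\<lambda>q. snd q * - ((?c n x)\<^sup>2 * (2 * \<beta> * (?d * ?a x)\<^sup>2)))) (at (r, x))"
          by (intro DERIV_compose_FDERIV[where g = snd and g' = snd] has_derivative_snd has_derivative_ident) (simp only: snd_conv)
        have 2: "((\<lambda>p. arctan (fst p * ?a (snd p))) has_derivative
            (\<lambda>q. inverse (1 + (r * ?a x)\<^sup>2) * (?a x * fst q + r * ?a x * \<beta> * snd q))) (at (r, x))"
          by (rule has_derivative_eq_rhs, (rule derivative_intros)+) (auto simp: fun_eq_iff algebra_simps)
        show ?thesis
          by (rule has_derivative_eq_rhs[OF has_derivative_mult[OF 2 1]])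
             (simp add: fun_eq_iff algebra_simps del: of_nat_Suc)
      qed
      have "(\<integral>u. ?\<Psi> (\<rho> u) (h u) * ?Q u \<partial>M) = - (\<integral>u. (?\<Psi>1 (\<rho> u) (h u) * V u + ?\<Psi>2 (\<rho> u) (h u) * W u) * G u \<partial>M)"
        by (rule W12_chain[OF \<rho> h G cont bd der])
      also have "\<dots> = (\<integral>u. - ((?\<Psi>1 (\<rho> u) (h u) * V u + ?\<Psi>2 (\<rho> u) (h u) * W u) * G u) \<partial>M)" by simp
      \<comment> \<open>Substituting \<open>V = - \<beta> * \<rho> * W\<close> cancels the
        derivatives of the arctangent, leaving only that of the cutoff.\<close>
      also have "\<dots> = (\<integral>u. ?r n (\<rho> u) (h u) * (W u * G u) \<partial>M)"
      proof (rule integral_cong_AE)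
        show "AE u in M. - ((?\<Psi>1 (\<rho> u) (h u) * V u + ?\<Psi>2 (\<rho> u) (h u) * W u) * G u) = ?r n (\<rho> u) (h u) * (W u * G u)"
          using VW
        proof eventually_elim
          case (elim u)
          then have "V u = - \<beta> * \<rho> u * W u" by linarith
          then show ?case by (simp add: algebra_simps)
        qed
      qed measurable
      finally show ?thesis .
    qed
    have \<delta>lim: "(\<lambda>n. (?\<delta> n * y)\<^sup>2) \<longlonglongrightarrow> 0" for y
      using tendsto_power[OF tendsto_mult_left_zero[OF LIMSEQ_inverse_real_of_nat, of y], of 2] by simp
    have clim: "(\<lambda>n. ?c n x) \<longlonglongrightarrow> 1" for x
      using tendsto_inverse[OF tendsto_add[OF tendsto_const[of 1] \<delta>lim[of "?a x"]]] by simp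
    have l1: "(\<lambda>n. \<integral>u. ?A u * ?c n (h u) * ?Q u \<partial>M) \<longlonglongrightarrow> (\<integral>u. ?A u * ?Q u \<partial>M)"
    proof (rule integral_bounded_mult_L2_tendsto[OF _ _ _ _ _ Acb])
      show "AE u in M. (\<lambda>n. ?A u * ?c n (h u)) \<longlonglongrightarrow> ?A u"
        using tendsto_mult_left[OF clim] by simp
    qed (use L2_adjoint[OF G] in auto)
    obtain C where "\<And>u. \<bar>G u\<bar> \<le> C" using G by (rule C1b_bound) blast
    then have WG: "L2 M (\<lambda>u. W u * G u)" by (intro L2_mult_bounded[OF L(2)]) measurable
    have l2: "(\<lambda>n. \<integral>u. ?r n (\<rho> u) (h u) * (W u * G u) \<partial>M) \<longlonglongrightarrow> (\<integral>u. 0 * (W u * G u) \<partial>M)"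
    proof (rule integral_bounded_mult_L2_tendsto[OF _ _ _ _ _ rb])
      show "AE u in M. (\<lambda>n. ?r n (\<rho> u) (h u)) \<longlonglongrightarrow> 0"
      proof (rule AE_I2)
        fix u
        have "(\<lambda>n. ?r n (\<rho> u) (h u)) \<longlonglongrightarrow> ?A u * 1\<^sup>2 * (2 * \<beta> * 0)"
          by (intro tendsto_mult tendsto_power tendsto_const clim \<delta>lim)
        then show "(\<lambda>n. ?r n (\<rho> u) (h u)) \<longlonglongrightarrow> 0" by simp
      qed
    qed (use WG in auto)
    have AQ0: "(\<integral>u. ?A u * ?Q u \<partial>M) = 0"
      using LIMSEQ_unique[OF l1[unfolded step] l2] by simp
    have "integrable M (\<lambda>u. ?A u * ?Q u)"
      using Ab by (intro integrable_mult_bounded[where C = 2] iQ) auto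
    then have "(\<integral>u. ?A u * ?Q u - m * ?Q u \<partial>M) = (\<integral>u. ?A u * ?Q u \<partial>M) - m * (\<integral>u. ?Q u \<partial>M)"
      using iQ by (subst Bochner_Integration.integral_diff) (auto simp del: right_diff_distrib)
    then show "(\<integral>u. (?A u - m) * ?Q u \<partial>M) = 0"
      using AQ0 Q0 by (simp add: left_diff_distrib)
  qed auto
  then have "AE u in M. \<rho> u = tan m * exp (- \<beta> * h u)"
  proof eventually_elim
    case (elim u)
    then have "\<rho> u * exp (\<beta> * h u) = tan m" by (metis eq_iff_diff_eq_0 tan_arctan)
    then show ?case by (simp add: exp_minus field_simps)
  qed
  then show ?thesis by blast
qed

end

section \<open>Smooth functions of finitely many variables\<close>

text \<open>The derivative is quantified existentially, so the closure properties need no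
  computation with \<open>deriv\<close>.\<close>

primrec kdiff :: "nat \<Rightarrow> (real \<Rightarrow> real) \<Rightarrow> bool" where
  "kdiff 0 f \<longleftrightarrow> continuous_on UNIV f"
| "kdiff (Suc k) f \<longleftrightarrow> (\<exists>f'. (\<forall>x. (f has_real_derivative f' x) (at x)) \<and> kdiff k f')"

lemma kdiff_continuous: "kdiff k f \<Longrightarrow> continuous_on UNIV f"
  by (cases k) (auto intro: DERIV_continuous_on)

lemma kdiff_SucD: "kdiff (Suc k) f \<Longrightarrow> kdiff k f"
proof (induction k arbitrary: f)
  case 0
  then show ?case using kdiff_continuous[OF 0] by simp
next
  case (Suc k)
  then obtain f' where "\<forall>x. (f has_real_derivative f' x) (at x)" "kdiff (Suc k) f'" by auto
  with Suc.IH[of f'] show ?case by auto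
qed

lemma kdiff_const: "kdiff k (\<lambda>_. c)"
proof (induction k arbitrary: c)
  case (Suc k)
  show ?case using Suc[of 0] by (auto intro!: exI[of _ "\<lambda>_. 0"])
qed simp

lemma kdiff_add: "kdiff k f \<Longrightarrow> kdiff k g \<Longrightarrow> kdiff k (\<lambda>x. f x + g x)"
proof (induction k arbitrary: f g)
  case (Suc k)
  from Suc.prems obtain f' g' where
    "\<forall>x. (f has_real_derivative f' x) (at x)" "kdiff k f'" "\<forall>x. (g has_real_derivative g' x) (at x)" "kdiff k g'"
    by auto
  then show ?case using Suc.IH[of f' g'] by (auto intro!: exI[of _ "\<lambda>x. f' x + g' x"] derivative_intros)
qed (auto intro!: continuous_intros)

lemma kdiff_mult: "kdiff k f \<Longrightarrow> kdiff k g \<Longrightarrow> kdiff k (\<lambda>x. f x * g x)"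
proof (induction k arbitrary: f g)
  case (Suc k)
  from Suc.prems obtain f' g' where d:
    "\<forall>x. (f has_real_derivative f' x) (at x)" "kdiff k f'" "\<forall>x. (g has_real_derivative g' x) (at x)" "kdiff k g'"
    by auto
  have "kdiff k (\<lambda>x. f' x * g x + g' x * f x)"
    by (intro kdiff_add Suc.IH d kdiff_SucD[OF Suc.prems(1)] kdiff_SucD[OF Suc.prems(2)])
  then show ?case using d by (auto intro!: exI[of _ "\<lambda>x. f' x * g x + g' x * f x"] DERIV_mult)
qed (auto intro!: continuous_intros)

lemma kdiff_inverse: "kdiff k f \<Longrightarrow> (\<And>x. f x \<noteq> 0) \<Longrightarrow> kdiff k (\<lambda>x. inverse (f x))"
proof (induction k arbitrary: f)
  case (Suc k)
  from Suc.prems obtain f' where d: "\<forall>x. (f has_real_derivative f' x) (at x)" "kdiff k f'"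
    by auto
  have "kdiff k (\<lambda>x. inverse (f x))"
    using kdiff_SucD[OF Suc.prems(1)] Suc.prems(2) by (rule Suc.IH)
  then have "kdiff k (\<lambda>x. (- 1) * (inverse (f x) * f' x * inverse (f x)))"
    by (intro kdiff_mult kdiff_const d)
  moreover have "((\<lambda>x. inverse (f x)) has_real_derivative (- 1) * (inverse (f x) * f' x * inverse (f x))) (at x)" for x
    using DERIV_inverse'[OF d(1)[rule_format, of x] Suc.prems(2)] by simp
  ultimately show ?case unfolding kdiff.simps
    by (intro exI[of _ "\<lambda>x. (- 1) * (inverse (f x) * f' x * inverse (f x))"] conjI allI)
qed (auto intro!: continuous_intros)

lemma kdiff_affine: "kdiff k f \<Longrightarrow> kdiff k (\<lambda>x. f (a * x + b))"
proof (induction k arbitrary: f)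
  case 0
  then have "continuous_on UNIV f" by simp
  then have "continuous_on UNIV (\<lambda>x. f (a * x + b))"
    by (rule continuous_on_compose2) (auto intro!: continuous_intros)
  then show ?case by simp
next
  case (Suc k)
  from Suc.prems obtain f' where d: "\<forall>x. (f has_real_derivative f' x) (at x)" "kdiff k f'"
    by auto
  have "((\<lambda>x. f (a * x + b)) has_real_derivative f' (a * x + b) * a) (at x)" for x
    by (rule DERIV_chain2[OF d(1)[rule_format]]) (auto intro!: derivative_eq_intros)
  moreover have "kdiff k (\<lambda>x. f' (a * x + b) * a)"
    by (rule kdiff_mult[OF Suc.IH[OF d(2)] kdiff_const])
  ultimately show ?case unfolding kdiff.simps
    by (intro exI[of _ "\<lambda>x. f' (a * x + b) * a"] conjI allI)
qed

text \<open>Differentiation only shifts the phase, so the induction stays within one family.\<close>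

lemma kdiff_cos: "kdiff k (\<lambda>x. cos (x + p))"
proof (induction k arbitrary: p)
  case (Suc k)
  have "((\<lambda>x. cos (x + p)) has_real_derivative cos (x + (p + pi / 2))) (at x)" for x
    by (auto intro!: derivative_eq_intros simp: cos_add sin_add)
  then show ?case unfolding kdiff.simps using Suc[of "p + pi / 2"]
    by (intro exI[of _ "\<lambda>x. cos (x + (p + pi / 2))"] conjI allI)
qed (auto intro!: continuous_intros)

lemma kdiff_id: "kdiff k (\<lambda>x. x)"
proof (cases k)
  case (Suc l)
  then show ?thesis using kdiff_const[of l 1] by (auto intro!: exI[of _ "\<lambda>_. 1"])
qed (auto intro!: continuous_intros)

section \<open>A smooth cutoff function on the line\<close>

lemma poly_times_exp_tendsto_0: "((\<lambda>s. poly p s * exp (- s)) \<longlongrightarrow> 0) (at_top :: real filter)"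
proof -
  have "((\<lambda>s. \<Sum>i\<le>degree p. coeff p i * (s ^ i / exp s)) \<longlongrightarrow> (\<Sum>i\<le>degree p. coeff p i * 0)) (at_top :: real filter)"
    by (intro tendsto_intros tendsto_power_div_exp_0)
  then show ?thesis
    by (simp add: poly_altdef sum_distrib_right exp_minus divide_inverse mult.assoc)
qed

definition flat :: "real poly \<Rightarrow> real \<Rightarrow> real" where
  "flat p t = (if t > 0 then poly p (1 / t) * exp (- (1 / t)) else 0)"

lemma flat_tendsto_0: "(flat p \<longlongrightarrow> 0) (at 0)"
proof -
  have "((\<lambda>t. poly p (1 / t) * exp (- (1 / t))) \<longlongrightarrow> 0) (at_right 0)"
    using filterlim_compose[OF poly_times_exp_tendsto_0 filterlim_inverse_at_top_right, of p]
    by (simp add: divide_inverse)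
  then have "(flat p \<longlongrightarrow> 0) (at_right 0)"
    by (rule Lim_transform_eventually) (auto simp: flat_def eventually_at_filter)
  moreover have "(flat p \<longlongrightarrow> 0) (at_left 0)"
    by (rule tendsto_eventually) (auto simp: flat_def eventually_at_filter)
  ultimately show ?thesis by (simp add: filterlim_at_split)
qed

text \<open>Both the polynomial and the exponential contribute an inner derivative with factor
  \<open>1 / t\<^sup>2\<close>, which is the polynomial \<open>[:0, 0, 1:]\<close> at
  \<open>1 / t\<close>. At 0 the difference quotient of \<open>flat p\<close> is
  \<open>flat (pCons 0 p)\<close>, again in the family, so it tends to 0.\<close>

lemma flat_DERIV: "(flat p has_real_derivative flat ([:0, 0, 1:] * (p - pderiv p)) t) (at t)"
proof -
  consider "t > 0" | "t < 0" | "t = 0" by linarith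
  then show ?thesis
  proof cases
    case 1
    have "((\<lambda>t. poly p (1 / t) * exp (- (1 / t))) has_real_derivative
        poly ([:0, 0, 1:] * (p - pderiv p)) (1 / t) * exp (- (1 / t))) (at t)"
      using 1 by (auto intro!: derivative_eq_intros DERIV_chain2[OF poly_DERIV] simp: field_simps power2_eq_square)
    then have "((\<lambda>t. poly p (1 / t) * exp (- (1 / t))) has_real_derivative flat ([:0, 0, 1:] * (p - pderiv p)) t) (at t)"
      using 1 by (simp add: flat_def)
    then show ?thesis
      by (rule has_field_derivative_transform_within_open[of _ _ _ "{0<..}"]) (use 1 in \<open>auto simp: flat_def\<close>)
  next
    case 2
    have "((\<lambda>_. 0) has_real_derivative flat ([:0, 0, 1:] * (p - pderiv p)) t) (at t)"
      using 2 by (simp add: flat_def)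
    then show ?thesis
      by (rule has_field_derivative_transform_within_open[of _ _ _ "{..<0}"]) (use 2 in \<open>auto simp: flat_def\<close>)
  next
    case 3
    have "(\<lambda>h. flat (pCons 0 p) h) \<midarrow>0\<rightarrow> 0" by (rule flat_tendsto_0)
    then have "(\<lambda>h. (flat p (0 + h) - flat p 0) / h) \<midarrow>0\<rightarrow> 0"
      by (rule Lim_transform_eventually) (auto simp: flat_def eventually_at_filter intro!: always_eventually)
    then show ?thesis using 3 by (simp add: DERIV_def flat_def)
  qed
qed

lemma kdiff_flat: "kdiff k (flat p)"
proof (induction k arbitrary: p)
  case 0
  show ?case using flat_DERIV by (auto intro: DERIV_continuous_on)
next
  case (Suc k)
  then show ?case using flat_DERIV by auto
qed

definition smooth_step :: "real \<Rightarrow> real" where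
  "smooth_step t = flat 1 t * inverse (flat 1 t + flat 1 (1 - t))"

lemma flat_1: "flat 1 t \<ge> 0" "t \<le> 0 \<Longrightarrow> flat 1 t = 0" "t > 0 \<Longrightarrow> flat 1 t > 0"
  by (auto simp: flat_def)

lemma smooth_step_denominator: "flat 1 t + flat 1 (1 - t) > 0"
proof (cases "t > 0")
  case True
  then show ?thesis using flat_1(1)[of "1 - t"] flat_1(3)[of t] by linarith
next
  case False
  then show ?thesis using flat_1(1)[of t] flat_1(3)[of "1 - t"] by linarith
qed

lemma smooth_step_range: "0 \<le> smooth_step t" "smooth_step t \<le> 1"
  using flat_1(1)[of t] flat_1(1)[of "1 - t"] smooth_step_denominator[of t]
  by (auto simp: smooth_step_def field_simps)

lemma smooth_step_eq: "t \<le> 0 \<Longrightarrow> smooth_step t = 0" "t \<ge> 1 \<Longrightarrow> smooth_step t = 1"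
  using flat_1(2)[of t] flat_1(2)[of "1 - t"] smooth_step_denominator[of t]
  by (auto simp: smooth_step_def)

lemma kdiff_smooth_step: "kdiff k smooth_step"
proof -
  have "kdiff k (\<lambda>t. flat 1 t * inverse (flat 1 t + flat 1 ((- 1) * t + 1)))"
  proof (rule kdiff_mult[OF kdiff_flat kdiff_inverse[OF kdiff_add[OF kdiff_flat kdiff_affine[OF kdiff_flat]]]])
    show "flat 1 t + flat 1 ((- 1) * t + 1) \<noteq> 0" for t
      using smooth_step_denominator[of t] by simp
  qed
  moreover have "(\<lambda>t. flat 1 t * inverse (flat 1 t + flat 1 ((- 1) * t + 1))) = smooth_step"
    by (auto simp: smooth_step_def fun_eq_iff)
  ultimately show ?thesis by simp
qed

definition plateau :: "real \<Rightarrow> real" where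
  "plateau t = smooth_step (2 - t) * smooth_step (2 + t)"

lemma kdiff_plateau: "kdiff k plateau"
proof -
  have "kdiff k (\<lambda>t. smooth_step ((- 1) * t + 2) * smooth_step (1 * t + 2))"
    by (rule kdiff_mult[OF kdiff_affine[OF kdiff_smooth_step] kdiff_affine[OF kdiff_smooth_step]])
  then show ?thesis by (simp add: plateau_def[abs_def] add.commute)
qed

lemma plateau_range: "0 \<le> plateau t" "plateau t \<le> 1"
  using smooth_step_range by (auto simp: plateau_def intro: mult_le_one)

lemma plateau_eq: "\<bar>t\<bar> \<le> 1 \<Longrightarrow> plateau t = 1" "\<bar>t\<bar> \<ge> 2 \<Longrightarrow> plateau t = 0"
  using smooth_step_eq by (auto simp: plateau_def abs_if split: if_splits)

section \<open>Calculus of \<open>Ck\<close> functions and compact support\<close>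

lemma Ck_continuous: "Ck m k \<phi> \<Longrightarrow> continuous_on UNIV \<phi>"
  by (cases k) auto

lemma Ck_SucD: "Ck m (Suc k) \<phi> \<Longrightarrow> Ck m k \<phi>"
proof (induction k arbitrary: \<phi>)
  case (Suc k)
  then show ?case by (metis Ck.simps(2))
qed simp

lemma partial_deriv_eqI:
  "((\<lambda>t. \<phi> (x(i := t))) has_real_derivative D) (at (x i)) \<Longrightarrow> partial_deriv i \<phi> x = D"
  unfolding partial_deriv_def by (rule DERIV_imp_deriv)

lemma Ck_partial_DERIV:
  assumes "Ck m (Suc k) \<phi>" "i < m"
  shows "((\<lambda>t. \<phi> (x(i := t))) has_real_derivative partial_deriv i \<phi> (x(i := s))) (at s)"
proof -
  have "(\<lambda>t. \<phi> ((x(i := s))(i := t))) differentiable (at ((x(i := s)) i))"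
    using assms by (metis Ck.simps(2))
  then show ?thesis
    by (simp add: partial_deriv_def real_differentiable_def DERIV_deriv_iff_real_differentiable)
qed

lemma Ck_partial_DERIV_self:
  assumes "Ck m (Suc k) \<phi>" "i < m"
  shows "((\<lambda>t. \<phi> (x(i := t))) has_real_derivative partial_deriv i \<phi> x) (at (x i))"
  using Ck_partial_DERIV[OF assms, of x "x i"] by (simp only: fun_upd_triv)

lemma Ck_SucI:
  assumes "continuous_on UNIV \<phi>"
    and "\<And>i x. i < m \<Longrightarrow> ((\<lambda>t. \<phi> (x(i := t))) has_real_derivative \<phi>' i x) (at (x i))"
    and "\<And>i. i < m \<Longrightarrow> Ck m k (\<phi>' i)"
  shows "Ck m (Suc k) \<phi>"
proof -
  have "partial_deriv i \<phi> = \<phi>' i" if "i < m" for i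
    using partial_deriv_eqI[OF assms(2)[OF that]] by (rule ext)
  then show ?thesis using assms
    by (auto simp: real_differentiable_def)
qed

lemma Ck_add: "Ck m k \<phi> \<Longrightarrow> Ck m k \<psi> \<Longrightarrow> Ck m k (\<lambda>x. \<phi> x + \<psi> x)"
proof (induction k arbitrary: \<phi> \<psi>)
  case (Suc k)
  show ?case
  proof (rule Ck_SucI)
    show "continuous_on UNIV (\<lambda>x. \<phi> x + \<psi> x)"
      using Suc.prems[THEN Ck_continuous] by (intro continuous_intros)
    fix i assume i: "i < m"
    show "((\<lambda>t. \<phi> (x(i := t)) + \<psi> (x(i := t))) has_real_derivative partial_deriv i \<phi> x + partial_deriv i \<psi> x) (at (x i))" for x
      by (rule DERIV_add[OF Ck_partial_DERIV_self[OF Suc.prems(1) i] Ck_partial_DERIV_self[OF Suc.prems(2) i]])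
    show "Ck m k (\<lambda>x. partial_deriv i \<phi> x + partial_deriv i \<psi> x)"
      using Suc i by simp
  qed
qed (auto intro!: continuous_intros)

lemma Ck_mult: "Ck m k \<phi> \<Longrightarrow> Ck m k \<psi> \<Longrightarrow> Ck m k (\<lambda>x. \<phi> x * \<psi> x)"
proof (induction k arbitrary: \<phi> \<psi>)
  case (Suc k)
  show ?case
  proof (rule Ck_SucI)
    show "continuous_on UNIV (\<lambda>x. \<phi> x * \<psi> x)"
      using Suc.prems[THEN Ck_continuous] by (intro continuous_intros)
    fix i assume i: "i < m"
    show "((\<lambda>t. \<phi> (x(i := t)) * \<psi> (x(i := t))) has_real_derivative partial_deriv i \<phi> x * \<psi> x + partial_deriv i \<psi> x * \<phi> x) (at (x i))" for x
      using DERIV_mult[OF Ck_partial_DERIV_self[OF Suc.prems(1) i, of x] Ck_partial_DERIV_self[OF Suc.prems(2) i, of x]]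
      by (simp only: fun_upd_triv)
    show "Ck m k (\<lambda>x. partial_deriv i \<phi> x * \<psi> x + partial_deriv i \<psi> x * \<phi> x)"
      using Suc.prems i by (intro Ck_add Suc.IH Ck_SucD[OF Suc.prems(1)] Ck_SucD[OF Suc.prems(2)]) auto
  qed
qed (auto intro!: continuous_intros)

lemma Ck_const: "Ck m k (\<lambda>_. c)"
proof (induction k arbitrary: c)
  case (Suc k)
  show ?case by (rule Ck_SucI[where \<phi>' = "\<lambda>_ _. 0"]) (auto intro: Suc)
qed simp

lemma Ck_prod: "finite I \<Longrightarrow> (\<And>i. i \<in> I \<Longrightarrow> Ck m k (\<phi> i)) \<Longrightarrow> Ck m k (\<lambda>x. \<Prod>i\<in>I. \<phi> i x)"
  by (induction I rule: finite_induct) (auto intro: Ck_const Ck_mult)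

text \<open>Linearity of \<open>L\<close> is expressed by constant slopes under coordinate updates;
  this fits both single coordinates and finite linear combinations of them.\<close>

lemma Ck_compose_linear:
  assumes "kdiff k \<theta>" and L: "continuous_on UNIV L" "\<And>i. i < m \<Longrightarrow> \<exists>c. \<forall>x t. L (x(i := t)) = L x + c * (t - x i)"
  shows "Ck m k (\<lambda>x. \<theta> (L x))"
  using assms(1)
proof (induction k arbitrary: \<theta>)
  case 0
  then have "continuous_on UNIV \<theta>" by simp
  then have "continuous_on UNIV (\<lambda>x. \<theta> (L x))"
    by (rule continuous_on_compose2[OF _ L(1)]) auto
  then show ?case by simp
next
  case (Suc k)
  then obtain \<theta>' where d: "\<forall>x. (\<theta> has_real_derivative \<theta>' x) (at x)" "kdiff k \<theta>'" by auto
  obtain c where c: "\<And>i x t. i < m \<Longrightarrow> L (x(i := t)) = L x + c i * (t - x i)" using L(2) by metis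
  show ?case
  proof (rule Ck_SucI)
    show "continuous_on UNIV (\<lambda>x. \<theta> (L x))"
      by (rule continuous_on_compose2[OF kdiff_continuous[OF Suc.prems] L(1)]) auto
    fix i assume i: "i < m"
    have "((\<lambda>t. \<theta> (L x + c i * (t - x i))) has_real_derivative \<theta>' (L x + c i * (x i - x i)) * c i) (at (x i))" for x
      by (rule DERIV_chain2[OF d(1)[rule_format]]) (auto intro!: derivative_eq_intros)
    then show "((\<lambda>t. \<theta> (L (x(i := t)))) has_real_derivative \<theta>' (L x) * c i) (at (x i))" for x
      by (simp add: c[OF i])
    show "Ck m k (\<lambda>x. \<theta>' (L x) * c i)"
      by (intro Ck_mult Ck_const Suc.IH d)
  qed
qed

lemma continuous_on_coordinate: "continuous_on UNIV (\<lambda>x::nat \<Rightarrow> real. x i)"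
  by (rule continuous_on_product_coordinates)

lemma Ck_coordinate: "kdiff k \<theta> \<Longrightarrow> Ck m k (\<lambda>x. \<theta> (x i))"
proof (erule Ck_compose_linear[OF _ continuous_on_coordinate])
  fix i' :: nat show "\<exists>c. \<forall>(x::nat \<Rightarrow> real) t. (x(i' := t)) i = x i + c * (t - x i')"
    by (rule exI[of _ "if i = i' then 1 else 0"]) auto
qed

lemma Cc_infinity_CkD: "\<phi> \<in> Cc_infinity m \<Longrightarrow> Ck m k \<phi>"
  by (simp add: Cc_infinity_def)

lemma Cc_infinity_partial_deriv:
  assumes "\<phi> \<in> Cc_infinity m" "i < m"
  shows "partial_deriv i \<phi> \<in> Cc_infinity m"
proof -
  obtain R where R: "\<And>x. \<phi> x \<noteq> 0 \<Longrightarrow> \<forall>i<m. \<bar>x i\<bar> \<le> R" and dep: "\<And>x y. \<forall>i<m. x i = y i \<Longrightarrow> \<phi> x = \<phi> y"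
    using assms by (auto simp: Cc_infinity_def)
  show ?thesis unfolding Cc_infinity_def
  proof (intro CollectI conjI allI impI)
    fix x y :: "nat \<Rightarrow> real" assume "\<forall>i<m. x i = y i"
    then have "(\<lambda>t. \<phi> (x(i := t))) = (\<lambda>t. \<phi> (y(i := t)))" "x i = y i"
      using assms(2) by (auto intro!: dep)
    then show "partial_deriv i \<phi> x = partial_deriv i \<phi> y"
      by (simp add: partial_deriv_def)
  next
    show "Ck m k (partial_deriv i \<phi>)" for k
      using Cc_infinity_CkD[OF assms(1), of "Suc k"] assms(2) by simp
  next
    show "\<exists>R. \<forall>x. partial_deriv i \<phi> x \<noteq> 0 \<longrightarrow> (\<forall>i<m. \<bar>x i\<bar> \<le> R)"
    proof (intro exI[of _ R] allI impI, rule ccontr)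
      fix x l assume nz: "partial_deriv i \<phi> x \<noteq> 0" and l: "l < m" "\<not> \<bar>x l\<bar> \<le> R"
      \<comment> \<open>A coordinate outside \<open>{- R..R}\<close> stays outside under small
        changes, so \<open>\<phi>\<close> vanishes near \<open>x i\<close> along coordinate
        \<open>i\<close> and the derivative is 0: the same \<open>R\<close> serves.\<close>
      have "\<forall>\<^sub>F t in nhds (x i). \<bar>(x(i := t)) l\<bar> > R"
      proof (cases "l = i")
        case True
        have "open {t. \<bar>t\<bar> > R}" by (intro open_Collect_less continuous_intros)
        then show ?thesis using True l by (simp add: eventually_nhds) (metis mem_Collect_eq not_le)
      qed (use l in auto)
      then have "\<forall>\<^sub>F t in nhds (x i). \<phi> (x(i := t)) = 0"
        by eventually_elim (use R l in force)
      then have "((\<lambda>t. \<phi> (x(i := t))) has_real_derivative 0) (at (x i))"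
        by (subst DERIV_cong_ev[OF refl _ refl, where g = "\<lambda>_. 0"]) auto
      then show False using nz partial_deriv_eqI by blast
    qed
  qed
qed

lemma Cc_infinity_bounded:
  assumes "\<phi> \<in> Cc_infinity m"
  shows "\<exists>C. \<forall>x. \<bar>\<phi> x\<bar> \<le> C"
proof -
  obtain R where R: "\<And>x. \<phi> x \<noteq> 0 \<Longrightarrow> \<forall>i<m. \<bar>x i\<bar> \<le> R" and dep: "\<And>x y. \<forall>i<m. x i = y i \<Longrightarrow> \<phi> x = \<phi> y"
    using assms by (auto simp: Cc_infinity_def)
  \<comment> \<open>Since \<open>\<phi>\<close> ignores the coordinates from \<open>m\<close> on,
    they may be set to 0; the resulting box of sequences is compact by Tychonoff's theorem.\<close>
  define S where "S = PiE UNIV (\<lambda>i. if i < m then {- R..R} else {0::real})"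
  have "compactin (product_topology (\<lambda>i. euclidean) UNIV) S"
    unfolding S_def by (subst compactin_PiE) (auto simp: compactin_euclidean_iff)
  then have "compact S" by (simp add: euclidean_product_topology flip: compactin_euclidean_iff)
  then have "compact (\<phi> ` S)"
    using Ck_continuous[OF Cc_infinity_CkD[OF assms, of 0]]
    by (intro compact_continuous_image) (auto intro: continuous_on_subset)
  then obtain C where C: "\<And>y. y \<in> \<phi> ` S \<Longrightarrow> norm y \<le> C"
    using compact_imp_bounded bounded_iff by metis
  have "\<bar>\<phi> x\<bar> \<le> max C 0" for x
  proof (cases "\<phi> x = 0")
    case False
    then have "(\<lambda>i. if i < m then x i else 0) \<in> S"
      using R by (fastforce simp: S_def abs_le_iff)
    moreover have "\<phi> x = \<phi> (\<lambda>i. if i < m then x i else 0)" by (rule dep) simp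
    ultimately show ?thesis using C by (metis image_eqI le_max_iff_disj real_norm_def)
  qed simp
  then show ?thesis by blast
qed

text \<open>The mean value theorem is applied in coordinate \<open>i\<close> to the increment in
  \<open>j\<close>, then in \<open>j\<close>. The second difference is symmetric in \<open>i\<close>
  and \<open>j\<close> while the order of differentiation is not, which is the source of Schwarz's
  theorem.\<close>

lemma second_difference_mean_value:
  assumes C: "Ck m 2 \<phi>" and ij: "i < m" "j < m" "i \<noteq> j" and h: "h > 0"
  shows "\<exists>\<xi> \<eta>. \<bar>\<xi> - a\<bar> \<le> h \<and> \<bar>\<eta> - b\<bar> \<le> h \<and>
    \<phi> (x(i := a + h, j := b + h)) - \<phi> (x(i := a + h, j := b)) - \<phi> (x(i := a, j := b + h)) + \<phi> (x(i := a, j := b))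
      = h * h * partial_deriv j (partial_deriv i \<phi>) (x(i := \<xi>, j := \<eta>))"
proof -
  have C2: "Ck m (Suc (Suc 0)) \<phi>" using C by (simp add: numeral_2_eq_2)
  let ?i = "partial_deriv i \<phi>"
  have C1: "Ck m (Suc 0) ?i" using C2 ij by simp
  have d1: "((\<lambda>s. \<phi> (x(i := s, j := t))) has_real_derivative ?i (x(i := s, j := t))) (at s)" for s t
    using Ck_partial_DERIV[OF C2 ij(1), of "x(j := t)" s] ij(3) by (simp add: fun_upd_twist)
  have d2: "((\<lambda>t. ?i (x(i := s, j := t))) has_real_derivative partial_deriv j ?i (x(i := s, j := t))) (at t)" for s t
    using Ck_partial_DERIV[OF C1 ij(2), of "x(i := s)" t] by simp
  obtain \<xi> where \<xi>: "a < \<xi>" "\<xi> < a + h"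
    "(\<phi> (x(i := a + h, j := b + h)) - \<phi> (x(i := a + h, j := b))) - (\<phi> (x(i := a, j := b + h)) - \<phi> (x(i := a, j := b)))
      = (a + h - a) * (?i (x(i := \<xi>, j := b + h)) - ?i (x(i := \<xi>, j := b)))"
    using MVT2[of a "a + h" "\<lambda>s. \<phi> (x(i := s, j := b + h)) - \<phi> (x(i := s, j := b))"
       "\<lambda>s. ?i (x(i := s, j := b + h)) - ?i (x(i := s, j := b))"]
      h DERIV_diff[OF d1 d1] by auto
  obtain \<eta> where \<eta>: "b < \<eta>" "\<eta> < b + h"
    "?i (x(i := \<xi>, j := b + h)) - ?i (x(i := \<xi>, j := b))
      = (b + h - b) * partial_deriv j ?i (x(i := \<xi>, j := \<eta>))"
    using MVT2[of b "b + h" "\<lambda>t. ?i (x(i := \<xi>, j := t))"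
       "\<lambda>t. partial_deriv j ?i (x(i := \<xi>, j := t))"] h d2 by auto
  have "\<phi> (x(i := a + h, j := b + h)) - \<phi> (x(i := a + h, j := b)) - \<phi> (x(i := a, j := b + h)) + \<phi> (x(i := a, j := b))
      = h * h * partial_deriv j ?i (x(i := \<xi>, j := \<eta>))"
    using \<xi>(3) \<eta>(3) by (simp add: algebra_simps)
  then show ?thesis using \<xi>(1,2) \<eta>(1,2) by (intro exI[of _ \<xi>] exI[of _ \<eta>]) auto
qed

text \<open>At each step size \<open>?h n\<close> both mixed derivatives take a common value, the
  second difference over \<open>?h n\<close> squared, at points within \<open>?h n\<close> of
  \<open>x\<close> in each of the two coordinates; continuity carries this to
  \<open>x\<close>.\<close>

lemma partial_deriv_commute:
  assumes C: "Ck m 2 \<phi>" and ij: "i < m" "j < m"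
  shows "partial_deriv i (partial_deriv j \<phi>) x = partial_deriv j (partial_deriv i \<phi>) x"
proof (cases "i = j")
  case False
  have C2: "Ck m (Suc (Suc 0)) \<phi>" using C by (simp add: numeral_2_eq_2)
  let ?ij = "partial_deriv i (partial_deriv j \<phi>)" and ?ji = "partial_deriv j (partial_deriv i \<phi>)"
  have c: "continuous_on UNIV ?ij" "continuous_on UNIV ?ji"
    using C2 ij by simp_all
  let ?h = "\<lambda>n. inverse (real (Suc n))"
  have "\<forall>n. \<exists>\<xi> \<eta> \<xi>' \<eta>'. \<bar>\<xi> - x i\<bar> \<le> ?h n \<and> \<bar>\<eta> - x j\<bar> \<le> ?h n \<and> \<bar>\<xi>' - x i\<bar> \<le> ?h n \<and> \<bar>\<eta>' - x j\<bar> \<le> ?h n \<and>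
     ?ji (x(i := \<xi>, j := \<eta>)) = ?ij (x(i := \<xi>', j := \<eta>'))"
    (is "\<forall>n. ?E n")
  proof
    fix n
    have h: "?h n > 0" by simp
    have hh: "?h n * ?h n \<noteq> 0" by simp
    obtain \<xi> \<eta> where 1: "\<bar>\<xi> - x i\<bar> \<le> ?h n" "\<bar>\<eta> - x j\<bar> \<le> ?h n"
      "\<phi> (x(i := x i + ?h n, j := x j + ?h n)) - \<phi> (x(i := x i + ?h n, j := x j)) - \<phi> (x(i := x i, j := x j + ?h n)) + \<phi> (x(i := x i, j := x j))
      = ?h n * ?h n * ?ji (x(i := \<xi>, j := \<eta>))"
      using second_difference_mean_value[OF C ij False h, of "x i" "x j" x] by blast
    obtain \<eta>' \<xi>' where 2: "\<bar>\<eta>' - x j\<bar> \<le> ?h n" "\<bar>\<xi>' - x i\<bar> \<le> ?h n"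
      "\<phi> (x(j := x j + ?h n, i := x i + ?h n)) - \<phi> (x(j := x j + ?h n, i := x i)) - \<phi> (x(j := x j, i := x i + ?h n)) + \<phi> (x(j := x j, i := x i))
      = ?h n * ?h n * ?ij (x(j := \<eta>', i := \<xi>'))"
      using second_difference_mean_value[OF C ij(2,1) False[symmetric] h, of "x j" "x i" x] by blast
    have tw: "x(j := t, i := s) = x(i := s, j := t)" for s t using False by (simp add: fun_upd_twist)
    have "?h n * ?h n * ?ji (x(i := \<xi>, j := \<eta>)) = ?h n * ?h n * ?ij (x(i := \<xi>', j := \<eta>'))"
      using 1(3) 2(3) unfolding tw by linarith
    then have "?ji (x(i := \<xi>, j := \<eta>)) = ?ij (x(i := \<xi>', j := \<eta>'))"
      using hh by (simp only: mult_cancel_left) simp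
    then show "?E n"
      using 1(1,2) 2(1,2) by blast
  qed
  then obtain \<xi> \<eta> \<xi>' \<eta>' where p: "\<And>n. \<bar>\<xi> n - x i\<bar> \<le> ?h n" "\<And>n. \<bar>\<eta> n - x j\<bar> \<le> ?h n" "\<And>n. \<bar>\<xi>' n - x i\<bar> \<le> ?h n" "\<And>n. \<bar>\<eta>' n - x j\<bar> \<le> ?h n"
    "\<And>n. ?ji (x(i := \<xi> n, j := \<eta> n)) = ?ij (x(i := \<xi>' n, j := \<eta>' n))"
    by metis
  have lim: "(\<lambda>n. a n) \<longlonglongrightarrow> l" if "\<And>n. \<bar>a n - l\<bar> \<le> ?h n" for a l
    using Lim_null_comparison[OF always_eventually LIMSEQ_inverse_real_of_nat, of "\<lambda>n. a n - l"] that
    by (simp add: LIM_zero_iff del: of_nat_Suc)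
  have cc: "(\<lambda>n. D (x(i := a n, j := b n))) \<longlonglongrightarrow> D x"
    if D: "continuous_on UNIV D" and a: "a \<longlonglongrightarrow> x i" and b: "b \<longlonglongrightarrow> x j" for D :: "(nat \<Rightarrow> real) \<Rightarrow> real" and a b
  proof -
    have "continuous_on UNIV (\<lambda>p. (x(i := fst p, j := snd p)) k)" for k
      by (cases "k = j"; cases "k = i") (auto intro!: continuous_intros)
    then have "continuous_on UNIV (\<lambda>p. x(i := fst p, j := snd p))"
      by (rule continuous_on_coordinatewise_then_product)
    then have "continuous_on UNIV (\<lambda>p. D (x(i := fst p, j := snd p)))"
      by (rule continuous_on_compose2[OF D]) auto
    then have "isCont (\<lambda>p. D (x(i := fst p, j := snd p))) (x i, x j)"
      by (simp add: continuous_on_eq_continuous_at)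
    from isCont_tendsto_compose[OF this tendsto_Pair[OF a b]] show ?thesis by simp
  qed
  have "(\<lambda>n. ?ji (x(i := \<xi> n, j := \<eta> n))) \<longlonglongrightarrow> ?ji x"
    by (intro cc c lim p)
  moreover have "(\<lambda>n. ?ji (x(i := \<xi> n, j := \<eta> n))) \<longlonglongrightarrow> ?ij x"
    unfolding p(5) by (intro cc c lim p)
  ultimately show ?thesis using LIMSEQ_unique by blast
qed simp

section \<open>The Gaussian frame of the free Gibbs measure\<close>

lemma module_scaleC: "module ((*\<^sub>C) :: complex \<Rightarrow> 'a::complex_inner \<Rightarrow> 'a)"
  using scaleC_of_real[of 1]
  by unfold_locales (auto simp: scaleC_add_right scaleC_add_left scaleC_scaleC)

lemma cinner_add_left: "cinner (x + y) z = cinner x z + cinner y z"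
  by (metis cinner_add_right cinner_commute complex_cnj_add)

lemma cinner_scaleC_left: "cinner (a *\<^sub>C x) y = cnj a * cinner x y"
  by (metis cinner_scaleC_right cinner_commute complex_cnj_mult)

lemma cinner_scaleR_right: "cinner x (r *\<^sub>R y) = complex_of_real r * cinner x y"
  by (metis cinner_scaleC_right scaleC_of_real)

lemma cinner_scaleR_left: "cinner (r *\<^sub>R x) y = complex_of_real r * cinner x y"
  by (metis cinner_scaleC_left scaleC_of_real complex_cnj_complex_of_real)

lemma cinner_zero_right[simp]: "cinner x 0 = 0"
  using cinner_scaleR_right[of x 0 0] by simp

lemma cinner_zero_left[simp]: "cinner 0 x = 0"
  using cinner_scaleR_left[of 0 0 x] by simp

lemma cinner_diff_right: "cinner x (y - z) = cinner x y - cinner x z"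
  using cinner_add_right[of x "y - z" z] by simp

lemma cinner_sum_right: "cinner x (\<Sum>i\<in>I. f i) = (\<Sum>i\<in>I. cinner x (f i))"
  by (induction I rule: infinite_finite_induct) (auto simp: cinner_add_right)

lemma cinner_sum_left: "cinner (\<Sum>i\<in>I. f i) x = (\<Sum>i\<in>I. cinner (f i) x)"
  by (induction I rule: infinite_finite_induct) (auto simp: cinner_add_left)

lemma cinner_self: "cinner x x = complex_of_real ((norm x)\<^sup>2)"
proof (rule complex_eqI)
  show "Re (cinner x x) = Re (complex_of_real ((norm x)\<^sup>2))"
    by (simp add: power2_norm_eq_inner inner_eq_Re_cinner)
  have "Im (cinner x x) = - Im (cinner x x)"
    by (metis cinner_commute complex_cnj cnj.sel(2))
  then show "Im (cinner x x) = Im (complex_of_real ((norm x)\<^sup>2))" by simp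
qed

lemma tendsto_cinner_right:
  assumes "(f \<longlongrightarrow> l) F"
  shows "((\<lambda>n. cinner x (f n)) \<longlongrightarrow> cinner x l) F"
proof -
  have eq: "cinner x y = Complex (inner x y) (inner (\<i> *\<^sub>C x) y)" for y
    by (simp add: inner_eq_Re_cinner cinner_scaleC_left complex_eq_iff)
  show ?thesis unfolding eq by (intro tendsto_Complex tendsto_inner tendsto_const assms)
qed

text \<open>A bounded functional is determined by its values on a dense set, so a representing
  vector \<open>y\<close> settles the definite description and makes the pairing an inner product of
  the completion.\<close>

lemma dual_pairing_eq:
  assumes dense: "closure (range \<iota>) = UNIV" and y: "\<And>x. inner (\<iota> x) y = inner x w"
  shows "dual_pairing \<iota> u w = inner u y"
proof -
  have "(THE l. bounded_linear l \<and> (\<forall>x. l (\<iota> x) = inner x w)) = (\<lambda>u. inner u y)"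
  proof (rule the_equality)
    show "bounded_linear (\<lambda>u. inner u y) \<and> (\<forall>x. inner (\<iota> x) y = inner x w)"
      by (simp add: y bounded_linear_inner_left)
    fix l assume l: "bounded_linear l \<and> (\<forall>x. l (\<iota> x) = inner x w)"
    have "closed {u. l u = inner u y}"
      using l by (intro closed_Collect_eq continuous_intros linear_continuous_on) auto
    moreover have "range \<iota> \<subseteq> {u. l u = inner u y}" using l y by auto
    ultimately have "closure (range \<iota>) \<subseteq> {u. l u = inner u y}" by (rule closure_minimal[rotated])
    then show "l = (\<lambda>u. inner u y)" unfolding dense by auto
  qed
  then show ?thesis by (simp add: dual_pairing_def)
qed

section \<open>Bessel's inequality and convergence of orthonormal expansions\<close>

locale orthonormal_sequence =
  fixes e :: "nat \<Rightarrow> 'h::{complex_inner,complete_space}"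
  assumes cinner_e: "cinner (e i) (e j) = (if i = j then 1 else 0)"
begin

lemma norm_sum_e: "finite I \<Longrightarrow> (norm (\<Sum>j\<in>I. a j *\<^sub>C e j))\<^sup>2 = (\<Sum>j\<in>I. (cmod (a j))\<^sup>2)"
proof -
  assume I: "finite I"
  have "complex_of_real ((norm (\<Sum>j\<in>I. a j *\<^sub>C e j))\<^sup>2) = (\<Sum>i\<in>I. \<Sum>j\<in>I. cnj (a i) * (a j * (if i = j then 1 else 0)))"
    unfolding cinner_self[symmetric] cinner_sum_left unfolding cinner_sum_right
    by (intro sum.cong refl) (simp add: cinner_scaleC_left cinner_scaleC_right cinner_e)
  also have "\<dots> = (\<Sum>i\<in>I. cnj (a i) * a i)"
    using I by (intro sum.cong refl) (simp add: if_distrib[where f = "\<lambda>x. _ * (_ * x)"] cong: if_cong)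
  also have "\<dots> = complex_of_real (\<Sum>j\<in>I. (cmod (a j))\<^sup>2)"
    unfolding of_real_sum by (intro sum.cong refl) (metis complex_norm_square mult.commute of_real_power)
  finally show ?thesis by (simp only: of_real_eq_iff)
qed

lemma bessel: "summable (\<lambda>j. (cmod (cinner (e j) x))\<^sup>2)"
proof (rule bounded_imp_summable[of _ "(norm x)\<^sup>2"])
  fix n
  let ?c = "\<lambda>j. cinner (e j) x"
  let ?y = "\<Sum>j\<le>n. ?c j *\<^sub>C e j"
  have "inner ?y x = (\<Sum>j\<le>n. (cmod (?c j))\<^sup>2)"
    unfolding inner_eq_Re_cinner cinner_sum_left cinner_scaleC_left Re_sum
    by (intro sum.cong refl) (simp add: cmod_power2 flip: power2_eq_square)
  moreover have "inner ?y ?y = (\<Sum>j\<le>n. (cmod (?c j))\<^sup>2)"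
    using norm_sum_e[of "{..n}" ?c] by (simp add: power2_norm_eq_inner)
  moreover have "0 \<le> inner (x - ?y) (x - ?y)" by simp
  ultimately show "(\<Sum>j\<le>n. (cmod (?c j))\<^sup>2) \<le> (norm x)\<^sup>2"
    by (simp add: inner_diff_left inner_diff_right power2_norm_eq_inner inner_commute[of x ?y])
qed simp

text \<open>By orthogonality the squared norm of a block of the series is the corresponding block of
  the numerical series; completeness gives the limit.\<close>

lemma summable_e:
  assumes "summable (\<lambda>j. (cmod (a j))\<^sup>2)"
  shows "summable (\<lambda>j. a j *\<^sub>C e j)"
proof -
  have "Cauchy (\<lambda>n. \<Sum>j<n. a j *\<^sub>C e j)"
  proof (rule metric_CauchyI)
    fix \<epsilon> :: real assume \<epsilon>: "\<epsilon> > 0"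
    then have "\<epsilon>\<^sup>2 > 0" by simp
    then obtain N where N: "\<And>m n. m \<ge> N \<Longrightarrow> norm (\<Sum>j\<in>{m..<n}. (cmod (a j))\<^sup>2) < \<epsilon>\<^sup>2"
      using assms unfolding summable_Cauchy by blast
    have *: "dist (\<Sum>j<m. a j *\<^sub>C e j) (\<Sum>j<n. a j *\<^sub>C e j) < \<epsilon>" if "N \<le> m" "m \<le> n" for m n
    proof -
      have "(\<Sum>j<n. a j *\<^sub>C e j) - (\<Sum>j<m. a j *\<^sub>C e j) = (\<Sum>j\<in>{m..<n}. a j *\<^sub>C e j)"
        using that(2) by (simp add: sum_diff_nat_ivl lessThan_atLeast0)
      then have "(dist (\<Sum>j<m. a j *\<^sub>C e j) (\<Sum>j<n. a j *\<^sub>C e j))\<^sup>2 = (\<Sum>j\<in>{m..<n}. (cmod (a j))\<^sup>2)"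
        by (subst dist_commute) (simp add: dist_norm norm_sum_e)
      also have "\<dots> < \<epsilon>\<^sup>2" using N[OF that(1), of n] by (simp add: sum_nonneg)
      finally show ?thesis using \<epsilon> by (simp add: power_less_imp_less_base)
    qed
    show "\<exists>M. \<forall>m\<ge>M. \<forall>n\<ge>M. dist (\<Sum>j<m. a j *\<^sub>C e j) (\<Sum>j<n. a j *\<^sub>C e j) < \<epsilon>"
    proof (intro exI[of _ N] allI impI)
      fix m n assume "N \<le> m" "N \<le> n"
      then show "dist (\<Sum>j<m. a j *\<^sub>C e j) (\<Sum>j<n. a j *\<^sub>C e j) < \<epsilon>"
        using *[of m n] *[of n m] by (cases "m \<le> n") (auto simp: dist_commute)
    qed
  qed
  then show ?thesis by (simp add: summable_iff_convergent Cauchy_convergent_iff)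
qed

end

section \<open>The frame of the completion and the covariance of the free measure\<close>

locale free_gibbs =
  fixes D :: "'h::{complex_inner,complete_space,second_countable_topology} set"
    and A :: "'h \<Rightarrow> 'h" and c :: real and e :: "nat \<Rightarrow> 'h" and lam :: "nat \<Rightarrow> real" and s :: real
    and \<iota> :: "'h \<Rightarrow> 'k::{complex_inner,complete_space,second_countable_topology}"
    and \<beta> :: real and \<mu>0 :: "'k measure"
  assumes self_adj: "self_adjoint D A" and c_pos: "c > 0"
    and coercive: "\<forall>x\<in>D. inner x (A x) \<ge> c * (norm x)\<^sup>2"
    and basis: "orthonormal_basis e" and eigen: "\<forall>j. e j \<in> D \<and> A (e j) = lam j *\<^sub>R e j"
    and s_nonneg: "s \<ge> 0" and completion: "sobolev_completion e lam s \<iota>"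
    and \<beta>_pos: "\<beta> > 0" and gibbs: "free_gibbs_measure D A e lam s \<iota> \<beta> \<mu>0"
begin

sublocale orthonormal_sequence e
  using basis by unfold_locales (simp add: orthonormal_basis_def)

definition E :: "nat \<times> bool \<Rightarrow> 'h" where "E v = (if snd v then \<i> *\<^sub>C e (fst v) else e (fst v))"
definition d :: "nat \<times> bool \<Rightarrow> 'k" where "d v = \<iota> (E v)"
text \<open>The factor \<open>lam powr s\<close> undoes the weight of the inner product of order
  \<open>-s\<close>, so that the inner product with \<open>z v\<close> is the duality pairing with
  \<open>E v\<close>.\<close>

definition z :: "nat \<times> bool \<Rightarrow> 'k" where "z v = (lam (fst v) powr s) *\<^sub>R \<iota> (E v)"
text \<open>The inverse variance of the coordinate \<open>v\<close> under the free measure; the two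
  real coordinates of a mode share it.\<close>

definition \<kappa> :: "nat \<times> bool \<Rightarrow> real" where "\<kappa> v = \<beta> * lam (fst v)"

lemma norm_e: "norm (e j) = 1"
proof -
  have "complex_of_real ((norm (e j))\<^sup>2) = complex_of_real 1"
    unfolding cinner_self[symmetric] cinner_e by simp
  then have "(norm (e j))\<^sup>2 = 1" by (simp only: of_real_eq_iff)
  then show ?thesis using norm_ge_zero[of "e j"] unfolding power2_eq_1_iff by linarith
qed

lemma lam_ge: "lam j \<ge> c"
  using coercive[rule_format, of "e j"] eigen by (simp add: norm_e power2_norm_eq_inner[symmetric])

lemma lam_pos: "lam j > 0"
  using lam_ge[of j] c_pos by linarith

lemma inner_E: "inner (E v) (E w) = (if v = w then 1 else 0)"
  by (cases v; cases w) (auto simp: E_def inner_eq_Re_cinner cinner_scaleC_left cinner_scaleC_right cinner_e)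

lemma D_closed: "0 \<in> D" "x \<in> D \<Longrightarrow> y \<in> D \<Longrightarrow> x + y \<in> D" "x \<in> D \<Longrightarrow> a *\<^sub>C x \<in> D" "x \<in> D \<Longrightarrow> r *\<^sub>R x \<in> D"
  and A_linear: "x \<in> D \<Longrightarrow> y \<in> D \<Longrightarrow> A (x + y) = A x + A y" "x \<in> D \<Longrightarrow> A (a *\<^sub>C x) = a *\<^sub>C A x"
    "x \<in> D \<Longrightarrow> A (r *\<^sub>R x) = r *\<^sub>R A x"
proof -
  have l: "linear_operator D A" using self_adj by (simp add: self_adjoint_def)
  then have "module.subspace (*\<^sub>C) D" by (simp add: linear_operator_def)
  then show *: "0 \<in> D" "x \<in> D \<Longrightarrow> y \<in> D \<Longrightarrow> x + y \<in> D" "\<And>a. x \<in> D \<Longrightarrow> a *\<^sub>C x \<in> D"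
    unfolding module.subspace_def[OF module_scaleC] by auto
  show "x \<in> D \<Longrightarrow> r *\<^sub>R x \<in> D" using *(3)[of "complex_of_real r"] by (simp add: scaleC_of_real)
  show "x \<in> D \<Longrightarrow> y \<in> D \<Longrightarrow> A (x + y) = A x + A y" "\<And>a. x \<in> D \<Longrightarrow> A (a *\<^sub>C x) = a *\<^sub>C A x"
    using l by (auto simp: linear_operator_def)
  then show "x \<in> D \<Longrightarrow> A (r *\<^sub>R x) = r *\<^sub>R A x"
    by (metis scaleC_of_real)
qed

lemma E_in_D: "E v \<in> D" "A (E v) = lam (fst v) *\<^sub>R E v"
proof -
  have e: "e j \<in> D" "A (e j) = lam j *\<^sub>R e j" for j using eigen by auto
  show "E v \<in> D" using e D_closed(3) by (simp add: E_def)
  have "\<i> *\<^sub>C (lam j *\<^sub>R e j) = lam j *\<^sub>R (\<i> *\<^sub>C e j)" for j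
    by (simp add: scaleC_of_real[symmetric] scaleC_scaleC mult.commute)
  then show "A (E v) = lam (fst v) *\<^sub>R E v" by (simp add: E_def A_linear(2) e)
qed

lemma sum_E_in_D:
  assumes "finite J"
  shows "(\<Sum>v\<in>J. w v *\<^sub>R E v) \<in> D" "A (\<Sum>v\<in>J. w v *\<^sub>R E v) = (\<Sum>v\<in>J. (w v * lam (fst v)) *\<^sub>R E v)"
proof -
  have A0: "A 0 = 0" using A_linear(3)[of 0 0] D_closed(1) by simp
  from assms have "(\<Sum>v\<in>J. w v *\<^sub>R E v) \<in> D \<and> A (\<Sum>v\<in>J. w v *\<^sub>R E v) = (\<Sum>v\<in>J. (w v * lam (fst v)) *\<^sub>R E v)"
  proof induction
    case (insert v J)
    then show ?case
      by (simp add: D_closed A_linear E_in_D)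
  qed (simp add: D_closed A0)
  then show "(\<Sum>v\<in>J. w v *\<^sub>R E v) \<in> D" "A (\<Sum>v\<in>J. w v *\<^sub>R E v) = (\<Sum>v\<in>J. (w v * lam (fst v)) *\<^sub>R E v)"
    by auto
qed

text \<open>Needed because the covariance is written with \<open>the_inv_into D A\<close>.\<close>

lemma inj_A: "inj_on A D"
proof (rule inj_onI)
  fix x y assume xy: "x \<in> D" "y \<in> D" "A x = A y"
  have m: "(- 1) *\<^sub>R y \<in> D" using D_closed(4)[OF xy(2)] .
  have "A (x + (- 1) *\<^sub>R y) = A x + (- 1) *\<^sub>R A y"
    by (simp only: A_linear(1)[OF xy(1) m] A_linear(3)[OF xy(2)])
  then have "A (x - y) = 0" using xy(3) by simp
  moreover have "x - y \<in> D" using D_closed(2)[OF xy(1) m] by simp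
  ultimately have "c * (norm (x - y))\<^sup>2 \<le> 0" using coercive by fastforce
  then show "x = y" using c_pos by (simp add: mult_le_0_iff)
qed

lemma \<iota>_linear: "\<iota> (x + y) = \<iota> x + \<iota> y" "\<iota> (a *\<^sub>C x) = a *\<^sub>C \<iota> x" "\<iota> (r *\<^sub>R x) = r *\<^sub>R \<iota> x" "\<iota> 0 = 0"
  "\<iota> (x - y) = \<iota> x - \<iota> y" "\<iota> (sum f I) = (\<Sum>i\<in>I. \<iota> (f i))"
proof -
  show add: "\<iota> (x + y) = \<iota> x + \<iota> y" for x y using completion by (simp add: sobolev_completion_def)
  show sc: "\<iota> (a *\<^sub>C x) = a *\<^sub>C \<iota> x" for a x using completion by (simp add: sobolev_completion_def)
  show scR: "\<iota> (r *\<^sub>R x) = r *\<^sub>R \<iota> x" for r x using sc[of "complex_of_real r" x] by (simp add: scaleC_of_real)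
  show z: "\<iota> 0 = 0" using scR[of 0 0] by simp
  show "\<iota> (x - y) = \<iota> x - \<iota> y" using add[of "x - y" y] by simp
  show "\<iota> (sum f I) = (\<Sum>i\<in>I. \<iota> (f i))"
    by (induction I rule: infinite_finite_induct) (auto simp: add z)
qed

lemma dense_\<iota>: "closure (range \<iota>) = UNIV"
  using completion by (simp add: sobolev_completion_def)

abbreviation op :: "'h \<Rightarrow> 'h" where "op x \<equiv> op_powr e lam (- s / 2) x"

text \<open>The infinite sum in \<open>op_powr\<close> is meaningful only if it converges. As
  \<open>lam j \<ge> c\<close> and the exponent is not positive, the factors are bounded by
  \<open>c powr (- s / 2)\<close>, and Bessel's inequality applies to every
  \<open>x\<close>.\<close>

lemma op_sums: "(\<lambda>j. (complex_of_real (lam j powr (- s / 2)) * cinner (e j) x) *\<^sub>C e j) sums op x"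
proof -
  have "summable (\<lambda>j. (c powr (- s / 2))\<^sup>2 * (cmod (cinner (e j) x))\<^sup>2)"
    by (intro summable_mult bessel)
  then have "summable (\<lambda>j. (cmod (complex_of_real (lam j powr (- s / 2)) * cinner (e j) x))\<^sup>2)"
  proof (rule summable_comparison_test[rotated], intro exI[of _ 0] allI impI)
    fix j
    have "lam j powr (- s / 2) \<le> c powr (- s / 2)"
      using lam_ge[of j] c_pos s_nonneg by (intro powr_mono2') auto
    then show "norm ((cmod (complex_of_real (lam j powr (- s / 2)) * cinner (e j) x))\<^sup>2) \<le> (c powr (- s / 2))\<^sup>2 * (cmod (cinner (e j) x))\<^sup>2"
      by (simp add: norm_mult power_mult_distrib mult_right_mono power_mono)
  qed
  from summable_sums[OF summable_e[OF this]] show ?thesis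
    unfolding op_powr_def by (simp add: scaleC_of_real[symmetric] scaleC_scaleC)
qed

lemma cinner_e_op: "cinner (e k) (op x) = complex_of_real (lam k powr (- s / 2)) * cinner (e k) x"
proof -
  let ?a = "\<lambda>j. complex_of_real (lam j powr (- s / 2)) * cinner (e j) x"
  have "(\<lambda>n. cinner (e k) (\<Sum>j<n. ?a j *\<^sub>C e j)) \<longlonglongrightarrow> cinner (e k) (op x)"
    using op_sums[of x] unfolding sums_def by (rule tendsto_cinner_right)
  moreover have "(\<lambda>n. cinner (e k) (\<Sum>j<n. ?a j *\<^sub>C e j)) \<longlonglongrightarrow> ?a k"
  proof (rule tendsto_eventually)
    show "\<forall>\<^sub>F n in sequentially. cinner (e k) (\<Sum>j<n. ?a j *\<^sub>C e j) = ?a k"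
      using eventually_gt_at_top[of k]
    proof eventually_elim
      case (elim n)
      have "cinner (e k) (\<Sum>j<n. ?a j *\<^sub>C e j) = (\<Sum>j<n. if j = k then ?a j else 0)"
        unfolding cinner_sum_right cinner_scaleC_right cinner_e by (intro sum.cong) auto
      then show ?case using elim by simp
    qed
  qed
  ultimately show ?thesis by (rule LIMSEQ_unique)
qed

lemma op_e: "op (e k) = (lam k powr (- s / 2)) *\<^sub>R e k"
proof -
  have "(\<lambda>j. (complex_of_real (lam j powr (- s / 2)) * cinner (e j) (e k)) *\<^sub>C e j) sums
    (\<Sum>j\<in>{k}. (complex_of_real (lam j powr (- s / 2)) * cinner (e j) (e k)) *\<^sub>C e j)"
    using module.scale_zero_left[OF module_scaleC]
    by (intro sums_finite) (auto simp: cinner_e)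
  from sums_unique2[OF op_sums this] show ?thesis by (simp add: cinner_e scaleC_of_real)
qed

lemma cinner_\<iota>: "cinner (\<iota> x) (\<iota> y) = cinner (op x) (op y)"
  using completion by (simp add: sobolev_completion_def)

text \<open>Each of the two operators \<open>op\<close> contributes
  \<open>lam powr (- s / 2)\<close> on the mode of \<open>v\<close>, and \<open>z v\<close> carries
  the inverse of the product.\<close>

lemma inner_\<iota>_z: "inner (\<iota> x) (z v) = inner x (E v)"
proof -
  have 1: "cinner (\<iota> x) (\<iota> (e k)) = complex_of_real (lam k powr (- s)) * cinner x (e k)" for k
  proof -
    have "cinner (\<iota> x) (\<iota> (e k)) = complex_of_real (lam k powr (- s / 2)) * cinner (op x) (e k)"
      by (simp only: cinner_\<iota> op_e cinner_scaleR_right)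
    also have "cinner (op x) (e k) = complex_of_real (lam k powr (- s / 2)) * cinner x (e k)"
      using cinner_e_op[of k x] cinner_commute[of "op x" "e k"] cinner_commute[of x "e k"] by simp
    finally show ?thesis by (simp flip: powr_add of_real_mult mult.assoc)
  qed
  have "cinner (\<iota> x) (\<iota> (E v)) = complex_of_real (lam (fst v) powr (- s)) * cinner x (E v)"
    by (auto simp: E_def \<iota>_linear cinner_scaleC_right 1 mult_ac)
  then have "cinner (\<iota> x) (z v) = complex_of_real (lam (fst v) powr s * lam (fst v) powr (- s)) * cinner x (E v)"
    by (simp add: z_def cinner_scaleR_right mult_ac)
  also have "lam (fst v) powr s * lam (fst v) powr (- s) = 1"
    using lam_pos[of "fst v"] by (simp flip: powr_add)
  finally show ?thesis by (simp add: inner_eq_Re_cinner)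
qed

lemma dual_pairing_sum: "dual_pairing \<iota> u (\<Sum>v\<in>J. w v *\<^sub>R E v) = inner u (\<Sum>v\<in>J. w v *\<^sub>R z v)"
  by (rule dual_pairing_eq[OF dense_\<iota>]) (simp add: inner_sum_right inner_\<iota>_z)

lemma dual_pairing_E: "dual_pairing \<iota> u (E v) = inner u (z v)"
  by (rule dual_pairing_eq[OF dense_\<iota> inner_\<iota>_z])

text \<open>Since \<open>\<iota> w\<close> and \<open>op w\<close> have the same norm, the expansion
  of \<open>x\<close> converges after applying \<open>\<iota>\<close>: \<open>op\<close> of the
  remainder is the tail of the series in \<open>op_sums\<close>. The real span suffices because both
  \<open>e j\<close> and \<open>\<i> *\<^sub>C e j\<close> occur among the
  \<open>E v\<close>.\<close>

lemma dense_z: "closure (span (range z)) = UNIV"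
proof -
  let ?S = "closure (span (range z))"
  have E: "\<iota> (E v) \<in> span (range z)" for v
  proof -
    have "\<iota> (E v) = (lam (fst v) powr (- s)) *\<^sub>R z v"
      using lam_pos[of "fst v"] by (simp add: z_def flip: powr_add)
    then show ?thesis by (simp add: span_scale span_base)
  qed
  have \<iota>e: "a *\<^sub>C \<iota> (e j) \<in> span (range z)" for a j
  proof -
    have "a *\<^sub>C \<iota> (e j) = Re a *\<^sub>R \<iota> (E (j, False)) + Im a *\<^sub>R \<iota> (E (j, True))"
    proof -
      have "a *\<^sub>C \<iota> (e j) = (complex_of_real (Re a) + complex_of_real (Im a) * \<i>) *\<^sub>C \<iota> (e j)"
        by (rule arg_cong[of _ _ "\<lambda>a. a *\<^sub>C \<iota> (e j)"]) (simp add: complex_eq_iff)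
      also have "\<dots> = Re a *\<^sub>R \<iota> (E (j, False)) + Im a *\<^sub>R \<iota> (E (j, True))"
        by (simp only: scaleC_add_left scaleC_scaleC[symmetric] scaleC_of_real E_def \<iota>_linear fst_conv snd_conv if_True if_False)
      finally show ?thesis .
    qed
    then show ?thesis using E by (simp add: span_add span_scale)
  qed
  have "\<iota> x \<in> ?S" for x
  proof -
    let ?y = "\<lambda>n. \<Sum>j<n. cinner (e j) x *\<^sub>C e j"
    let ?a = "\<lambda>j. complex_of_real (lam j powr (- s / 2)) * cinner (e j) x"
    have "op (x - ?y n) = op x - (\<Sum>j<n. ?a j *\<^sub>C e j)" for n
    proof -
      have co: "cinner (e j) (x - ?y n) = (if j < n then 0 else cinner (e j) x)" for j
      proof -
        have "cinner (e j) (?y n) = (\<Sum>i<n. if i = j then cinner (e i) x else 0)"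
          unfolding cinner_sum_right cinner_scaleC_right cinner_e by (intro sum.cong) auto
        also have "\<dots> = (if j < n then cinner (e j) x else 0)" by simp
        finally show ?thesis by (simp add: cinner_diff_right)
      qed
      have "(\<lambda>j. ?a j *\<^sub>C e j - (if j \<in> {..<n} then ?a j *\<^sub>C e j else 0)) sums (op x - (\<Sum>j<n. ?a j *\<^sub>C e j))"
        by (intro sums_diff op_sums sums_If_finite_set) auto
      moreover have "?a j *\<^sub>C e j - (if j \<in> {..<n} then ?a j *\<^sub>C e j else 0) =
          (complex_of_real (lam j powr (- s / 2)) * cinner (e j) (x - ?y n)) *\<^sub>C e j" for j
        using module.scale_zero_left[OF module_scaleC] by (auto simp: co)
      ultimately show ?thesis using op_sums[of "x - ?y n"] sums_unique2 by simp
    qed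
    moreover have "(\<lambda>n. op x - (\<Sum>j<n. ?a j *\<^sub>C e j)) \<longlonglongrightarrow> op x - op x"
      using op_sums[of x] unfolding sums_def by (intro tendsto_intros)
    ultimately have "(\<lambda>n. op (x - ?y n)) \<longlonglongrightarrow> 0" by simp
    then have "(\<lambda>n. norm (op (x - ?y n))) \<longlonglongrightarrow> 0" by (rule tendsto_norm_zero)
    moreover have "norm (op w) = norm (\<iota> w)" for w
      using cinner_\<iota>[of w w] unfolding cinner_self by (simp only: of_real_eq_iff) (simp add: power2_eq_iff_nonneg)
    ultimately have "(\<lambda>n. norm (\<iota> (x - ?y n))) \<longlonglongrightarrow> 0" by (simp only:)
    then have "(\<lambda>n. \<iota> (x - ?y n)) \<longlonglongrightarrow> 0" by (rule tendsto_norm_zero_cancel)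
    then have "(\<lambda>n. \<iota> x - \<iota> (x - ?y n)) \<longlonglongrightarrow> \<iota> x - 0" by (intro tendsto_intros)
    moreover have "\<iota> x - \<iota> (x - ?y n) = (\<Sum>j<n. cinner (e j) x *\<^sub>C \<iota> (e j))" for n
      by (simp add: \<iota>_linear)
    ultimately have "(\<lambda>n. \<Sum>j<n. cinner (e j) x *\<^sub>C \<iota> (e j)) \<longlonglongrightarrow> \<iota> x" by simp
    moreover have "(\<Sum>j<n. cinner (e j) x *\<^sub>C \<iota> (e j)) \<in> span (range z)" for n
      by (intro span_sum \<iota>e)
    ultimately show ?thesis unfolding closure_sequential
      by (intro exI[of _ "\<lambda>n. \<Sum>j<n. cinner (e j) x *\<^sub>C \<iota> (e j)"] conjI allI)
  qed
  then have "closure (range \<iota>) \<subseteq> ?S" by (intro closure_minimal) auto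
  then show ?thesis using dense_\<iota> by auto
qed

lemma borel_prob_\<mu>0: "prob_space \<mu>0" "sets \<mu>0 = sets borel"
  using gibbs by (auto simp: free_gibbs_measure_def borel_prob_def)

text \<open>On finite combinations of the \<open>E v\<close> the inverse of \<open>A\<close> is
  explicit, because each \<open>E v\<close> is an eigenvector. Symmetry of \<open>A\<close> makes
  the complex covariance real, and its real part is computed in the real orthonormal system
  \<open>E\<close>.\<close>

lemma char_\<mu>0:
  assumes J: "finite J"
  shows "(CLINT u|\<mu>0. iexp (inner u (\<Sum>v\<in>J. w v *\<^sub>R z v))) = complex_of_real (exp (- (\<Sum>v\<in>J. (w v)\<^sup>2 / \<kappa> v) / 2))"
proof -
  let ?W = "\<Sum>v\<in>J. w v *\<^sub>R E v" and ?W' = "\<Sum>v\<in>J. (w v / lam (fst v)) *\<^sub>R E v"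
  have AW: "?W' \<in> D" "A ?W' = ?W"
    using sum_E_in_D[OF J, of "\<lambda>v. w v / lam (fst v)"] lam_pos by (auto simp: less_imp_neq[symmetric])
  have inv: "the_inv_into D A ?W = ?W'"
    using the_inv_into_f_f[OF inj_A AW(1)] by (simp add: AW(2))
  have "cinner ?W' (A ?W') = cinner (A ?W') ?W'"
    using self_adj AW(1) unfolding self_adjoint_def by blast
  then have sym: "cinner ?W ?W' = cnj (cinner ?W ?W')"
    using cinner_commute[of ?W ?W'] by (simp add: AW(2))
  have "Re (cinner ?W ?W') = (\<Sum>v\<in>J. (w v)\<^sup>2 / lam (fst v))"
  proof -
    have "Re (cinner ?W ?W') = (\<Sum>v\<in>J. \<Sum>v'\<in>J. if v = v' then w v * (w v / lam (fst v)) else 0)"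
      unfolding inner_eq_Re_cinner[symmetric] inner_sum_left unfolding inner_sum_right
      by (intro sum.cong refl) (simp add: inner_E)
    also have "\<dots> = (\<Sum>v\<in>J. w v * (w v / lam (fst v)))"
      using J by (intro sum.cong refl) simp
    finally show ?thesis by (simp add: power2_eq_square)
  qed
  moreover have "Im (cinner ?W ?W') = 0" using arg_cong[OF sym, of Im] by simp
  ultimately have ci: "cinner ?W ?W' = complex_of_real (\<Sum>v\<in>J. (w v)\<^sup>2 / lam (fst v))"
    by (simp add: complex_eq_iff)
  have "?W \<in> sobolev e lam s"
  proof -
    have "summable (\<lambda>j. (lam j powr (s / 2) * cmod (cinner (e j) ?W))\<^sup>2)"
    proof (rule summable_finite[of "fst ` J"])
      fix j assume j: "j \<notin> fst ` J"
      have "cinner (e j) (E v) = 0" if "v \<in> J" for v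
        using that j by (cases v) (force simp: E_def cinner_scaleC_right cinner_e)
      then show "(lam j powr (s / 2) * cmod (cinner (e j) ?W))\<^sup>2 = 0"
        by (simp add: cinner_sum_right cinner_scaleR_right)
    qed (use J in simp)
    then show ?thesis by (simp add: sobolev_def op_powr_domain_def)
  qed
  then have "(CLINT u|\<mu>0. iexp (dual_pairing \<iota> u ?W)) = exp (- (1 / (2 * complex_of_real \<beta>)) * cinner ?W (the_inv_into D A ?W))"
    using gibbs by (simp add: free_gibbs_measure_def)
  also have "- (1 / (2 * complex_of_real \<beta>)) * cinner ?W (the_inv_into D A ?W)
     = complex_of_real (- (1 / (2 * \<beta>)) * (\<Sum>v\<in>J. (w v)\<^sup>2 / lam (fst v)))"
    unfolding inv ci by simp
  also have "- (1 / (2 * \<beta>)) * (\<Sum>v\<in>J. (w v)\<^sup>2 / lam (fst v)) = - (\<Sum>v\<in>J. (w v)\<^sup>2 / \<kappa> v) / 2"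
    using \<beta>_pos by (simp add: \<kappa>_def sum_distrib_left sum_divide_distrib sum_negf field_simps)
  finally show ?thesis by (simp only: dual_pairing_sum exp_of_real)
qed

sublocale frame: gaussian_frame \<mu>0 z d \<kappa>
proof (rule gaussian_frame.intro)
  show "\<And>v. \<kappa> v > 0" using lam_pos \<beta>_pos by (simp add: \<kappa>_def)
  show "\<And>v v'. inner (d v) (z v') = (if v = v' then 1 else 0)"
    by (simp add: d_def inner_\<iota>_z inner_E)
qed (rule borel_prob_\<mu>0 dense_z char_\<mu>0, assumption?)+

end

section \<open>Cylindrical functions and the KMS condition\<close>

lemma Cc_infinity_cutoff:
  assumes g: "\<And>k. Ck m k g" "\<And>x y. (\<And>i. i < m \<Longrightarrow> x i = y i) \<Longrightarrow> g x = g y" and R: "R > 0"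
  shows "(\<lambda>x. g x * (\<Prod>i<m. plateau (x i / R))) \<in> Cc_infinity m"
  unfolding Cc_infinity_def
proof (intro CollectI conjI allI impI)
  fix x y :: "nat \<Rightarrow> real" assume "\<forall>i<m. x i = y i"
  then show "g x * (\<Prod>i<m. plateau (x i / R)) = g y * (\<Prod>i<m. plateau (y i / R))"
    using g(2)[of x y] by simp
next
  fix k
  have "kdiff k (\<lambda>t. plateau (t / R))"
    using kdiff_affine[OF kdiff_plateau, of k "1 / R" 0] by simp
  then show "Ck m k (\<lambda>x. g x * (\<Prod>i<m. plateau (x i / R)))"
    by (intro Ck_mult g Ck_prod Ck_coordinate[where \<theta> = "\<lambda>t. plateau (t / R)"]) auto
next
  show "\<exists>C. \<forall>x. g x * (\<Prod>i<m. plateau (x i / R)) \<noteq> 0 \<longrightarrow> (\<forall>i<m. \<bar>x i\<bar> \<le> C)"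
  proof (intro exI[of _ "2 * R"] allI impI, rule ccontr)
    fix x i assume nz: "g x * (\<Prod>i<m. plateau (x i / R)) \<noteq> 0" and i: "i < m" "\<not> \<bar>x i\<bar> \<le> 2 * R"
    then have "plateau (x i / R) = 0"
      using R by (intro plateau_eq) (simp add: field_simps)
    then have "(\<Prod>i<m. plateau (x i / R)) = 0" using i(1) by auto
    then show False using nz by simp
  qed
qed

lemma powr_2_abs: "\<bar>x\<bar> powr 2 = (x::real)\<^sup>2"
  by (cases "x = 0") simp_all

context free_gibbs
begin

abbreviation "cyl" where "cyl \<equiv> cyl_functions e \<iota>"
abbreviation dd where "dd v \<equiv> dir_deriv (d v)"

text \<open>The position of the frame coordinate \<open>v\<close> in the sequence
  \<open>P n\<close>; meaningful for \<open>fst v < n\<close>.\<close>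

definition idx :: "nat \<Rightarrow> nat \<times> bool \<Rightarrow> nat" where "idx n v = (if snd v then n + fst v else fst v)"

abbreviation P :: "nat \<Rightarrow> 'k \<Rightarrow> nat \<Rightarrow> real" where "P n \<equiv> cyl_proj e \<iota> n"

lemma P_eq: "P n u k = (if k < n then inner u (z (k, False)) else if k < 2 * n then inner u (z (k - n, True)) else 0)"
  using dual_pairing_E[of u "(k, False)"] dual_pairing_E[of u "(k - n, True)"]
  by (simp add: cyl_proj_def E_def)

lemma idx_less: "fst v < n \<Longrightarrow> idx n v < 2 * n"
  by (simp add: idx_def)

lemma P_idx: "fst v < n \<Longrightarrow> P n u (idx n v) = inner u (z v)"
  by (cases v) (auto simp: P_eq idx_def)

lemma P_shift: "P n (u + t *\<^sub>R d v) = (if fst v < n then (P n u)(idx n v := P n u (idx n v) + t) else P n u)"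
  by (cases v) (auto simp: fun_eq_iff P_eq idx_def inner_add_left frame.biorth)

lemma continuous_P: "continuous_on UNIV (P n)"
proof (rule continuous_on_coordinatewise_then_product)
  show "continuous_on UNIV (\<lambda>u. P n u k)" for k
    by (cases "k < n"; cases "k < 2 * n") (auto simp: P_eq intro!: continuous_intros)
qed

lemma cyl_continuous_bounded:
  assumes "\<phi> \<in> Cc_infinity m"
  shows "continuous_on UNIV (\<phi> \<circ> P n)" "\<exists>C. \<forall>u. \<bar>(\<phi> \<circ> P n) u\<bar> \<le> C"
proof -
  have "continuous_on (range (P n)) \<phi>"
    using Ck_continuous[OF Cc_infinity_CkD[OF assms, of 0]] by (rule continuous_on_subset) simp
  then show "continuous_on UNIV (\<phi> \<circ> P n)"
    by (rule continuous_on_compose[OF continuous_P])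
  show "\<exists>C. \<forall>u. \<bar>(\<phi> \<circ> P n) u\<bar> \<le> C"
    using Cc_infinity_bounded[OF assms] by auto
qed

lemma cyl_dir_deriv:
  assumes \<phi>: "\<phi> \<in> Cc_infinity (2 * n)"
  shows "dd v (\<phi> \<circ> P n) = (if fst v < n then partial_deriv (idx n v) \<phi> \<circ> P n else (\<lambda>_. 0))"
    and "C1b (d v) (\<phi> \<circ> P n) (dd v (\<phi> \<circ> P n))"
proof -
  define F' where "F' = (if fst v < n then partial_deriv (idx n v) \<phi> \<circ> P n else (\<lambda>_. 0))"
  have der: "((\<lambda>t. (\<phi> \<circ> P n) (u + t *\<^sub>R d v)) has_real_derivative F' u) (at 0)" for u
  proof (cases "fst v < n")
    case True
    have "((\<lambda>s. \<phi> ((P n u)(idx n v := s))) has_real_derivative partial_deriv (idx n v) \<phi> (P n u)) (at (P n u (idx n v) + 0))"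
      using Ck_partial_DERIV_self[OF Cc_infinity_CkD[OF \<phi>] idx_less[OF True], of "P n u"] by simp
    then have "((\<lambda>t. \<phi> ((P n u)(idx n v := P n u (idx n v) + t))) has_real_derivative partial_deriv (idx n v) \<phi> (P n u) * 1) (at 0)"
      by (rule DERIV_chain2) (auto intro!: derivative_eq_intros)
    then show ?thesis using True by (simp add: F'_def P_shift)
  next
    case False
    then show ?thesis by (simp add: F'_def P_shift)
  qed
  show eq: "dd v (\<phi> \<circ> P n) = (if fst v < n then partial_deriv (idx n v) \<phi> \<circ> P n else (\<lambda>_. 0))"
    unfolding dir_deriv_def[abs_def] DERIV_imp_deriv[OF der] by (simp add: F'_def)
  have "continuous_on UNIV F'" "\<exists>C. \<forall>u. \<bar>F' u\<bar> \<le> C"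
    using cyl_continuous_bounded[OF Cc_infinity_partial_deriv[OF \<phi> idx_less[of v n]], of n]
    by (auto simp: F'_def)
  then show "C1b (d v) (\<phi> \<circ> P n) (dd v (\<phi> \<circ> P n))"
    unfolding C1b_def eq F'_def[symmetric] using cyl_continuous_bounded[OF \<phi>, of n] der by auto
qed

text \<open>The symmetry of second derivatives is what the cancellation in
  \<open>kms_identity\<close> rests on; the number \<open>n\<close> of modes turns every series over
  \<open>j\<close> into a finite sum.\<close>

lemma cyl_properties:
  assumes "F \<in> cyl"
  obtains n where "\<And>v. C1b (d v) F (dd v F)"
    and "\<And>v w. C1b (d w) (dd v F) (dd w (dd v F))"
    and "\<And>v w. dd w (dd v F) = dd v (dd w F)"
    and "\<forall>v u. n \<le> fst v \<longrightarrow> dd v F u = 0"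
proof -
  obtain n \<phi> where F: "F = \<phi> \<circ> P n" and \<phi>: "\<phi> \<in> Cc_infinity (2 * n)"
    using assms by (auto simp: cyl_functions_def)
  have zero: "dd w (\<lambda>_. 0) = (\<lambda>_. 0)" "C1b (d w) (\<lambda>_. 0) (\<lambda>_. 0)" for w
    by (auto simp: dir_deriv_def[abs_def] C1b_def)
  have pd: "partial_deriv (idx n v) \<phi> \<in> Cc_infinity (2 * n)" if "fst v < n" for v
    using that by (intro Cc_infinity_partial_deriv \<phi> idx_less)
  show thesis
  proof (rule that[of n])
    show "C1b (d v) F (dd v F)" for v
      unfolding F by (rule cyl_dir_deriv[OF \<phi>])
    show "C1b (d w) (dd v F) (dd w (dd v F))" for v w
      unfolding F cyl_dir_deriv(1)[OF \<phi>, of v] using cyl_dir_deriv(2)[OF pd, of v w]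
      by (simp add: zero)
    show "dd w (dd v F) = dd v (dd w F)" for v w
      using partial_deriv_commute[OF Cc_infinity_CkD[OF \<phi>] idx_less[of v n] idx_less[of w n]]
      unfolding F cyl_dir_deriv(1)[OF \<phi>]
      by (auto simp: zero cyl_dir_deriv(1)[OF pd] fun_eq_iff)
    show "\<forall>v u. n \<le> fst v \<longrightarrow> dd v F u = 0"
      unfolding F cyl_dir_deriv(1)[OF \<phi>] by simp
  qed
qed

section \<open>Malliavin gradients and their components\<close>

lemma d_pairs: "\<iota> (e j) = d (j, False)" "\<iota> (\<i> *\<^sub>C e j) = d (j, True)"
  by (simp_all add: d_def E_def)

lemma dual_pairs: "dual_pairing \<iota> u (e j) = inner u (z (j, False))" "dual_pairing \<iota> u (\<i> *\<^sub>C e j) = inner u (z (j, True))"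
  using dual_pairing_E[of u "(j, False)"] dual_pairing_E[of u "(j, True)"] by (simp_all add: E_def)

lemma cyl_sums:
  assumes n: "\<forall>v u. n \<le> fst v \<longrightarrow> dd v F u = 0"
  shows "poisson_bracket e \<iota> F G u = (\<Sum>j<n. dd (j, False) F u * dd (j, True) G u
        - dd (j, False) G u * dd (j, True) F u)"
    and "linear_drift e lam \<iota> F u = (\<Sum>j<n. lam j * (dd (j, False) F u * inner u (z (j, True))
        - dd (j, True) F u * inner u (z (j, False))))"
    and "nonlinear_drift e \<iota> V F u = (\<Sum>j<n. dd (j, False) F u * inner (V u) (z (j, True))
        - dd (j, True) F u * inner (V u) (z (j, False)))"
    and "cyl_gradient e \<iota> F u = (\<Sum>j<n. dd (j, False) F u *\<^sub>R E (j, False) + dd (j, True) F u *\<^sub>R E (j, True))"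
  unfolding poisson_bracket_def linear_drift_def nonlinear_drift_def cyl_gradient_def d_pairs dual_pairs
  by (subst suminf_finite[of "{..<n}"]; simp add: n E_def)+

lemma inner_cyl_gradient:
  assumes n: "\<forall>v u. n \<le> fst v \<longrightarrow> dd v F u = 0"
  shows "inner (\<iota> (cyl_gradient e \<iota> F u)) (z v) = dd v F u"
proof -
  have "inner (\<iota> (cyl_gradient e \<iota> F u)) (z v) = (\<Sum>j<n. if j = fst v then dd v F u else 0)"
    unfolding inner_\<iota>_z cyl_sums(4)[OF n] inner_sum_left
    by (intro sum.cong refl) (cases v, auto simp: inner_add_left inner_E)
  also have "\<dots> = dd v F u" using n by (cases v) (auto simp: not_less)
  finally show ?thesis .
qed

text \<open>Pairing with \<open>z v\<close> is bounded on the completion, so by Cauchy-Schwarz the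
  norm convergence of the gradients passes to each component, and the components of a cylindrical
  gradient are its directional derivatives.\<close>

lemma malliavin_imp_W12:
  assumes "has_malliavin_gradient e \<iota> \<mu>0 2 F V"
  shows "W12 \<mu>0 (d v) F (\<lambda>u. inner (V u) (z v))"
proof -
  obtain Fn where Fn: "\<And>n. Fn n \<in> cyl" "tendsto_Lp \<mu>0 2 Fn F"
    "tendsto_Lp \<mu>0 2 (\<lambda>n u. \<iota> (cyl_gradient e \<iota> (Fn n) u)) V"
    and FV: "in_Lp \<mu>0 2 F" "in_Lp \<mu>0 2 V"
    using assms by (auto simp: has_malliavin_gradient_def)
  let ?grad = "\<lambda>n u. \<iota> (cyl_gradient e \<iota> (Fn n) u)"
  let ?nz = "ennreal ((norm (z v))\<^sup>2)" and ?err = "\<lambda>n u. ennreal (norm (?grad n u - V u) powr 2)"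
  let ?Fv = "\<lambda>n. dd v (Fn n)" and ?Vv = "\<lambda>u. inner (V u) (z v)"
  have [measurable]: "F \<in> borel_measurable \<mu>0" "V \<in> borel_measurable \<mu>0" using FV by (auto simp: in_Lp_def)
  have LF: "L2 \<mu>0 F"
    unfolding L2_def
  proof
    show "integrable \<mu>0 (\<lambda>u. (F u)\<^sup>2)"
      by (rule integrableI_bounded) (use FV(1) in \<open>auto simp: in_Lp_def powr_2_abs\<close>)
  qed measurable
  have cs: "ennreal ((inner x (z v))\<^sup>2) \<le> ?nz * ennreal (norm x powr 2)" for x
  proof -
    have "\<bar>inner x (z v)\<bar> \<le> norm x * norm (z v)" by (rule Cauchy_Schwarz_ineq2)
    then have "\<bar>inner x (z v)\<bar>\<^sup>2 \<le> (norm x * norm (z v))\<^sup>2" by (rule power_mono) simp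
    also have "\<dots> = (norm (z v))\<^sup>2 * (norm x powr 2)"
      using powr_2_abs[of "norm x"] by (simp add: power_mult_distrib)
    finally show ?thesis by (simp add: ennreal_leI flip: ennreal_mult)
  qed
  have LV: "L2 \<mu>0 (\<lambda>u. inner (V u) (z v))"
    unfolding L2_def
  proof
    show "integrable \<mu>0 (\<lambda>u. (?Vv u)\<^sup>2)"
    proof (rule integrableI_bounded)
      have "(\<integral>\<^sup>+u. ennreal (norm ((?Vv u)\<^sup>2)) \<partial>\<mu>0) \<le> (\<integral>\<^sup>+u. ?nz * ennreal (norm (V u) powr 2) \<partial>\<mu>0)"
        using cs by (intro nn_integral_mono) (simp only: real_norm_def abs_power2)
      also have "\<dots> = ?nz * (\<integral>\<^sup>+u. ennreal (norm (V u) powr 2) \<partial>\<mu>0)"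
        by (rule nn_integral_cmult) measurable
      also have "\<dots> < \<infinity>" using FV(2) by (simp add: in_Lp_def ennreal_mult_less_top)
      finally show "(\<integral>\<^sup>+u. ennreal (norm ((?Vv u)\<^sup>2)) \<partial>\<mu>0) < \<infinity>" .
    qed measurable
  qed measurable
  have C: "C1b (d v) (Fn n) (dd v (Fn n))" for v n
    by (rule cyl_properties[OF Fn(1)[of n]]) blast
  have sq: "(\<lambda>n. \<integral>u. (a n u)\<^sup>2 \<partial>\<mu>0) \<longlonglongrightarrow> 0"
    if a: "\<And>n. L2 \<mu>0 (a n)" "(\<lambda>n. \<integral>\<^sup>+u. ennreal ((a n u)\<^sup>2) \<partial>\<mu>0) \<longlonglongrightarrow> 0" for a :: "nat \<Rightarrow> 'k \<Rightarrow> real"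
  proof -
    have "(\<integral>\<^sup>+u. ennreal ((a n u)\<^sup>2) \<partial>\<mu>0) = ennreal (\<integral>u. (a n u)\<^sup>2 \<partial>\<mu>0)" for n
      using a(1)[of n] by (intro nn_integral_eq_integral) (auto simp: L2_def)
    with a(2) have "(\<lambda>n. ennreal (\<integral>u. (a n u)\<^sup>2 \<partial>\<mu>0)) \<longlonglongrightarrow> 0" by (simp only:)
    then show ?thesis by (rule iffD1[OF ennreal_tendsto_0_iff, rotated]) simp
  qed
  have c1: "(\<lambda>n. \<integral>u. (Fn n u - F u)\<^sup>2 \<partial>\<mu>0) \<longlonglongrightarrow> 0"
  proof (rule sq)
    show "L2 \<mu>0 (\<lambda>u. Fn n u - F u)" for n by (intro L2_diff frame.C1b_L2(1)[OF C[of v n]] LF)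
    show "(\<lambda>n. \<integral>\<^sup>+u. ennreal ((Fn n u - F u)\<^sup>2) \<partial>\<mu>0) \<longlonglongrightarrow> 0"
      using Fn(2) by (simp add: tendsto_Lp_def powr_2_abs)
  qed
  have c2: "(\<lambda>n. \<integral>u. (?Fv n u - ?Vv u)\<^sup>2 \<partial>\<mu>0) \<longlonglongrightarrow> 0"
  proof (rule sq)
    show "L2 \<mu>0 (\<lambda>u. ?Fv n u - ?Vv u)" for n
      by (intro L2_diff frame.C1b_L2(2)[OF C[of v n]] LV)
    have le: "(\<integral>\<^sup>+u. ennreal ((?Fv n u - ?Vv u)\<^sup>2) \<partial>\<mu>0)
        \<le> ?nz * (\<integral>\<^sup>+u. ?err n u \<partial>\<mu>0)" for n
    proof -
      obtain m where m: "\<forall>v u. m \<le> fst v \<longrightarrow> dd v (Fn n) u = 0"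
        by (rule cyl_properties[OF Fn(1)[of n]]) blast
      have dm[measurable]: "dd v (Fn n) \<in> borel_measurable \<mu>0" for v
        by (rule frame.C1b_measurable(2)[OF C])
      have "(\<lambda>u. ?grad n u) = (\<lambda>u. \<Sum>j<m. dd (j, False) (Fn n) u *\<^sub>R \<iota> (E (j, False)) + dd (j, True) (Fn n) u *\<^sub>R \<iota> (E (j, True)))"
        by (simp add: cyl_sums(4)[OF m] \<iota>_linear)
      then have [measurable]: "(\<lambda>u. ?grad n u) \<in> borel_measurable \<mu>0"
        by simp
      have "(\<integral>\<^sup>+u. ennreal ((?Fv n u - ?Vv u)\<^sup>2) \<partial>\<mu>0)
        \<le> (\<integral>\<^sup>+u. ?nz * ?err n u \<partial>\<mu>0)"
      proof (rule nn_integral_mono)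
        fix u
        show "ennreal ((?Fv n u - ?Vv u)\<^sup>2) \<le> ?nz * ?err n u"
          using cs[of "?grad n u - V u"] unfolding inner_diff_left inner_cyl_gradient[OF m] .
      qed
      also have "\<dots> = ?nz * (\<integral>\<^sup>+u. ?err n u \<partial>\<mu>0)"
        by (rule nn_integral_cmult) measurable
      finally show ?thesis .
    qed
    have "(\<lambda>n. ?nz * (\<integral>\<^sup>+u. ?err n u \<partial>\<mu>0)) \<longlonglongrightarrow> ?nz * 0"
      using Fn(3) unfolding tendsto_Lp_def by (intro tendsto_mult_ennreal tendsto_const) auto
    then have "(\<lambda>n. ?nz * (\<integral>\<^sup>+u. ?err n u \<partial>\<mu>0)) \<longlonglongrightarrow> 0" by simp
    then show "(\<lambda>n. \<integral>\<^sup>+u. ennreal ((?Fv n u - ?Vv u)\<^sup>2) \<partial>\<mu>0) \<longlonglongrightarrow> 0"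
      by (rule tendsto_sandwich[OF always_eventually always_eventually tendsto_const, rotated 2]) (use le in auto)
  qed
  show ?thesis unfolding W12_def
    by (intro conjI exI[of _ Fn] exI[of _ "\<lambda>n. dd v (Fn n)"] allI LF LV C c1 c2)
qed

section \<open>The KMS condition as a gradient equation\<close>

definition T :: "('k \<Rightarrow> real) \<Rightarrow> (nat \<times> bool \<Rightarrow> 'k \<Rightarrow> real) \<Rightarrow> ('k \<Rightarrow> 'k) \<Rightarrow> nat \<times> bool \<Rightarrow> 'k \<Rightarrow> real" where
  "T \<rho> V H v u = V v u + \<beta> * \<rho> u * inner (H u) (z v)"

text \<open>The pairing of the gradient of \<open>F\<close> with \<open>- \<i>\<close> times the
  vector whose components are \<open>T\<close>.\<close>

definition hamiltonian_defect ::
    "('k \<Rightarrow> real) \<Rightarrow> (nat \<times> bool \<Rightarrow> 'k \<Rightarrow> real) \<Rightarrow> ('k \<Rightarrow> 'k) \<Rightarrow> ('k \<Rightarrow> real) \<Rightarrow> 'k \<Rightarrow> real" where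
  "hamiltonian_defect \<rho> V H F u = (\<Sum>j. dd (j, False) F u * T \<rho> V H (j, True) u
      - dd (j, True) F u * T \<rho> V H (j, False) u)"

lemma C1b_mult_L2:
  assumes "C1b x f f'" "L2 \<mu>0 g"
  shows "L2 \<mu>0 (\<lambda>u. g u * f u)"
proof -
  obtain C where "\<And>u. \<bar>f u\<bar> \<le> C" using frame.C1b_bound[OF assms(1)] by blast
  then show ?thesis using frame.C1b_measurable[OF assms(1)] assms(2) by (intro L2_mult_bounded)
qed

text \<open>The function \<open>G * dd v F\<close> is integrated by parts in the direction
  \<open>w\<close> conjugate to \<open>v\<close>. Its derivative yields the Poisson bracket and a
  second derivative of \<open>F\<close>, which drops out in the difference over the two orders of a
  conjugate pair. The Gaussian term carries \<open>\<kappa> w = \<beta> * lam j\<close>, so it is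
  exactly \<open>\<beta>\<close> times the linear drift.\<close>

lemma kms_identity:
  assumes F: "F \<in> cyl" and G: "G \<in> cyl"
    and \<rho>: "\<And>v. W12 \<mu>0 (d v) \<rho> (V v)" and H: "\<And>v. L2 \<mu>0 (\<lambda>u. inner (H u) (z v))"
  shows "(\<integral>u. \<rho> u * poisson_bracket e \<iota> F G u \<partial>\<mu>0)
      - \<beta> * (\<integral>u. \<rho> u * ((linear_drift e lam \<iota> F u + nonlinear_drift e \<iota> H F u) * G u) \<partial>\<mu>0)
      = - (\<integral>u. G u * hamiltonian_defect \<rho> V H F u \<partial>\<mu>0)" (is "?L = ?R")
    and "poisson_bracket e \<iota> F G \<in> borel_measurable \<mu>0"
    and "(\<lambda>u. (linear_drift e lam \<iota> F u + nonlinear_drift e \<iota> H F u) * G u) \<in> borel_measurable \<mu>0"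
    and "integrable \<mu>0 (hamiltonian_defect \<rho> V H F)"
proof -
  obtain n where n: "\<And>v. C1b (d v) F (dd v F)"
    "\<And>v w. C1b (d w) (dd v F) (dd w (dd v F))"
    "\<And>v w. dd w (dd v F) = dd v (dd w F)"
    "\<forall>v u. n \<le> fst v \<longrightarrow> dd v F u = 0"
    by (rule cyl_properties[OF F]) blast
  have g: "\<And>v. C1b (d v) G (dd v G)"
    "\<And>v w. C1b (d w) (dd v G) (dd w (dd v G))"
    by (rule cyl_properties[OF G]; blast)+
  let ?drift = "\<lambda>u. (linear_drift e lam \<iota> F u + nonlinear_drift e \<iota> H F u) * G u"
  let ?P = "\<lambda>u. \<rho> u * poisson_bracket e \<iota> F G u" and ?defect = "hamiltonian_defect \<rho> V H F"
  let ?T = "T \<rho> V H"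
  have L: "L2 \<mu>0 \<rho>" "\<And>v. L2 \<mu>0 (V v)" using \<rho> by (auto simp: W12_def)
  have [measurable]: "\<rho> \<in> borel_measurable \<mu>0" "\<And>v. V v \<in> borel_measurable \<mu>0" "\<And>v. (\<lambda>u. inner (H u) (z v)) \<in> borel_measurable \<mu>0"
    using L H by (auto simp: L2_def)
  have Gm[measurable]: "G \<in> borel_measurable \<mu>0" by (rule frame.C1b_measurable(1)[OF g(1)])
  have dm[measurable]: "dd v F \<in> borel_measurable \<mu>0" "dd v G \<in> borel_measurable \<mu>0" for v
    by (rule frame.C1b_measurable(1)[OF n(2)], rule frame.C1b_measurable(1)[OF g(2)])
  let ?f = "\<lambda>v. dd v F" and ?g = "\<lambda>v. dd v G"
  let ?\<Phi> = "\<lambda>v u. G u * ?f v u" and ?\<Phi>' = "\<lambda>w v u. ?g w u * ?f v u + G u * dd w (?f v) u"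
  let ?X = "\<lambda>v u. inner u (z v)" and ?W = "\<lambda>v u. inner (H u) (z v)"
  have C\<Phi>: "C1b (d w) (?\<Phi> v) (?\<Phi>' w v)" for v w by (rule C1b_mult[OF g(1) n(2)])
  let ?A = "\<lambda>w v u. \<rho> u * (?\<Phi>' w v u - \<kappa> w * ?X w u * ?\<Phi> v u)"
  let ?C = "\<lambda>w v u. V w u * ?\<Phi> v u"
  let ?N = "\<lambda>w v u. \<beta> * (\<rho> u * ?\<Phi> v u * ?W w u)"
  have iA: "integrable \<mu>0 (?A w v)" for w v
    by (rule L2_integrable_mult[OF L(1) frame.L2_adjoint[OF C\<Phi>]])
  have iC: "integrable \<mu>0 (?C w v)" for w v
    by (rule L2_integrable_mult[OF L(2) frame.C1b_L2(1)[OF C\<Phi>]])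
  have iN: "integrable \<mu>0 (?N w v)" for w v
    by (intro integrable_mult_right L2_integrable_mult C1b_mult_L2[OF C\<Phi>] L H)
  have AC: "(\<integral>u. ?A w v u \<partial>\<mu>0) = - (\<integral>u. ?C w v u \<partial>\<mu>0)" for w v
    by (rule frame.W12_integration_by_parts[OF \<rho> C\<Phi>])
  note sums = cyl_sums(1-3)[OF n(4)]
  have defect: "?defect u = (\<Sum>j<n. ?f (j, False) u * ?T (j, True) u
      - ?f (j, True) u * ?T (j, False) u)" for u
    unfolding hamiltonian_defect_def by (subst suminf_finite[of "{..<n}"]) (auto simp: n(4))
  show m1: "poisson_bracket e \<iota> F G \<in> borel_measurable \<mu>0" unfolding sums[abs_def] by measurable
  show m2: "?drift \<in> borel_measurable \<mu>0"
    unfolding sums by measurable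
  have iT: "integrable \<mu>0 (\<lambda>u. ?f w u * ?T v u)" for v w
  proof -
    have "integrable \<mu>0 (\<lambda>u. V v u * ?f w u)"
      by (rule L2_integrable_mult[OF L(2) frame.C1b_L2(1)[OF n(2)]])
    moreover have "integrable \<mu>0 (\<lambda>u. \<beta> * ((\<rho> u * ?f w u) * ?W v u))"
      by (intro integrable_mult_right L2_integrable_mult C1b_mult_L2[OF n(2)] L H)
    ultimately have "integrable \<mu>0 (\<lambda>u. V v u * ?f w u + \<beta> * ((\<rho> u * ?f w u) * ?W v u))"
      by (rule Bochner_Integration.integrable_add)
    then show ?thesis by (simp add: T_def algebra_simps)
  qed
  show "integrable \<mu>0 (?defect)"
    unfolding defect[abs_def] by (intro Bochner_Integration.integrable_sum Bochner_Integration.integrable_diff iT)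
  have iP: "integrable \<mu>0 ?P"
  proof -
    have "integrable \<mu>0 (\<lambda>u. (\<rho> u * ?f v u) * ?g w u)" for v w
      by (rule L2_integrable_mult[OF C1b_mult_L2[OF n(2) L(1)] frame.C1b_L2(1)[OF g(2)]])
    then have "integrable \<mu>0 (\<lambda>u. \<Sum>j<n. (\<rho> u * ?f (j, False) u) * ?g (j, True) u - (\<rho> u * ?f (j, True) u) * ?g (j, False) u)"
      by (intro Bochner_Integration.integrable_sum Bochner_Integration.integrable_diff)
    then show ?thesis unfolding sums by (simp add: sum_distrib_left algebra_simps)
  qed
  have iD: "integrable \<mu>0 (\<lambda>u. \<rho> u * ?drift u)"
  proof -
    have "integrable \<mu>0 (\<lambda>u. (\<rho> u * ?\<Phi> v u) * ?X w u)" "integrable \<mu>0 (\<lambda>u. (\<rho> u * ?\<Phi> v u) * ?W w u)" for v w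
      by (intro L2_integrable_mult C1b_mult_L2[OF C\<Phi>] L H frame.L2_X)+
    then have "integrable \<mu>0 (\<lambda>u. \<Sum>j<n. lam j * ((\<rho> u * ?\<Phi> (j, False) u) * ?X (j, True) u - (\<rho> u * ?\<Phi> (j, True) u) * ?X (j, False) u)
        + ((\<rho> u * ?\<Phi> (j, False) u) * ?W (j, True) u - (\<rho> u * ?\<Phi> (j, True) u) * ?W (j, False) u))"
      by (intro Bochner_Integration.integrable_sum Bochner_Integration.integrable_add integrable_mult_right Bochner_Integration.integrable_diff)
    then show ?thesis unfolding sums by (simp add: sum_distrib_left sum_distrib_right sum.distrib[symmetric] algebra_simps)
  qed
  \<comment> \<open>The contributions of mode \<open>j\<close> before and after integration by
    parts: each \<open>?A\<close> integrates to minus the integral of \<open>?C\<close>, while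
    \<open>?N\<close>, the nonlinear drift, is carried along.\<close>
  let ?lhs = "\<lambda>j u. ?A (j, True) (j, False) u - ?A (j, False) (j, True) u - (?N (j, True) (j, False) u - ?N (j, False) (j, True) u)"
  let ?rhs = "\<lambda>j u. ?C (j, True) (j, False) u - ?C (j, False) (j, True) u + (?N (j, True) (j, False) u - ?N (j, False) (j, True) u)"
  have "?L = (\<integral>u. ?P u - \<beta> * (\<rho> u * ?drift u) \<partial>\<mu>0)"
    using iP iD by (subst Bochner_Integration.integral_diff) auto
  also have "\<dots> = (\<integral>u. (\<Sum>j<n. ?lhs j u) \<partial>\<mu>0)"
  proof (rule Bochner_Integration.integral_cong[OF refl])
    fix u
    have "?lhs j u = \<rho> u * (?f (j, False) u * ?g (j, True) u - ?g (j, False) u * ?f (j, True) u)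
        - \<beta> * (\<rho> u * ((lam j * (?f (j, False) u * ?X (j, True) u - ?f (j, True) u * ?X (j, False) u)
            + (?f (j, False) u * ?W (j, True) u - ?f (j, True) u * ?W (j, False) u)) * G u))" for j
      unfolding n(3)[of "(j, True)" "(j, False)"] by (simp add: \<kappa>_def algebra_simps)
    then show "?P u - \<beta> * (\<rho> u * ?drift u)
       = (\<Sum>j<n. ?lhs j u)"
      unfolding sums sum.distrib[symmetric] by (simp only: sum_distrib_left sum_distrib_right sum_subtractf[symmetric])
  qed
  also have "\<dots> = (\<Sum>j<n. \<integral>u. ?lhs j u \<partial>\<mu>0)"
    by (intro Bochner_Integration.integral_sum Bochner_Integration.integrable_diff iA iN)
  also have "\<dots> = (\<Sum>j<n. - (\<integral>u. ?rhs j u \<partial>\<mu>0))"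
  proof (intro sum.cong refl)
    fix j
    have "(\<integral>u. ?lhs j u \<partial>\<mu>0) = (\<integral>u. ?A (j, True) (j, False) u \<partial>\<mu>0) - (\<integral>u. ?A (j, False) (j, True) u \<partial>\<mu>0)
      - ((\<integral>u. ?N (j, True) (j, False) u \<partial>\<mu>0) - (\<integral>u. ?N (j, False) (j, True) u \<partial>\<mu>0))"
      by (simp only: Bochner_Integration.integral_diff Bochner_Integration.integrable_diff iA iN)
    moreover have "(\<integral>u. ?rhs j u \<partial>\<mu>0) = (\<integral>u. ?C (j, True) (j, False) u \<partial>\<mu>0) - (\<integral>u. ?C (j, False) (j, True) u \<partial>\<mu>0)
      + ((\<integral>u. ?N (j, True) (j, False) u \<partial>\<mu>0) - (\<integral>u. ?N (j, False) (j, True) u \<partial>\<mu>0))"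
      by (simp only: Bochner_Integration.integral_diff Bochner_Integration.integral_add Bochner_Integration.integrable_diff iC iN)
    ultimately show "(\<integral>u. ?lhs j u \<partial>\<mu>0) = - (\<integral>u. ?rhs j u \<partial>\<mu>0)"
      unfolding AC by linarith
  qed
  also have "\<dots> = - (\<integral>u. (\<Sum>j<n. ?rhs j u) \<partial>\<mu>0)"
    unfolding sum_negf
    by (subst Bochner_Integration.integral_sum) (intro Bochner_Integration.integrable_add Bochner_Integration.integrable_diff iC iN refl)+
  also have "(\<integral>u. (\<Sum>j<n. ?rhs j u) \<partial>\<mu>0) = (\<integral>u. G u * ?defect u \<partial>\<mu>0)"
    unfolding defect sum_distrib_left
    by (intro Bochner_Integration.integral_cong refl sum.cong) (simp add: T_def algebra_simps)
  finally show "?L = ?R" .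
qed

section \<open>Cylindrical functions as test functions\<close>

lemma cyl_cutoff:
  assumes "\<And>k. Ck (2 * n) k g" "\<And>x y. (\<And>i. i < 2 * n \<Longrightarrow> x i = y i) \<Longrightarrow> g x = g y" "R > 0" "1 \<le> n"
  shows "(\<lambda>u. g (P n u) * (\<Prod>i<2*n. plateau (P n u i / R))) \<in> cyl"
proof -
  have "(\<lambda>x. g x * (\<Prod>i<2*n. plateau (x i / R))) \<circ> P n \<in> cyl"
    unfolding cyl_functions_def using Cc_infinity_cutoff[OF assms(1-3)] assms(4) by blast
  then show ?thesis by (simp add: comp_def)
qed

text \<open>A character lacks compact support, but times a plateau of growing radius it is
  cylindrical. Dominated convergence removes the plateau, so the transform of \<open>S\<close>
  vanishes.\<close>

lemma AE_zero_if_orthogonal_to_cyl: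
  assumes S: "integrable \<mu>0 S" and orth: "\<And>G. G \<in> cyl \<Longrightarrow> (\<integral>u. G u * S u \<partial>\<mu>0) = 0"
  shows "AE u in \<mu>0. S u = 0"
proof -
  note [measurable] = borel_measurable_integrable[OF S]
  have main: "(\<integral>u. S u * \<theta> (inner u y) \<partial>\<mu>0) = 0"
    if y: "y \<in> span (range z)" and \<theta>: "\<And>k. kdiff k \<theta>" "\<And>x. \<bar>\<theta> x\<bar> \<le> 1" for y \<theta>
  proof -
    obtain J w where J: "finite J" and yJ: "y = (\<Sum>v\<in>J. w v *\<^sub>R z v)"
      using span_range_explicit[OF y] by metis
    obtain n where n: "1 \<le> n" "\<And>v. v \<in> J \<Longrightarrow> fst v < n"
    \<comment> \<open>\<open>insert 0\<close> keeps the maximum defined when \<open>J\<close> is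
      empty, and \<open>Suc\<close> gives both the strict bound and
      \<open>1 \<le> n\<close>.\<close>
    proof (rule that[of "Suc (Max (insert 0 (fst ` J)))"])
      show "fst v < Suc (Max (insert 0 (fst ` J)))" if "v \<in> J" for v
        using that J by (intro le_imp_less_Suc Max_ge) auto
    qed simp
    let ?L = "\<lambda>x. \<Sum>v\<in>J. w v * x (idx n v)"
    have L: "?L (P n u) = inner u y" for u
      using n by (simp add: yJ inner_sum_right P_idx)
    have Lc: "continuous_on UNIV ?L"
      by (intro continuous_intros continuous_on_coordinate)
    have Ck: "Ck (2 * n) k (\<lambda>x. \<theta> (?L x))" for k
    proof (rule Ck_compose_linear[OF \<theta>(1) Lc])
      fix i
      have "?L (x(i := t)) = ?L x + (\<Sum>v\<in>J. if idx n v = i then w v else 0) * (t - x i)" for x t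
        unfolding sum_distrib_right sum.distrib[symmetric]
        by (intro sum.cong) (auto simp: algebra_simps)
      then show "\<exists>c. \<forall>x t. ?L (x(i := t)) = ?L x + c * (t - x i)" by blast
    qed
    have dep: "\<theta> (?L x) = \<theta> (?L x')" if "\<And>i. i < 2 * n \<Longrightarrow> x i = x' i" for x x'
      using that n idx_less by (intro arg_cong[of _ _ \<theta>] sum.cong) auto
    let ?p = "\<lambda>k u. \<Prod>i<2*n. plateau (P n u i / real (Suc k))"
    have cyl: "(\<lambda>u. \<theta> (inner u y) * ?p k u) \<in> cyl" for k
      using cyl_cutoff[OF Ck dep _ n(1), of "real (Suc k)"] unfolding L by simp
    have z: "(\<integral>u. (\<theta> (inner u y) * ?p k u) * S u \<partial>\<mu>0) = 0" for k
      by (rule orth[OF cyl])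
    have pb: "\<bar>?p k u\<bar> \<le> 1" for k u
      unfolding abs_prod using plateau_range by (intro prod_le_1) (simp add: abs_of_nonneg)
    have pl: "(\<lambda>k. ?p k u) \<longlonglongrightarrow> 1" for u
    proof (rule tendsto_eventually)
      have "\<forall>\<^sub>F k in sequentially. \<forall>i\<in>{..<2*n}. \<bar>P n u i\<bar> \<le> real (Suc k)"
      proof (rule eventually_ball_finite[OF finite_lessThan], rule ballI)
        fix i
        obtain N where "\<bar>P n u i\<bar> \<le> real N" using real_arch_simple by blast
        then show "\<forall>\<^sub>F k in sequentially. \<bar>P n u i\<bar> \<le> real (Suc k)"
          by (intro eventually_sequentiallyI[of N]) linarith
      qed
      then show "\<forall>\<^sub>F k in sequentially. ?p k u = 1"
        by eventually_elim (intro prod.neutral ballI plateau_eq, simp del: of_nat_Suc)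
    qed
    have [measurable]: "(\<lambda>u. \<theta> (inner u y) * ?p k u) \<in> borel_measurable \<mu>0" for k
      by (rule cyl_properties[OF cyl[of k]]) (rule frame.C1b_measurable(1), blast)
    have [measurable]: "\<theta> \<in> borel_measurable borel"
      using kdiff_continuous[OF \<theta>(1)] by (rule borel_measurable_continuous_onI)
    have "(\<lambda>k. \<integral>u. (\<theta> (inner u y) * ?p k u) * S u \<partial>\<mu>0) \<longlonglongrightarrow> (\<integral>u. (\<theta> (inner u y) * 1) * S u \<partial>\<mu>0)"
    proof (rule integral_dominated_convergence[where w = "\<lambda>u. \<bar>S u\<bar>"])
      show "AE u in \<mu>0. (\<lambda>k. (\<theta> (inner u y) * ?p k u) * S u) \<longlonglongrightarrow> (\<theta> (inner u y) * 1) * S u"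
        by (intro AE_I2 tendsto_intros pl)
      show "AE u in \<mu>0. norm ((\<theta> (inner u y) * ?p k u) * S u) \<le> \<bar>S u\<bar>" for k
      proof (rule AE_I2)
        fix u
        have "\<bar>\<theta> (inner u y) * ?p k u\<bar> \<le> 1"
          unfolding abs_mult by (intro mult_le_one \<theta> pb) simp
        then show "norm ((\<theta> (inner u y) * ?p k u) * S u) \<le> \<bar>S u\<bar>"
          unfolding real_norm_def abs_mult[of _ "S u"] by (intro mult_left_le_one_le) auto
      qed
    qed (use S in \<open>auto simp del: of_nat_Suc\<close>)
    then have "(\<lambda>k::nat. 0) \<longlonglongrightarrow> (\<integral>u. (\<theta> (inner u y) * 1) * S u \<partial>\<mu>0)" unfolding z .
    then show ?thesis by (simp add: LIMSEQ_const_iff mult.commute)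
  qed
  show ?thesis
  proof (rule AE_zero_if_char_functional_zero[OF frame.finite_measure_axioms frame.sets_M S dense_z])
    show "(\<integral>u. S u * cos (inner u y + p) \<partial>\<mu>0) = 0" if "y \<in> span (range z)" for y p
      by (rule main[OF that kdiff_cos]) simp
  qed
qed

lemma AE_T_zero_if_defect_zero:
  assumes defect: "\<And>F. F \<in> cyl \<Longrightarrow> AE u in \<mu>0. hamiltonian_defect \<rho> V H F u = 0"
  shows "AE u in \<mu>0. T \<rho> V H w u = 0"
proof -
  txt \<open>Near \<open>u\<close> the function \<open>?F k\<close> is the coordinate \<open>?v\<close> conjugate to \<open>w\<close> once \<open>k\<close> is large.\<close>
  let ?v = "(fst w, \<not> snd w)" and ?n = "Suc (fst w)"
  let ?T = "T \<rho> V H"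
  let ?F = "\<lambda>k u. P ?n u (idx ?n ?v) * (\<Prod>i<2*?n. plateau (P ?n u i / real (Suc k)))"
  have F: "?F k \<in> cyl" for k
    by (rule cyl_cutoff[where g = "\<lambda>x. x (idx ?n ?v)"])
       (use idx_less[of ?v ?n] in \<open>auto intro: Ck_coordinate[OF kdiff_id]\<close>)
  \<comment> \<open>One null set serves all cutoffs, which allows \<open>k\<close> to be chosen
    depending on \<open>u\<close>.\<close>
  have "AE u in \<mu>0. \<forall>k. hamiltonian_defect \<rho> V H (?F k) u = 0"
    using defect[OF F] by (simp add: AE_all_countable)
  then show ?thesis
  proof eventually_elim
    case (elim u)
    have "\<exists>k. \<forall>i<2*?n. \<bar>P ?n u i\<bar> < real (Suc k)"
    proof -
      obtain k where k: "(\<Sum>i<2*?n. \<bar>P ?n u i\<bar>) \<le> real k" using real_arch_simple by blast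
      have "\<bar>P ?n u i\<bar> \<le> real k" if "i < 2*?n" for i
        using member_le_sum[of i "{..<2*?n}" "\<lambda>i. \<bar>P ?n u i\<bar>"] that k by simp
      then show ?thesis by (intro exI[of _ k]) fastforce
    qed
    then obtain k where k: "\<And>i. i < 2*?n \<Longrightarrow> \<bar>P ?n u i\<bar> < real (Suc k)" by blast
    \<comment> \<open>The strict bounds on the coordinates of \<open>u\<close> persist nearby along
      \<open>d v'\<close>, so there the plateau is 1 and \<open>?F k\<close> is the pure
      coordinate.\<close>
    have dirF: "dd v' (?F k) u = (if v' = ?v then 1 else 0)" for v'
      unfolding dir_deriv_def
    proof (rule DERIV_imp_deriv)
      have "\<forall>\<^sub>F t in nhds 0. \<forall>i\<in>{..<2*?n}. \<bar>P ?n (u + t *\<^sub>R d v') i\<bar> < real (Suc k)"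
      proof (rule eventually_ball_finite[OF finite_lessThan], rule ballI)
        fix i assume i: "i \<in> {..<2*?n}"
        have "continuous_on UNIV (\<lambda>t. \<bar>P ?n (u + t *\<^sub>R d v') i\<bar>)"
          by (cases "i < ?n"; cases "i < 2 * ?n") (auto simp: P_eq intro!: continuous_intros)
        then have "isCont (\<lambda>t. \<bar>P ?n (u + t *\<^sub>R d v') i\<bar>) 0" by (simp add: continuous_on_eq_continuous_at)
        then have "((\<lambda>t. \<bar>P ?n (u + t *\<^sub>R d v') i\<bar>) \<longlongrightarrow> \<bar>P ?n (u + 0 *\<^sub>R d v') i\<bar>) (nhds 0)"
          unfolding isCont_def by (rule iffD1[OF tendsto_at_iff_tendsto_nhds])
        then show "\<forall>\<^sub>F t in nhds 0. \<bar>P ?n (u + t *\<^sub>R d v') i\<bar> < real (Suc k)"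
          using k[of i] i by (intro order_tendstoD(2)) auto
      qed
      then have ev: "\<forall>\<^sub>F t in nhds 0. ?F k (u + t *\<^sub>R d v') = inner u (z ?v) + t * (if v' = ?v then 1 else 0)"
      proof eventually_elim
        case (elim t)
        have "(\<Prod>i<2*?n. plateau (P ?n (u + t *\<^sub>R d v') i / real (Suc k))) = 1"
          using elim by (intro prod.neutral ballI plateau_eq) (simp add: less_imp_le del: of_nat_Suc)
        moreover have "P ?n (u + t *\<^sub>R d v') (idx ?n ?v) = inner u (z ?v) + t * (if v' = ?v then 1 else 0)"
          by (subst P_idx) (auto simp: inner_add_left frame.biorth)
        ultimately show ?case by simp
      qed
      have "((\<lambda>t. inner u (z ?v) + t * (if v' = ?v then 1 else 0)) has_real_derivative (if v' = ?v then 1 else 0)) (at 0)"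
        by (auto intro!: derivative_eq_intros)
      then show "((\<lambda>t. ?F k (u + t *\<^sub>R d v')) has_real_derivative (if v' = ?v then 1 else 0)) (at 0)"
        by (subst DERIV_cong_ev[OF refl ev refl])
    qed
    have "hamiltonian_defect \<rho> V H (?F k) u = (\<Sum>j\<in>{fst w}. (if (j, False) = ?v then 1 else 0) * ?T (j, True) u
      - (if (j, True) = ?v then 1 else 0) * ?T (j, False) u)"
      unfolding hamiltonian_defect_def dirF by (rule suminf_finite) auto
    then have "(\<Sum>j\<in>{fst w}. (if (j, False) = ?v then 1 else 0) * ?T (j, True) u
      - (if (j, True) = ?v then 1 else 0) * ?T (j, False) u) = 0"
      using elim by (simp only:)
    then have "(if snd w then ?T w u else - ?T w u) = 0"
      by (cases w) auto
    then show ?case by (simp split: if_splits)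
  qed
qed

lemma KMS_iff_gradient_equation:
  assumes \<rho>: "\<And>v. W12 \<mu>0 (d v) \<rho> (V v)" and H: "\<And>v. L2 \<mu>0 (\<lambda>u. inner (H u) (z v))"
    and \<rho>0: "\<And>u. \<rho> u \<ge> 0" and prob: "borel_prob (density \<mu>0 (\<lambda>u. ennreal (\<rho> u)))"
  shows "KMS_state e lam \<iota> \<beta> H (density \<mu>0 (\<lambda>u. ennreal (\<rho> u))) \<longleftrightarrow> (\<forall>v. AE u in \<mu>0. T \<rho> V H v u = 0)"
proof -
  let ?\<mu> = "density \<mu>0 (\<lambda>u. ennreal (\<rho> u))" and ?S = "hamiltonian_defect \<rho> V H"
  have [measurable]: "\<rho> \<in> borel_measurable \<mu>0" using \<rho> by (auto simp: W12_def L2_def)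
  have dens: "(\<integral>u. f u \<partial>?\<mu>) = (\<integral>u. \<rho> u * f u \<partial>\<mu>0)"
    if "f \<in> borel_measurable \<mu>0" for f :: "'k \<Rightarrow> real"
    using that \<rho>0 by (subst integral_density) auto
  have "(\<integral>u. poisson_bracket e \<iota> F G u \<partial>?\<mu>)
      = \<beta> * (\<integral>u. (linear_drift e lam \<iota> F u + nonlinear_drift e \<iota> H F u) * G u \<partial>?\<mu>)
    \<longleftrightarrow> (\<integral>u. G u * ?S F u \<partial>\<mu>0) = 0"
    if F: "F \<in> cyl" "G \<in> cyl" for F G
    unfolding dens[OF kms_identity(2)[where \<rho> = \<rho> and V = V, OF F \<rho> H]] dens[OF kms_identity(3)[where \<rho> = \<rho> and V = V, OF F \<rho> H]]
    using kms_identity(1)[where V = V, OF F \<rho> H] by linarith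
  then have "KMS_state e lam \<iota> \<beta> H ?\<mu> \<longleftrightarrow> (\<forall>F\<in>cyl. \<forall>G\<in>cyl. (\<integral>u. G u * ?S F u \<partial>\<mu>0) = 0)"
    using prob by (simp add: KMS_state_def)
  also have "\<dots> \<longleftrightarrow> (\<forall>v. AE u in \<mu>0. T \<rho> V H v u = 0)"
  proof (intro iffI allI ballI)
    fix w assume *: "\<forall>F\<in>cyl. \<forall>G\<in>cyl. (\<integral>u. G u * ?S F u \<partial>\<mu>0) = 0"
    show "AE u in \<mu>0. T \<rho> V H w u = 0"
    proof (rule AE_T_zero_if_defect_zero)
      show "AE u in \<mu>0. ?S F u = 0" if F: "F \<in> cyl" for F
        by (rule AE_zero_if_orthogonal_to_cyl[OF kms_identity(4)[where \<rho> = \<rho> and V = V, OF F F \<rho> H]]) (use * F in blast)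
    qed
  next
    fix F G assume "\<forall>v. AE u in \<mu>0. T \<rho> V H v u = 0"
    \<comment> \<open>The index type is countable, so the exceptional sets of all components have a
      null union.\<close>
    then have "AE u in \<mu>0. \<forall>v. T \<rho> V H v u = 0" by (simp add: AE_all_countable)
    then have "AE u in \<mu>0. G u * ?S F u = 0"
      by eventually_elim (simp add: hamiltonian_defect_def)
    then show "(\<integral>u. G u * ?S F u \<partial>\<mu>0) = 0" by (rule integral_eq_zero_AE)
  qed
  finally show ?thesis .
qed

end

theorem theorem4p14:
  fixes D :: "'h::{complex_inner,complete_space,second_countable_topology} set"
    and A :: "'h \<Rightarrow> 'h"
    and c :: real
    and e :: "nat \<Rightarrow> 'h"
    and lam :: "nat \<Rightarrow> real"
    and s :: real
    and \<iota> :: "'h \<Rightarrow> 'k::{complex_inner,complete_space,second_countable_topology}"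
    and \<beta> :: real
    and \<mu>0 \<mu> :: "'k measure"
    and h \<rho> :: "'k \<Rightarrow> real"
  assumes "self_adjoint D A"
    and "c > 0"
    and "\<forall>x\<in>D. inner x (A x) \<ge> c * (norm x)\<^sup>2"
    and "compact_resolvent D A"
    and "orthonormal_basis e"
    and "\<forall>j. e j \<in> D \<and> A (e j) = lam j *\<^sub>R e j"
    and "s \<ge> 0"
    and "summable (\<lambda>j. lam j powr (- (1 + s)))"
    and "sobolev_completion e lam s \<iota>"
    and "\<beta> > 0"
    and "free_gibbs_measure D A e lam s \<iota> \<beta> \<mu>0"
    and "h \<in> borel_measurable borel"
    and "h \<in> malliavin_space e \<iota> \<mu>0 2"
    and "in_Lp \<mu>0 2 (\<lambda>u. exp (- \<beta> * h u))"
    and "borel_prob \<mu>"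
    and "absolutely_continuous \<mu>0 \<mu>"
    and "\<rho> \<in> borel_measurable borel"
    and "\<forall>u. \<rho> u \<ge> 0"
    and "integrable \<mu>0 \<rho>"
    and "\<mu> = density \<mu>0 (\<lambda>u. ennreal (\<rho> u))"
    and "\<rho> \<in> malliavin_space e \<iota> \<mu>0 2"
  shows "KMS_state e lam \<iota> \<beta> (malliavin_gradient e \<iota> \<mu>0 2 h) \<mu> \<longleftrightarrow> \<mu> = gibbs_measure \<beta> h \<mu>0"
proof -
  interpret free_gibbs D A c e lam s \<iota> \<beta> \<mu>0
    by (rule free_gibbs.intro) fact+
  let ?H = "malliavin_gradient e \<iota> \<mu>0 2 h"
  have "has_malliavin_gradient e \<iota> \<mu>0 2 h ?H"
    using assms(13) someI[of "has_malliavin_gradient e \<iota> \<mu>0 2 h"]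
    unfolding malliavin_gradient_def malliavin_space_def by blast
  then have h: "W12 \<mu>0 (d v) h (\<lambda>u. inner (?H u) (z v))" for v by (rule malliavin_imp_W12)
  then have H: "L2 \<mu>0 (\<lambda>u. inner (?H u) (z v))" for v by (simp add: W12_def)
  obtain V where "has_malliavin_gradient e \<iota> \<mu>0 2 \<rho> V"
    using assms(21) unfolding malliavin_space_def by blast
  then have \<rho>: "W12 \<mu>0 (d v) \<rho> (\<lambda>u. inner (V u) (z v))" for v by (rule malliavin_imp_W12)
  have [measurable]: "h \<in> borel_measurable \<mu>0" "\<rho> \<in> borel_measurable \<mu>0"
    using assms(12,17) by (auto simp: frame.meas_M)
  have \<rho>0: "\<And>u. \<rho> u \<ge> 0" using assms(18) by blast
  have prob: "borel_prob (density \<mu>0 (\<lambda>u. ennreal (\<rho> u)))" using assms(15,20) by simp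
  define Z where "Z = (\<integral>u. exp (- \<beta> * h u) \<partial>\<mu>0)"
  have kms: "KMS_state e lam \<iota> \<beta> ?H \<mu> \<longleftrightarrow> (\<forall>v. AE u in \<mu>0. inner (V u) (z v) + \<beta> * \<rho> u * inner (?H u) (z v) = 0)"
    unfolding assms(20) KMS_iff_gradient_equation[OF \<rho> H \<rho>0 prob] T_def ..
  have gibbs: "\<mu> = gibbs_measure \<beta> h \<mu>0 \<longleftrightarrow> (AE u in \<mu>0. \<rho> u = exp (- \<beta> * h u) / Z)"
  proof -
    have Z0: "Z \<ge> 0" by (simp add: Z_def)
    have "\<mu> = gibbs_measure \<beta> h \<mu>0 \<longleftrightarrow> (AE u in \<mu>0. ennreal (\<rho> u) = ennreal (exp (- \<beta> * h u) / Z))"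
      unfolding assms(20) gibbs_measure_def Z_def[symmetric]
      by (rule frame.density_unique_iff) measurable
    then show ?thesis using \<rho>0 Z0 by (simp add: ennreal_inj)
  qed
  show ?thesis unfolding kms gibbs
  proof (intro iffI allI)
    fix v assume "AE u in \<mu>0. \<rho> u = exp (- \<beta> * h u) / Z"
    then have "AE u in \<mu>0. \<rho> u = (1 / Z) * exp (- \<beta> * h u)" by simp
    then show "AE u in \<mu>0. inner (V u) (z v) + \<beta> * \<rho> u * inner (?H u) (z v) = 0"
      using frame.gibbs_density_imp_gradient[OF \<rho> h, of \<beta> "1 / Z"] assms(10) by simp
  next
    assume "\<forall>v. AE u in \<mu>0. inner (V u) (z v) + \<beta> * \<rho> u * inner (?H u) (z v) = 0"
    then have "\<exists>V W. W12 \<mu>0 (d v) \<rho> V \<and> W12 \<mu>0 (d v) h W \<and> (AE u in \<mu>0. V u + \<beta> * \<rho> u * W u = 0)" for v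
      using \<rho> h by blast
    then obtain C where C: "AE u in \<mu>0. \<rho> u = C * exp (- \<beta> * h u)"
      using frame.gradient_imp_gibbs_density[of \<rho> h \<beta>] assms(10) by auto
    have "ennreal (\<integral>u. \<rho> u \<partial>\<mu>0) = (\<integral>\<^sup>+u. ennreal (\<rho> u) \<partial>\<mu>0)"
      using assms(19) \<rho>0 by (subst nn_integral_eq_integral) auto
    also have "\<dots> = emeasure \<mu> (space \<mu>)"
      unfolding assms(20) by (subst emeasure_density) (auto intro!: nn_integral_cong)
    also have "\<dots> = 1"
      using assms(15) by (simp add: borel_prob_def prob_space.emeasure_space_1)
    finally have "(\<integral>u. \<rho> u \<partial>\<mu>0) = 1" by simp
    moreover have "(\<integral>u. \<rho> u \<partial>\<mu>0) = (\<integral>u. C * exp (- \<beta> * h u) \<partial>\<mu>0)"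
      by (rule integral_cong_AE) (use C in auto)
    \<comment> \<open>Total mass 1 determines the constant and at the same time shows that
      \<open>Z\<close> is not 0.\<close>
    ultimately have "C * Z = 1" by (simp add: Z_def)
    then have "C = 1 / Z" by (metis nonzero_eq_divide_eq mult_zero_right zero_neq_one)
    with C show "AE u in \<mu>0. \<rho> u = exp (- \<beta> * h u) / Z" by simp
  qed
qed

end
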